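(* Let $R$ be the hyperfinite ${\rm II}_1$ factor, let $\theta\in(0,1)$ be irrational, and let $u,v\in R$ be unitary operators with $R=\{u,v\}''$ and $vu=e^{2\pi i\theta}uv$. If $f\in C(S^1)$, then the spectral radius of $uf(v)$ is $r(uf(v))=\Delta(f(v))$.
   Context: $S^1$ is the unit circle in $\mathbb{C}$. $f(v)$ is defined by functional calculus of the unitary $v$. $\Delta(f(v))=\exp\left(\int_0^1\ln|f(e^{2\pi ix})|\,dx\right)$ is the Fuglede-Kadison determinant of $f(v)$, with the convention $\exp(-\infty)=0$. *)

theory Defs
  imports "HOL-Analysis.Analysis"
begin

text \<open>Complex Hilbert spaces; the inner product is linear in its second argument. The last axiom ties
  the norm to the inner product and makes the latter positive definite.\<close>

class complex_hilbert = banach +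
  fixes scaleC :: "complex \<Rightarrow> 'a \<Rightarrow> 'a"  (infixr "*\<^sub>C" 75)
    and cinner :: "'a \<Rightarrow> 'a \<Rightarrow> complex"
  assumes scaleC_add_right: "c *\<^sub>C (x + y) = c *\<^sub>C x + c *\<^sub>C y"
    and scaleC_add_left: "(c + d) *\<^sub>C x = c *\<^sub>C x + d *\<^sub>C x"
    and scaleC_scaleC: "c *\<^sub>C (d *\<^sub>C x) = (c * d) *\<^sub>C x"
    and scaleR_scaleC: "r *\<^sub>R x = complex_of_real r *\<^sub>C x"
    and cinner_commute: "cinner x y = cnj (cinner y x)"
    and cinner_add_right: "cinner x (y + z) = cinner x y + cinner x z"
    and cinner_scaleC_right: "cinner x (c *\<^sub>C y) = c * cinner x y"
    and cinner_self: "cinner x x = complex_of_real ((norm x)\<^sup>2)"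

lemma norm_scaleC: "norm (c *\<^sub>C x) = cmod c * norm (x :: 'h::complex_hilbert)"
proof -
  have "cinner (c *\<^sub>C x) (c *\<^sub>C x) = c * (cnj c * cinner x x)"
    by (metis cinner_commute cinner_scaleC_right complex_cnj_mult)
  also have "\<dots> = complex_of_real ((cmod c * norm x)\<^sup>2)"
    by (simp add: cinner_self power_mult_distrib complex_norm_square[symmetric] flip: mult.assoc of_real_power)
  finally have "(norm (c *\<^sub>C x))\<^sup>2 = (cmod c * norm x)\<^sup>2"
    by (simp only: cinner_self of_real_eq_iff)
  then show ?thesis
    by (simp add: power2_eq_iff_nonneg)
qed

text \<open>Operators are elements of the type of bounded real-linear maps; \<open>BH\<close> is the
  algebra of those that are complex-linear. Its operator norm is the one of that type.\<close>

definition BH :: "('h::complex_hilbert \<Rightarrow>\<^sub>L 'h) set" where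
  "BH = {T. \<forall>c x. blinfun_apply T (c *\<^sub>C x) = c *\<^sub>C blinfun_apply T x}"

lift_definition scalar_op :: "complex \<Rightarrow> ('h::complex_hilbert \<Rightarrow>\<^sub>L 'h)" is "\<lambda>c x. c *\<^sub>C x"
proof -
  fix c :: complex
  show "bounded_linear (\<lambda>x::'h. c *\<^sub>C x)"
    by (rule bounded_linear_intro[where K = "cmod c"])
       (simp_all add: scaleC_add_right scaleR_scaleC scaleC_scaleC norm_scaleC mult.commute)
qed

definition adj :: "('h::complex_hilbert \<Rightarrow>\<^sub>L 'h) \<Rightarrow> ('h \<Rightarrow>\<^sub>L 'h)" where
  "adj T = (THE S. \<forall>x y. cinner (blinfun_apply S x) y = cinner x (blinfun_apply T y))"

definition unitary :: "('h::complex_hilbert \<Rightarrow>\<^sub>L 'h) \<Rightarrow> bool" where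
  "unitary T \<longleftrightarrow> T \<in> BH \<and> adj T o\<^sub>L T = id_blinfun \<and> T o\<^sub>L adj T = id_blinfun"

definition spectrum :: "('h::complex_hilbert \<Rightarrow>\<^sub>L 'h) \<Rightarrow> complex set" where
  "spectrum T = {z. \<not> (\<exists>S\<in>BH. S o\<^sub>L (T - scalar_op z) = id_blinfun \<and>
                             (T - scalar_op z) o\<^sub>L S = id_blinfun)}"

definition spectral_radius :: "('h::complex_hilbert \<Rightarrow>\<^sub>L 'h) \<Rightarrow> real" where
  "spectral_radius T = (SUP z\<in>spectrum T. cmod z)"

text \<open>The continuous functional calculus of a normal operator \<open>a\<close>: the unital isometric
  *-homomorphism from the continuous functions on the spectrum of \<open>a\<close> that maps the identity
  function to \<open>a\<close>. It is unique on functions continuous on the spectrum; its values elsewhere are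
  irrelevant.\<close>

definition is_cfc ::
    "('h::complex_hilbert \<Rightarrow>\<^sub>L 'h) \<Rightarrow> ((complex \<Rightarrow> complex) \<Rightarrow> ('h \<Rightarrow>\<^sub>L 'h)) \<Rightarrow> bool" where
  "is_cfc a \<Phi> \<longleftrightarrow>
     (\<forall>c. \<Phi> (\<lambda>z. c) = scalar_op c) \<and>
     \<Phi> (\<lambda>z. z) = a \<and>
     (\<forall>f g. continuous_on (spectrum a) f \<and> continuous_on (spectrum a) g \<longrightarrow>
        \<Phi> (\<lambda>z. f z + g z) = \<Phi> f + \<Phi> g \<and> \<Phi> (\<lambda>z. f z * g z) = \<Phi> f o\<^sub>L \<Phi> g) \<and>
     (\<forall>f. continuous_on (spectrum a) f \<longrightarrow>
        \<Phi> f \<in> BH \<and> \<Phi> (\<lambda>z. cnj (f z)) = adj (\<Phi> f) \<and>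
        norm (\<Phi> f) = (SUP z\<in>spectrum a. cmod (f z)))"

definition cfc :: "('h::complex_hilbert \<Rightarrow>\<^sub>L 'h) \<Rightarrow> (complex \<Rightarrow> complex) \<Rightarrow> ('h \<Rightarrow>\<^sub>L 'h)" where
  "cfc a = (SOME \<Phi>. is_cfc a \<Phi>)"

definition commutant :: "('h::complex_hilbert \<Rightarrow>\<^sub>L 'h) set \<Rightarrow> ('h \<Rightarrow>\<^sub>L 'h) set" where
  "commutant A = {T\<in>BH. \<forall>S\<in>A. T o\<^sub>L S = S o\<^sub>L T}"

definition von_neumann_algebra :: "('h::complex_hilbert \<Rightarrow>\<^sub>L 'h) set \<Rightarrow> bool" where
  "von_neumann_algebra M \<longleftrightarrow> M \<subseteq> BH \<and> adj ` M \<subseteq> M \<and> commutant (commutant M) = M"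

definition factor :: "('h::complex_hilbert \<Rightarrow>\<^sub>L 'h) set \<Rightarrow> bool" where
  "factor M \<longleftrightarrow> von_neumann_algebra M \<and> M \<inter> commutant M = range scalar_op"

text \<open>The real span is used; real and complex finite-dimensionality agree.\<close>

definition finite_dimensional :: "('h::complex_hilbert \<Rightarrow>\<^sub>L 'h) set \<Rightarrow> bool" where
  "finite_dimensional M \<longleftrightarrow> (\<exists>B. finite B \<and> M \<subseteq> span B)"

text \<open>Normality is ultraweak continuity, i.e. being of the form \<open>T \<mapsto> \<Sum>n. cinner (x n) (T (y n))\<close>
  with square-summable \<open>x\<close> and \<open>y\<close>.\<close>

definition normal_functional ::
    "('h::complex_hilbert \<Rightarrow>\<^sub>L 'h) set \<Rightarrow> (('h \<Rightarrow>\<^sub>L 'h) \<Rightarrow> complex) \<Rightarrow> bool" where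
  "normal_functional M \<tau> \<longleftrightarrow>
     (\<exists>x y :: nat \<Rightarrow> 'h. summable (\<lambda>n. (norm (x n))\<^sup>2) \<and> summable (\<lambda>n. (norm (y n))\<^sup>2) \<and>
        (\<forall>T\<in>M. (\<lambda>n. cinner (x n) (blinfun_apply T (y n))) sums \<tau> T))"

definition faithful_normal_tracial_state ::
    "('h::complex_hilbert \<Rightarrow>\<^sub>L 'h) set \<Rightarrow> (('h \<Rightarrow>\<^sub>L 'h) \<Rightarrow> complex) \<Rightarrow> bool" where
  "faithful_normal_tracial_state M \<tau> \<longleftrightarrow>
     (\<forall>S\<in>M. \<forall>T\<in>M. \<tau> (S + T) = \<tau> S + \<tau> T) \<and>
     (\<forall>c. \<forall>T\<in>M. \<tau> (scalar_op c o\<^sub>L T) = c * \<tau> T) \<and>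
     \<tau> id_blinfun = 1 \<and>
     (\<forall>T\<in>M. \<tau> (adj T o\<^sub>L T) \<in> \<real>\<^sub>\<ge>\<^sub>0) \<and>
     (\<forall>T\<in>M. \<tau> (adj T o\<^sub>L T) = 0 \<longrightarrow> T = 0) \<and>
     (\<forall>S\<in>M. \<forall>T\<in>M. \<tau> (S o\<^sub>L T) = \<tau> (T o\<^sub>L S)) \<and>
     normal_functional M \<tau>"

definition II1_factor :: "('h::complex_hilbert \<Rightarrow>\<^sub>L 'h) set \<Rightarrow> bool" where
  "II1_factor M \<longleftrightarrow> factor M \<and> \<not> finite_dimensional M \<and>
     (\<exists>\<tau>. faithful_normal_tracial_state M \<tau>)"

definition hyperfinite :: "('h::complex_hilbert \<Rightarrow>\<^sub>L 'h) set \<Rightarrow> bool" where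
  "hyperfinite M \<longleftrightarrow>
     (\<exists>N :: nat \<Rightarrow> ('h \<Rightarrow>\<^sub>L 'h) set.
        (\<forall>n. von_neumann_algebra (N n) \<and> finite_dimensional (N n) \<and> N n \<subseteq> N (Suc n)) \<and>
        commutant (commutant (\<Union>n. N n)) = M)"

text \<open>On a \<open>II\<^sub>1\<close> factor the tracial state is unique, so the choice only matters outside \<open>M\<close>.\<close>

definition trace_of :: "('h::complex_hilbert \<Rightarrow>\<^sub>L 'h) set \<Rightarrow> ('h \<Rightarrow>\<^sub>L 'h) \<Rightarrow> complex" where
  "trace_of M = (SOME \<tau>. faithful_normal_tracial_state M \<tau>)"

definition abs_op :: "('h::complex_hilbert \<Rightarrow>\<^sub>L 'h) \<Rightarrow> ('h \<Rightarrow>\<^sub>L 'h)" where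
  "abs_op T = cfc (adj T o\<^sub>L T) (\<lambda>z. complex_of_real (sqrt (Re z)))"

text \<open>The Fuglede--Kadison determinant: \<open>exp (\<tau> (ln \<bar>T\<bar>))\<close> for invertible \<open>T\<close>, and
  the infimum (limit) over \<open>\<epsilon> > 0\<close> of the determinants of the invertible operators \<open>\<bar>T\<bar> + \<epsilon>\<close> in
  general. The trace of a self-adjoint operator is real.\<close>

definition fk_det :: "('h::complex_hilbert \<Rightarrow>\<^sub>L 'h) set \<Rightarrow> ('h \<Rightarrow>\<^sub>L 'h) \<Rightarrow> real" where
  "fk_det M T = (INF \<epsilon>\<in>{0<..}.
     exp (Re (trace_of M (cfc (abs_op T) (\<lambda>z. complex_of_real (ln (Re z + \<epsilon>)))))))"

text \<open>\<open>exp (\<integral>\<^sub>0\<^sup>1 ln \<bar>f(e\<^sup>2\<^sup>\<pi>\<^sup>i\<^sup>x)\<bar> dx)\<close>, with value 0 when the integral is \<open>-\<infinity>\<close>. For \<open>f\<close>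
  continuous on the circle \<open>ln \<bar>f\<bar>\<close> is bounded above, so the integral is \<open>-\<infinity>\<close> exactly if it is not
  finite. The condition on zeros is needed because \<open>ln 0 = 0\<close> in HOL instead of \<open>-\<infinity>\<close>.\<close>

definition exp_int_ln_circle :: "(complex \<Rightarrow> complex) \<Rightarrow> real" where
  "exp_int_ln_circle f =
     (let g = (\<lambda>x::real. cmod (f (exp (2 * complex_of_real pi * \<i> * complex_of_real x))))
      in if (AE x\<in>{0..1} in lborel. g x \<noteq> 0) \<and> set_integrable lborel {0..1} (\<lambda>x. ln (g x))
         then exp (LBINT x:{0..1}. ln (g x)) else 0)"

end

theory Submission
  imports Defs "HOL-Complex_Analysis.Cauchy_Integral_Formula"
begin

text \<open>Write \<open>\<lambda> = e\<^sup>2\<^sup>\<pi>\<^sup>i\<^sup>\<theta>\<close>. The relation \<open>vu = \<lambda>uv\<close> forces \<open>\<tau>(v\<^sup>k) = 0\<close> for \<open>k \<noteq> 0\<close>, so that \<open>\<tau>\<close> is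
  integration over the circle on the trigonometric polynomials in \<open>v\<close>; comparing norms of high
  powers with integrals shows that \<open>\<parallel>p(v)\<parallel>\<close> is the maximum of \<open>\<bar>p\<bar>\<close> on the whole circle. Moreover
  \<open>(u f(v))\<^sup>n = u\<^sup>n F\<^sub>n(v)\<close> with \<open>F\<^sub>n(z) = \<Prod>k<n. f(\<lambda>\<^sup>k z)\<close>, hence \<open>\<parallel>(u f(v))\<^sup>n\<parallel> = max \<bar>F\<^sub>n\<bar>\<close>. Uniform
  equidistribution of the irrational rotation, applied to \<open>ln (\<bar>f\<bar> + \<epsilon>)\<close>, bounds the spectral radius
  from above by the determinant. Conversely \<open>max \<bar>F\<^sub>n\<bar>\<close> is at least the geometric mean of \<open>\<bar>F\<^sub>n\<bar>\<close>, which
  is the \<open>n\<close>-th power of the determinant, and the spectral radius formula gives the lower bound.\<close>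

subsection \<open>Complex Hilbert spaces and adjoints\<close>

text \<open>If f has zeros, ln |f| is not continuous and equidistribution does not apply to it.
  Replacing |f| by |f| + \<epsilon> is harmless for upper bounds but points the wrong way for lower
  bounds. This is why the lower bound rests only on the rotation invariance of the average and on a
  maximum dominating a mean. The same \<epsilon> occurs in \<open>fk_det\<close>, so
  \<open>mahler\<close>, the infimum over \<epsilon> > 0 of exp of the average of ln (|f| +
  \<epsilon>), is the natural meeting point: spectral radius, determinant and circle integral are
  each shown equal to it. The other obstacle is that \<open>cfc\<close> is an arbitrary choice among
  the maps satisfying \<open>is_cfc\<close>. It becomes usable only after such a map has been
  constructed for \<open>v\<close>, by completing trigonometric polynomials in norm, and shown
  unique on continuous functions. That the spectrum of \<open>v\<close> is the whole circle comes
  out of the same construction, because a calculus over a compact set determines that set as the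
  spectrum.\<close>

lemma scaleC_one [simp]: "1 *\<^sub>C x = (x :: 'h::complex_hilbert)"
  using scaleR_scaleC[of 1 x] by simp

lemma scaleC_zero_left [simp]: "0 *\<^sub>C x = (0 :: 'h::complex_hilbert)"
  using scaleR_scaleC[of 0 x] by simp

lemma scaleC_zero_right [simp]: "c *\<^sub>C 0 = (0 :: 'h::complex_hilbert)"
  using norm_scaleC[of c 0] by simp

lemma scaleC_minus_right: "c *\<^sub>C (x - y) = c *\<^sub>C x - c *\<^sub>C (y :: 'h::complex_hilbert)"
  by (metis scaleC_add_right add_diff_cancel diff_add_cancel)

lemma cinner_add_left: "cinner (x + y) (z :: 'h::complex_hilbert) = cinner x z + cinner y z"
  by (metis cinner_add_right cinner_commute complex_cnj_add)

lemma cinner_scaleC_left: "cinner (c *\<^sub>C x) (y :: 'h::complex_hilbert) = cnj c * cinner x y"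
  by (metis cinner_scaleC_right cinner_commute complex_cnj_mult)

lemma cinner_zero_right [simp]: "cinner (x :: 'h::complex_hilbert) 0 = 0"
  using cinner_add_right[of x 0 0] by simp

lemma cinner_diff_right: "cinner (x :: 'h::complex_hilbert) (y - z) = cinner x y - cinner x z"
  by (metis cinner_add_right add_diff_cancel diff_add_cancel)

lemma cinner_diff_left: "cinner (y - z) (x :: 'h::complex_hilbert) = cinner y x - cinner z x"
  by (metis cinner_add_left add_diff_cancel diff_add_cancel)

lemma cinner_scaleR_right: "cinner (x :: 'h::complex_hilbert) (r *\<^sub>R y) = of_real r * cinner x y"
  by (simp add: scaleR_scaleC cinner_scaleC_right)

lemma cinner_scaleR_left: "cinner (r *\<^sub>R x) (y :: 'h::complex_hilbert) = of_real r * cinner x y"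
  by (simp add: scaleR_scaleC cinner_scaleC_left)

lemma cinner_eqI:
  assumes "\<And>z. cinner z x = cinner z (y :: 'h::complex_hilbert)"
  shows "x = y"
proof -
  have "cinner (x - y) (x - y) = 0" using assms by (simp add: cinner_diff_right)
  thus ?thesis by (simp add: cinner_self)
qed

lemma norm_add_square:
  "(norm (x + y))\<^sup>2 = (norm x)\<^sup>2 + (norm (y :: 'h::complex_hilbert))\<^sup>2 + 2 * Re (cinner x y)"
proof -
  have "cinner (x + y) (x + y) = cinner x x + cinner y y + (cinner x y + cnj (cinner x y))"
    by (simp add: cinner_add_left cinner_add_right cinner_commute[of y x])
  hence "Re (cinner (x + y) (x + y)) = Re (cinner x x) + Re (cinner y y) + 2 * Re (cinner x y)"
    by simp
  thus ?thesis by (simp add: cinner_self)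
qed

lemma norm_diff_square:
  "(norm (x - y))\<^sup>2 = (norm x)\<^sup>2 + (norm (y :: 'h::complex_hilbert))\<^sup>2 - 2 * Re (cinner x y)"
  using norm_add_square[of x "- y"] cinner_diff_right[of x 0 y] by simp

lemma Cauchy_Schwarz_cinner: "cmod (cinner x (y :: 'h::complex_hilbert)) \<le> norm x * norm y"
proof (cases "norm y = 0")
  case False
  \<comment> \<open>The vector c y is the orthogonal projection of x onto the line through y; the
    conjugate appears because the inner product is linear in its second argument.\<close>
  define c where "c = cnj (cinner x y) / of_real ((norm y)\<^sup>2)"
  have cc: "cinner x y * cnj (cinner x y) = of_real ((cmod (cinner x y))\<^sup>2)"
    by (simp only: complex_norm_square)
  have "Re (cinner x (c *\<^sub>C y)) = (cmod (cinner x y))\<^sup>2 / (norm y)\<^sup>2"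
    by (simp add: cinner_scaleC_right c_def cc mult.commute Re_divide_of_real del: of_real_power)
  moreover have "(norm (c *\<^sub>C y))\<^sup>2 = (cmod (cinner x y))\<^sup>2 / (norm y)\<^sup>2"
    using False by (simp add: norm_scaleC c_def norm_divide norm_mult power2_eq_square)
  moreover have "0 \<le> (norm (x - c *\<^sub>C y))\<^sup>2" by simp
  ultimately have "(cmod (cinner x y))\<^sup>2 / (norm y)\<^sup>2 \<le> (norm x)\<^sup>2"
    unfolding norm_diff_square by simp
  hence "(cmod (cinner x y))\<^sup>2 \<le> (norm x * norm y)\<^sup>2"
    using False by (simp add: divide_simps power_mult_distrib mult.commute)
  thus ?thesis by (simp add: power2_le_iff_abs_le)
qed simp

lemma bounded_linear_cinner: "bounded_linear (cinner (x :: 'h::complex_hilbert))"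
  by (rule bounded_linear_intro[where K = "norm x"])
     (auto simp: cinner_add_right cinner_scaleR_right scaleR_conv_of_real mult.commute
       intro: order_trans[OF Cauchy_Schwarz_cinner])

text \<open>The minimizer of \<open>\<parallel>w\<parallel>\<^sup>2 - 2 \<phi> w\<close> represents \<open>\<phi>\<close>; by the parallelogram law a minimizing
  sequence is Cauchy.\<close>

lemma Riesz_real:
  fixes \<phi> :: "'h::complex_hilbert \<Rightarrow> real"
  assumes "bounded_linear \<phi>"
  shows "\<exists>w. \<forall>h. \<phi> h = Re (cinner w h)"
proof -
  interpret bounded_linear \<phi> by fact
  obtain K where K: "\<And>h. \<bar>\<phi> h\<bar> \<le> norm h * K" "K > 0"
    using pos_bounded by auto
  define J where "J w = (norm w)\<^sup>2 - 2 * \<phi> w" for w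
  have J_ge: "J w \<ge> - K\<^sup>2" for w
  proof -
    have "0 \<le> (norm w - K)\<^sup>2" by simp
    moreover have "\<phi> w \<le> norm w * K" using K(1)[of w] by linarith
    ultimately show ?thesis by (simp add: J_def power2_diff)
  qed
  have bdd: "bdd_below (range J)" using J_ge by (meson bdd_belowI2)
  define m where "m = Inf (range J)"
  have m_le: "m \<le> J w" for w unfolding m_def using bdd by (auto intro: cINF_lower)
  have "\<exists>w. J w < m + inverse (real (Suc n))" for n
  proof -
    have "m < m + inverse (real (Suc n))" by simp
    thus ?thesis using bdd unfolding m_def by (subst (asm) cInf_less_iff) auto
  qed
  then obtain W where W: "\<And>n. J (W n) < m + inverse (real (Suc n))" by metis
  \<comment> \<open>The linear term of \<open>J\<close> cancels in this combination, so the
    parallelogram law for the norm carries over to \<open>J\<close>.\<close>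
  have par: "(norm (x - y))\<^sup>2 = 2 * J x + 2 * J y - 4 * J ((1/2) *\<^sub>R (x + y))" for x y
    by (simp add: J_def norm_add_square norm_diff_square cinner_scaleR_left cinner_scaleR_right
        cinner_add_left cinner_add_right cinner_commute[of y x] add scaleR power_mult_distrib
        power_divide algebra_simps)
  have dist: "(norm (W i - W j))\<^sup>2 \<le> 4 * inverse (real (Suc N))" if "i \<ge> N" "j \<ge> N" for i j N
  proof -
    have "inverse (real (Suc i)) \<le> inverse (real (Suc N))" "inverse (real (Suc j)) \<le> inverse (real (Suc N))"
      using that by (auto intro!: le_imp_inverse_le)
    thus ?thesis
      using par[of "W i" "W j"] W[of i] W[of j] m_le[of "(1/2) *\<^sub>R (W i + W j)"] by argo
  qed
  have "Cauchy W"
  proof (rule CauchyI)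
    fix e :: real assume "e > 0"
    then obtain N where N: "inverse (real (Suc N)) < e\<^sup>2 / 4"
      using reals_Archimedean[of "e\<^sup>2 / 4"] by auto
    have "norm (W i - W j) < e" if "i \<ge> N" "j \<ge> N" for i j
      by (rule power2_less_imp_less) (use dist[OF that] N \<open>e > 0\<close> in auto)
    thus "\<exists>M. \<forall>i\<ge>M. \<forall>j\<ge>M. norm (W i - W j) < e" by blast
  qed
  then obtain w where w: "W \<longlonglongrightarrow> w" using Cauchy_convergent convergent_def by blast
  have "(\<lambda>n. J (W n)) \<longlonglongrightarrow> J w" unfolding J_def
    by (intro tendsto_intros tendsto w)
  moreover have "(\<lambda>n. m + inverse (real (Suc n))) \<longlonglongrightarrow> m"
    using LIMSEQ_inverse_real_of_nat_add .
  ultimately have "J w \<le> m" using W by (meson LIMSEQ_le less_imp_le)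
  hence min: "J w \<le> J x" for x using m_le by (meson order_trans)
  have "\<phi> h = Re (cinner w h)" for h
  proof (cases "h = 0")
    case False
    define d where "d = Re (cinner w h) - \<phi> h"
    \<comment> \<open>This t minimizes the quadratic polynomial J (w + t h) - J w, so that
      minimality of w forces d = 0.\<close>
    define t where "t = - d / (norm h)\<^sup>2"
    have "J (w + t *\<^sub>R h) = J w + t\<^sup>2 * (norm h)\<^sup>2 + 2 * t * d"
      by (simp add: J_def norm_add_square add scaleR cinner_scaleR_right d_def
          power_mult_distrib algebra_simps)
    hence "0 \<le> t\<^sup>2 * (norm h)\<^sup>2 + 2 * t * d" using min[of "w + t *\<^sub>R h"] by simp
    also have "\<dots> = - d\<^sup>2 / (norm h)\<^sup>2"
      using False by (simp add: t_def field_simps power2_eq_square)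
    finally show ?thesis using False by (simp add: d_def divide_simps)
  qed simp
  thus ?thesis by blast
qed

text \<open>A complex-linear functional is determined by its real part, since Im (\<phi> h) = - Re
  (\<phi> (\<i> h)); the real representation therefore suffices.\<close>

lemma Riesz:
  fixes \<phi> :: "'h::complex_hilbert \<Rightarrow> complex"
  assumes "bounded_linear \<phi>" and scale: "\<And>c h. \<phi> (c *\<^sub>C h) = c * \<phi> h"
  shows "\<exists>w. \<forall>h. \<phi> h = cinner w h"
proof -
  obtain w where w: "\<And>h. Re (\<phi> h) = Re (cinner w h)"
    using Riesz_real[OF bounded_linear_compose[OF bounded_linear_Re assms(1)]] by auto
  have "Im (\<phi> h) = Im (cinner w h)" for h
    using w[of "\<i> *\<^sub>C h"] by (simp add: scale cinner_scaleC_right)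
  thus ?thesis using w by (metis complex_eqI)
qed

section \<open>Adjoints and the C*-identity\<close>

lemma BH_scaleC: "T \<in> BH \<Longrightarrow> blinfun_apply T (c *\<^sub>C x) = c *\<^sub>C blinfun_apply T x"
  by (simp add: BH_def)

lemma adj_exists:
  assumes "T \<in> BH"
  shows "\<exists>S. \<forall>x y. cinner (blinfun_apply S x) y = cinner x (blinfun_apply T y)"
proof -
  have "\<exists>w. \<forall>y. cinner x (T y) = cinner w y" for x
    by (rule Riesz) (use assms in \<open>auto intro: bounded_linear_compose[OF bounded_linear_cinner]
        blinfun.bounded_linear_right simp: BH_scaleC cinner_scaleC_right\<close>)
  then obtain S where S: "\<And>x y. cinner x (T y) = cinner (S x) y" by metis
  have S': "cinner y (S x) = cinner (T y) x" for x y
    by (metis S cinner_commute)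
  have "bounded_linear S"
  proof (rule bounded_linear_intro[where K = "norm T"])
    show "S (x + y) = S x + S y" for x y
      by (rule cinner_eqI) (simp add: S' cinner_add_right)
    show "S (r *\<^sub>R x) = r *\<^sub>R S x" for r x
      by (rule cinner_eqI) (simp add: S' cinner_scaleR_right)
    show "norm (S x) \<le> norm x * norm T" for x
    proof (cases "norm (S x) = 0")
      case False
      have "norm (S x) * norm (S x) = cmod (cinner (T (S x)) x)"
        by (simp add: S'[symmetric] cinner_self power2_eq_square norm_mult)
      also have "\<dots> \<le> norm (T (S x)) * norm x" by (rule Cauchy_Schwarz_cinner)
      also have "\<dots> \<le> (norm T * norm (S x)) * norm x"
        by (intro mult_right_mono norm_blinfun) auto
      finally show ?thesis using False by (simp add: mult_ac)
    qed simp
  qed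
  hence "\<forall>x y. cinner (blinfun_apply (Blinfun S) x) y = cinner x (blinfun_apply T y)"
    by (simp add: bounded_linear_Blinfun_apply S)
  thus ?thesis by blast
qed

text \<open>Makes the definite description in \<open>adj\<close> computable: inner products separate
  points, so at most one operator satisfies the defining identity.\<close>

lemma adj_eqI:
  assumes "\<And>x y. cinner (blinfun_apply S x) y = cinner x (blinfun_apply T y)"
  shows "adj T = S"
proof -
  have "S' = S" if "\<forall>x y. cinner (blinfun_apply S' x) y = cinner x (blinfun_apply T y)" for S'
  proof (rule blinfun_eqI, rule cinner_eqI)
    show "cinner z (blinfun_apply S' i) = cinner z (blinfun_apply S i)" for z i
      by (metis assms that cinner_commute)
  qed
  thus ?thesis unfolding adj_def using assms by (intro the_equality) auto
qed

lemma cinner_adj_left: "T \<in> BH \<Longrightarrow> cinner (blinfun_apply (adj T) x) y = cinner x (blinfun_apply T y)"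
  using adj_exists[of T] adj_eqI by metis

lemma cinner_adj_right: "T \<in> BH \<Longrightarrow> cinner x (blinfun_apply (adj T) y) = cinner (blinfun_apply T x) y"
  by (metis cinner_adj_left cinner_commute)

lemma BHI: "(\<And>c x. blinfun_apply T (c *\<^sub>C x) = c *\<^sub>C blinfun_apply T x) \<Longrightarrow> T \<in> BH"
  by (simp add: BH_def)

lemma adj_in_BH [simp]: "T \<in> BH \<Longrightarrow> adj T \<in> BH"
  by (rule BHI, rule cinner_eqI) (simp add: cinner_adj_right cinner_scaleC_right)

lemma id_in_BH [simp]: "id_blinfun \<in> BH" by (simp add: BH_def)
lemma zero_in_BH [simp]: "0 \<in> BH" by (simp add: BH_def)
lemma scalar_op_in_BH [simp]: "scalar_op c \<in> BH"
  by (simp add: BH_def scalar_op.rep_eq scaleC_scaleC mult.commute)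
lemma add_in_BH [simp]: "S \<in> BH \<Longrightarrow> T \<in> BH \<Longrightarrow> S + T \<in> BH"
  by (simp add: BH_def blinfun.bilinear_simps scaleC_add_right)
lemma diff_in_BH [simp]: "S \<in> BH \<Longrightarrow> T \<in> BH \<Longrightarrow> S - T \<in> BH"
  by (simp add: BH_def blinfun.bilinear_simps scaleC_minus_right)
lemma compose_in_BH [simp]: "S \<in> BH \<Longrightarrow> T \<in> BH \<Longrightarrow> S o\<^sub>L T \<in> BH"
  by (simp add: BH_def)

lemma BH_limit:
  assumes "\<And>n. T n \<in> BH" "T \<longlonglongrightarrow> S"
  shows "S \<in> BH"
proof (rule BHI)
  fix c x
  have 1: "(\<lambda>n. T n y) \<longlonglongrightarrow> S y" for y
    by (intro tendsto_intros assms)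
  have "bounded_linear ((*\<^sub>C) c :: 'a \<Rightarrow> 'a)"
    using blinfun.bounded_linear_right[of "scalar_op c"] by (simp add: scalar_op.rep_eq)
  hence "(\<lambda>n. c *\<^sub>C T n x) \<longlonglongrightarrow> c *\<^sub>C S x"
    using 1 bounded_linear.tendsto by blast
  moreover have "(\<lambda>n. c *\<^sub>C T n x) \<longlonglongrightarrow> S (c *\<^sub>C x)"
    using 1[of "c *\<^sub>C x"] assms(1) by (simp add: BH_scaleC)
  ultimately show "S (c *\<^sub>C x) = c *\<^sub>C S x" by (rule LIMSEQ_unique[symmetric])
qed

lemma adj_adj [simp]: "T \<in> BH \<Longrightarrow> adj (adj T) = T"
  by (rule adj_eqI) (simp add: cinner_adj_right)

lemma adj_compose: "S \<in> BH \<Longrightarrow> T \<in> BH \<Longrightarrow> adj (S o\<^sub>L T) = adj T o\<^sub>L adj S"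
  by (rule adj_eqI) (simp add: cinner_adj_left)

lemma adj_add: "S \<in> BH \<Longrightarrow> T \<in> BH \<Longrightarrow> adj (S + T) = adj S + adj T"
  by (rule adj_eqI) (simp add: cinner_adj_left blinfun.bilinear_simps cinner_add_left cinner_add_right)

lemma adj_diff: "S \<in> BH \<Longrightarrow> T \<in> BH \<Longrightarrow> adj (S - T) = adj S - adj T"
  by (rule adj_eqI) (simp add: cinner_adj_left blinfun.bilinear_simps cinner_diff_left cinner_diff_right)

lemma adj_scalar_op [simp]: "adj (scalar_op c) = scalar_op (cnj c)"
  by (rule adj_eqI) (simp add: scalar_op.rep_eq cinner_scaleC_left cinner_scaleC_right)

lemma adj_id [simp]: "adj id_blinfun = id_blinfun"
  by (rule adj_eqI) simp

text \<open>The substantial half of the C*-identity: the squared norm of T x is the inner product of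
  x with T*T x, to which Cauchy-Schwarz applies.\<close>

lemma norm_square_le_adj_compose_self:
  assumes "T \<in> BH"
  shows "(norm T)\<^sup>2 \<le> norm (adj T o\<^sub>L T)"
proof -
  have "norm T \<le> sqrt (norm (adj T o\<^sub>L T))"
  proof (rule norm_blinfun_bound)
    fix x
    have "(norm (T x))\<^sup>2 = cmod (cinner x ((adj T o\<^sub>L T) x))"
      using assms by (simp add: cinner_adj_right cinner_self norm_power)
    also have "\<dots> \<le> norm x * norm ((adj T o\<^sub>L T) x)" by (rule Cauchy_Schwarz_cinner)
    also have "\<dots> \<le> norm x * (norm (adj T o\<^sub>L T) * norm x)"
      by (intro mult_left_mono norm_blinfun) auto
    also have "\<dots> = (sqrt (norm (adj T o\<^sub>L T)) * norm x)\<^sup>2"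
      by (simp add: power_mult_distrib power2_eq_square)
    finally show "norm (T x) \<le> sqrt (norm (adj T o\<^sub>L T)) * norm x"
      by (rule power2_le_imp_le) auto
  qed auto
  hence "(norm T)\<^sup>2 \<le> (sqrt (norm (adj T o\<^sub>L T)))\<^sup>2" by (intro power_mono) auto
  thus ?thesis by simp
qed

lemma norm_adj [simp]:
  assumes "T \<in> BH"
  shows "norm (adj T) = norm T"
proof -
  have le: "norm S \<le> norm (adj S)" if "S \<in> BH" for S :: "'a \<Rightarrow>\<^sub>L 'a"
  proof (cases "norm S = 0")
    case False
    have "norm S * norm S \<le> norm (adj S) * norm S"
      using norm_square_le_adj_compose_self[OF that] norm_blinfun_compose[of "adj S" S]
      by (simp add: power2_eq_square)
    thus ?thesis using False by simp
  qed simp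
  show ?thesis using le[of T] le[of "adj T"] assms by (simp add: antisym)
qed

lemma norm_adj_compose_self:
  assumes "T \<in> BH"
  shows "norm (adj T o\<^sub>L T) = (norm T)\<^sup>2"
  using norm_square_le_adj_compose_self[OF assms] norm_blinfun_compose[of "adj T" T] assms
  by (simp add: power2_eq_square)

subsection \<open>Spectrum and norms of powers\<close>

lemma compose_assoc: "(A o\<^sub>L B) o\<^sub>L C = A o\<^sub>L (B o\<^sub>L C)"
  by (rule blinfun_eqI) simp

lemmas compose_distrib =
  bounded_bilinear.add_left[OF bounded_bilinear_blinfun_compose]
  bounded_bilinear.add_right[OF bounded_bilinear_blinfun_compose]
  bounded_bilinear.diff_left[OF bounded_bilinear_blinfun_compose]
  bounded_bilinear.diff_right[OF bounded_bilinear_blinfun_compose]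
  bounded_bilinear.minus_left[OF bounded_bilinear_blinfun_compose]
  bounded_bilinear.minus_right[OF bounded_bilinear_blinfun_compose]

lemma compose_id [simp]: "T o\<^sub>L id_blinfun = T" "id_blinfun o\<^sub>L T = T"
  by (rule blinfun_eqI, simp)+

lemma scalar_op_0 [simp]: "scalar_op 0 = 0"
  by (rule blinfun_eqI) (simp add: scalar_op.rep_eq)

lemma scalar_op_1 [simp]: "scalar_op 1 = id_blinfun"
  by (rule blinfun_eqI) (simp add: scalar_op.rep_eq)

lemma scalar_op_add: "scalar_op (c + d) = scalar_op c + scalar_op d"
  by (rule blinfun_eqI) (simp add: scalar_op.rep_eq scaleC_add_left blinfun.bilinear_simps)

lemma scalar_op_diff: "scalar_op (c - d) = scalar_op c - scalar_op d"
  by (metis scalar_op_add add_diff_cancel diff_add_cancel)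

lemma scalar_op_minus: "scalar_op (- c) = - scalar_op c"
  using scalar_op_diff[of 0 c] by simp

lemma scalar_op_mult: "scalar_op c o\<^sub>L scalar_op d = scalar_op (c * d)"
  by (rule blinfun_eqI) (simp add: scalar_op.rep_eq scaleC_scaleC)

lemma scalar_op_mult_compose: "scalar_op c o\<^sub>L (scalar_op d o\<^sub>L T) = scalar_op (c * d) o\<^sub>L T"
  by (simp flip: compose_assoc add: scalar_op_mult)

lemma scalar_op_commute: "T \<in> BH \<Longrightarrow> T o\<^sub>L scalar_op c = scalar_op c o\<^sub>L T"
  by (rule blinfun_eqI) (simp add: scalar_op.rep_eq BH_scaleC)

lemma scalar_op_left_commute:
  "T \<in> BH \<Longrightarrow> T o\<^sub>L (scalar_op c o\<^sub>L S) = scalar_op c o\<^sub>L (T o\<^sub>L S)"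
  by (simp flip: compose_assoc add: scalar_op_commute)

lemma norm_scalar_op_le: "norm (scalar_op c) \<le> cmod c"
  by (rule norm_blinfun_bound) (simp_all add: scalar_op.rep_eq norm_scaleC)

lemma norm_scalar_op_compose_le: "norm (scalar_op c o\<^sub>L T) \<le> cmod c * norm T"
  by (rule order_trans[OF norm_blinfun_compose]) (intro mult_right_mono norm_scalar_op_le norm_ge_zero)

primrec opow :: "('h::real_normed_vector \<Rightarrow>\<^sub>L 'h) \<Rightarrow> nat \<Rightarrow> ('h \<Rightarrow>\<^sub>L 'h)" where
  "opow T 0 = id_blinfun"
| "opow T (Suc n) = T o\<^sub>L opow T n"

lemma opow_commute: "opow T n o\<^sub>L T = T o\<^sub>L opow T n"
  by (induction n) (simp_all add: compose_assoc)

lemma opow_add: "opow T (m + n) = opow T m o\<^sub>L opow T n"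
  by (induction m) (simp_all add: compose_assoc)

lemma opow_in_BH [simp]: "T \<in> BH \<Longrightarrow> opow T n \<in> BH"
  by (induction n) simp_all

lemma norm_opow_le: "norm (opow T n) \<le> norm T ^ n"
proof (induction n)
  case (Suc n)
  thus ?case using norm_blinfun_compose[of T "opow T n"]
    by (simp add: order_trans[OF _ mult_left_mono])
qed (simp add: norm_blinfun_id_le)

definition invertible_op :: "('h::complex_hilbert \<Rightarrow>\<^sub>L 'h) \<Rightarrow> bool" where
  "invertible_op T \<longleftrightarrow> (\<exists>S\<in>BH. S o\<^sub>L T = id_blinfun \<and> T o\<^sub>L S = id_blinfun)"

lemma spectrum_iff: "z \<in> spectrum T \<longleftrightarrow> \<not> invertible_op (T - scalar_op z)"
  by (simp add: spectrum_def invertible_op_def)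

lemma invertible_op_scale:
  assumes "invertible_op T" "T \<in> BH" "c \<noteq> 0"
  shows "invertible_op (scalar_op c o\<^sub>L T)"
proof -
  obtain S where "S \<in> BH" "S o\<^sub>L T = id_blinfun" "T o\<^sub>L S = id_blinfun"
    using assms(1) by (auto simp: invertible_op_def)
  thus ?thesis using assms(3) unfolding invertible_op_def
    by (intro bexI[of _ "scalar_op (inverse c) o\<^sub>L S"])
       (auto simp: compose_assoc scalar_op_left_commute[OF \<open>S \<in> BH\<close>]
          scalar_op_left_commute[OF assms(2)] scalar_op_mult_compose scalar_op_mult)
qed

text \<open>An inverse S of the commuting product AB supplies the left inverse SB and the right
  inverse BS of A, and a left and a right inverse of the same operator coincide.\<close>

lemma invertible_op_factor:
  assumes "invertible_op (A o\<^sub>L B)" "A o\<^sub>L B = B o\<^sub>L A" "A \<in> BH" "B \<in> BH"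
  shows "invertible_op A"
proof -
  obtain S where S: "S \<in> BH" "S o\<^sub>L (A o\<^sub>L B) = id_blinfun" "(A o\<^sub>L B) o\<^sub>L S = id_blinfun"
    using assms(1) by (auto simp: invertible_op_def)
  have 1: "(S o\<^sub>L B) o\<^sub>L A = id_blinfun" using S(2) assms(2) by (simp add: compose_assoc)
  have 2: "A o\<^sub>L (B o\<^sub>L S) = id_blinfun" using S(3) by (simp add: compose_assoc)
  have "S o\<^sub>L B = ((S o\<^sub>L B) o\<^sub>L A) o\<^sub>L (B o\<^sub>L S)" using 2 by (simp add: compose_assoc)
  hence "S o\<^sub>L B = B o\<^sub>L S" by (simp only: 1 compose_id)
  thus ?thesis using 1 2 S(1) assms(3,4) unfolding invertible_op_def
    by (intro bexI[of _ "S o\<^sub>L B"]) auto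
qed

lemma invertible_op_Neumann:
  assumes "T \<in> BH" "norm T < 1"
  shows "invertible_op (id_blinfun - T)"
proof -
  have "summable (\<lambda>n. norm T ^ n)" using assms(2) by (intro summable_geometric) simp
  hence sm: "summable (opow T)"
    by (rule summable_comparison_test'[of _ 0]) (simp add: norm_opow_le)
  define S where "S = suminf (opow T)"
  have S: "opow T sums S" unfolding S_def using sm by (rule summable_sums)
  \<comment> \<open>The products of 1 - T with the powers of T telescope to 1, from the left and
    from the right.\<close>
  have tele: "(\<lambda>n. opow T n - opow T (Suc n)) sums id_blinfun"
    using telescope_sums'[OF summable_LIMSEQ_zero[OF sm]] by simp
  have "(\<lambda>n. (id_blinfun - T) o\<^sub>L opow T n) sums ((id_blinfun - T) o\<^sub>L S)"
    by (rule bounded_linear.sums[OF bounded_bilinear.bounded_linear_right[OF bounded_bilinear_blinfun_compose] S])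
  moreover have "(\<lambda>n. opow T n o\<^sub>L (id_blinfun - T)) sums (S o\<^sub>L (id_blinfun - T))"
    by (rule bounded_linear.sums[OF bounded_bilinear.bounded_linear_left[OF bounded_bilinear_blinfun_compose] S])
  ultimately have "(id_blinfun - T) o\<^sub>L S = id_blinfun" "S o\<^sub>L (id_blinfun - T) = id_blinfun"
    using sums_unique2[OF tele, symmetric] by (auto simp: compose_distrib opow_commute)
  moreover have "S \<in> BH"
  proof (rule BH_limit)
    show "(\<Sum>i<n. opow T i) \<in> BH" for n
      by (induction n) (simp_all add: assms(1))
  qed (use S in \<open>simp add: sums_def\<close>)
  ultimately show ?thesis unfolding invertible_op_def by blast
qed

text \<open>The geometric factorization of T^n - z^n, obtained recursively from T^(n+1) - z^(n+1) =
  T (T^n - z^n) + z^n (T - z). Commutation of the factors is carried along because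
  \<open>invertible_op_factor\<close> asks for it.\<close>

lemma opow_minus_scalar_factor:
  assumes T: "T \<in> BH"
  shows "\<exists>Q\<in>BH. opow T n - scalar_op (z ^ n) = (T - scalar_op z) o\<^sub>L Q \<and>
                (T - scalar_op z) o\<^sub>L Q = Q o\<^sub>L (T - scalar_op z)"
proof (induction n)
  case 0
  show ?case by (rule bexI[of _ 0]) auto
next
  case (Suc n)
  then obtain Q where Q: "Q \<in> BH" "opow T n - scalar_op (z ^ n) = (T - scalar_op z) o\<^sub>L Q"
    "(T - scalar_op z) o\<^sub>L Q = Q o\<^sub>L (T - scalar_op z)" by blast
  have TQ: "T o\<^sub>L Q = Q o\<^sub>L T"
    using Q(3) by (simp add: compose_distrib scalar_op_commute[OF Q(1)])
  have pow: "opow T n = (T o\<^sub>L Q) - (scalar_op z o\<^sub>L Q) + scalar_op (z ^ n)"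
    using Q(2) by (simp add: compose_distrib algebra_simps)
  define Q' where "Q' = (T o\<^sub>L Q) + scalar_op (z ^ n)"
  have "opow T (Suc n) - scalar_op (z ^ Suc n) = (T - scalar_op z) o\<^sub>L Q'"
    by (simp add: Q'_def pow compose_distrib scalar_op_commute[OF T] scalar_op_left_commute[OF T]
        scalar_op_mult)
  moreover have "(T - scalar_op z) o\<^sub>L Q' = Q' o\<^sub>L (T - scalar_op z)"
    by (simp add: Q'_def compose_distrib scalar_op_commute[OF T] scalar_op_commute[OF Q(1)]
        compose_assoc scalar_op_left_commute[OF T] scalar_op_mult mult.commute flip: TQ)
  ultimately show ?case using T Q(1) by (intro bexI[of _ Q']) (auto simp: Q'_def)
qed

text \<open>The easy half of Gelfand's formula. If |z|^n exceeded the norm of T^n, the Neumann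
  series would invert T^n - z^n, and with it the commuting factor T - z.\<close>

lemma spectrum_norm_power_le:
  assumes "T \<in> BH" "z \<in> spectrum T"
  shows "cmod z ^ n \<le> norm (opow T n)"
proof (rule ccontr)
  assume "\<not> ?thesis"
  hence lt: "norm (opow T n) < cmod z ^ n" by simp
  hence nz: "z ^ n \<noteq> 0" using norm_ge_zero[of "opow T n"]
    by (metis norm_power norm_zero not_less)
  define A where "A = scalar_op (inverse (z ^ n)) o\<^sub>L opow T n"
  have "norm A \<le> inverse (cmod z ^ n) * norm (opow T n)"
    unfolding A_def using norm_scalar_op_compose_le by (metis norm_inverse norm_power)
  also have "\<dots> < 1" using lt nz by (simp add: field_simps norm_power[symmetric])
  finally have "invertible_op (scalar_op (- (z ^ n)) o\<^sub>L (id_blinfun - A))"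
    using nz assms(1) by (intro invertible_op_scale invertible_op_Neumann) (auto simp: A_def)
  moreover have "scalar_op (- (z ^ n)) o\<^sub>L (id_blinfun - A) = opow T n - scalar_op (z ^ n)"
    using nz by (simp add: A_def compose_distrib scalar_op_minus scalar_op_mult_compose)
  ultimately have "invertible_op (T - scalar_op z)"
    using opow_minus_scalar_factor[OF assms(1), of n z] invertible_op_factor assms(1)
    by (metis diff_in_BH scalar_op_in_BH)
  thus False using assms(2) by (simp add: spectrum_iff)
qed

text \<open>The hard half of Gelfand's formula: the matrix coefficients of \<open>(1 - zT)\<^sup>-\<^sup>1\<close> are holomorphic
  on the disc of radius \<open>1/\<rho>\<close> with Taylor coefficients \<open>\<langle>x, T\<^sup>n y\<rangle>\<close>, so that Cauchy's inequality
  applies.\<close>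

lemma opow_bound_of_spectrum:
  fixes T :: "'h::complex_hilbert \<Rightarrow>\<^sub>L 'h"
  assumes T: "T \<in> BH" and \<rho>: "\<rho> > 0" and sp: "\<And>w. cmod w \<ge> \<rho> \<Longrightarrow> w \<notin> spectrum T"
  shows "\<exists>B. \<forall>n. norm (opow T n) \<le> B * \<rho> ^ n"
proof -
  define D where "D = cball (0::complex) (1 / \<rho>)"
  define M where "M z = id_blinfun - (scalar_op z o\<^sub>L T)" for z
  have "\<exists>R\<in>BH. R o\<^sub>L M z = id_blinfun \<and> M z o\<^sub>L R = id_blinfun" if z: "z \<in> D" for z
  proof (cases "z = 0")
    case True
    thus ?thesis by (intro bexI[of _ id_blinfun]) (auto simp: M_def)
  next
    case False
    \<comment> \<open>For z \<noteq> 0 one has 1 - zT = - z (T - 1/z), and |1/z| \<ge> \<rho> on the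
      closed disc \<open>D\<close>.\<close>
    hence "invertible_op (T - scalar_op (inverse z))"
      using sp[of "inverse z"] z \<rho> by (auto simp: spectrum_iff D_def norm_divide field_simps)
    hence "invertible_op (scalar_op (- z) o\<^sub>L (T - scalar_op (inverse z)))"
      using False T by (intro invertible_op_scale) auto
    also have "scalar_op (- z) o\<^sub>L (T - scalar_op (inverse z)) = M z"
      using False by (simp add: M_def compose_distrib scalar_op_minus scalar_op_mult)
    finally show ?thesis by (simp add: invertible_op_def)
  qed
  then obtain R where R: "\<And>z. z \<in> D \<Longrightarrow> R z \<in> BH" "\<And>z. z \<in> D \<Longrightarrow> R z o\<^sub>L M z = id_blinfun"
    "\<And>z. z \<in> D \<Longrightarrow> M z o\<^sub>L R z = id_blinfun" by metis
  \<comment> \<open>A resolvent identity. It yields the continuity of \<open>R\<close> and, after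
    division by z - w, the derivative of the matrix coefficients.\<close>
  have res: "R z - R w = scalar_op (z - w) o\<^sub>L (R z o\<^sub>L (T o\<^sub>L R w))" if "z \<in> D" "w \<in> D" for z w
  proof -
    have "R z - R w = (R z o\<^sub>L (M w o\<^sub>L R w)) - ((R z o\<^sub>L M z) o\<^sub>L R w)"
      using that R by simp
    also have "\<dots> = R z o\<^sub>L ((M w - M z) o\<^sub>L R w)"
      by (simp add: compose_distrib compose_assoc)
    also have "M w - M z = scalar_op (z - w) o\<^sub>L T"
      by (simp add: M_def compose_distrib scalar_op_diff)
    finally show ?thesis
      by (simp add: compose_assoc scalar_op_left_commute[OF R(1)[OF that(1)]])
  qed
  have cont: "continuous_on D R"
    unfolding continuous_on_def
  proof
    fix w assume w: "w \<in> D"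
    define C where "C = norm T * norm (R w) + 1"
    have C: "C > 0" "norm T * norm (R w) \<le> C" unfolding C_def by (auto intro: add_nonneg_pos)
    have bd: "norm (R z - R w) \<le> cmod (z - w) * (norm (R z) * C)" if "z \<in> D" for z
    proof -
      have "norm (R z o\<^sub>L (T o\<^sub>L R w)) \<le> norm (R z) * (norm T * norm (R w))"
        by (meson norm_blinfun_compose mult_left_mono norm_ge_zero order_trans)
      also have "\<dots> \<le> norm (R z) * C" using C by (intro mult_left_mono) auto
      finally show ?thesis
        unfolding res[OF that w] by (meson norm_scalar_op_compose_le mult_left_mono norm_ge_zero order_trans)
    qed
    \<comment> \<open>The estimate \<open>bd\<close> still contains the norm of R z. Near w the
      difference is at most half of that norm and can be absorbed, which gives a local bound in
      terms of R w alone.\<close>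
    have bd2: "norm (R z) \<le> 2 * norm (R w)" if "z \<in> D" "cmod (z - w) < 1 / (2 * C)" for z
    proof -
      have "cmod (z - w) * C \<le> 1 / 2" using that C by (simp add: field_simps)
      hence "(cmod (z - w) * C) * norm (R z) \<le> 1 / 2 * norm (R z)"
        by (intro mult_right_mono) auto
      hence "norm (R z - R w) \<le> 1 / 2 * norm (R z)" using bd[OF that(1)] by (simp add: mult_ac)
      thus ?thesis using norm_triangle_sub[of "R z" "R w"] by simp
    qed
    have "((\<lambda>z. R z - R w) \<longlongrightarrow> 0) (at w within D)"
    proof (rule Lim_null_comparison)
      have "eventually (\<lambda>z. z \<in> D \<and> dist z w < 1 / (2 * C)) (at w within D)"
        unfolding eventually_at using C by (intro exI[of _ "1 / (2 * C)"]) auto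
      thus "\<forall>\<^sub>F z in at w within D. norm (R z - R w) \<le> cmod (z - w) * (2 * norm (R w) * C)"
      proof eventually_elim
        case (elim z)
        have "norm (R z) * C \<le> 2 * norm (R w) * C"
          using bd2[of z] elim C by (intro mult_right_mono) (auto simp: dist_norm)
        thus ?case using bd[of z] elim by (meson mult_left_mono norm_ge_zero order_trans)
      qed
      show "((\<lambda>z. cmod (z - w) * (2 * norm (R w) * C)) \<longlongrightarrow> 0) (at w within D)"
        by (rule tendsto_eq_intros refl | simp)+
    qed
    thus "(R \<longlongrightarrow> R w) (at w within D)" using Lim_null by blast
  qed
  have "bounded (R ` D)" using cont by (intro compact_imp_bounded compact_continuous_image) (auto simp: D_def)
  then obtain B where B: "B > 0" "\<And>z. z \<in> D \<Longrightarrow> norm (R z) \<le> B"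
    unfolding bounded_pos by blast
  have RS: "R z = id_blinfun + (scalar_op z o\<^sub>L (T o\<^sub>L R z))" if "z \<in> D" for z
    using R(3)[OF that] by (simp add: M_def compose_distrib compose_assoc algebra_simps)
  have "norm (opow T n) \<le> B * \<rho> ^ n" for n
  proof (rule norm_blinfun_bound)
    show "B * \<rho> ^ n \<ge> 0" using B \<rho> by simp
    fix y
    \<comment> \<open>With this x the n-th Taylor coefficient of F is the squared norm of T^n y, so
      Cauchy's inequality for F turns into the desired bound after cancelling one factor.\<close>
    define x where "x = opow T n y"
    define F where "F z = cinner x (R z y)" for z
    define a where "a k = cinner x (opow T k y)" for k
    have bl: "bounded_linear (\<lambda>S. cinner x (blinfun_apply S y))"
      by (intro bounded_linear_compose[OF bounded_linear_cinner] blinfun.bounded_linear_left)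
    have contF: "continuous_on D F" unfolding F_def
      by (rule bounded_linear.continuous_on[OF bl cont])
    have FB: "cmod (F z) \<le> norm x * (B * norm y)" if "z \<in> D" for z
      unfolding F_def using B(2)[OF that]
      by (intro order_trans[OF Cauchy_Schwarz_cinner] mult_left_mono order_trans[OF norm_blinfun] mult_right_mono) auto
    have hol: "F holomorphic_on ball 0 (1 / \<rho>)"
    proof -
      have "(F has_field_derivative cinner x (R w (T (R w y)))) (at w)" if "w \<in> ball 0 (1 / \<rho>)" for w
      proof -
        have w: "w \<in> D" using that by (auto simp: D_def)
        have "((\<lambda>z. cinner x (R z (T (R w y)))) \<longlongrightarrow> cinner x (R w (T (R w y)))) (at w within ball 0 (1/\<rho>))"
        proof -
          have "continuous_on (ball 0 (1/\<rho>)) R" using cont by (rule continuous_on_subset) (auto simp: D_def)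
          hence "(R \<longlongrightarrow> R w) (at w within ball 0 (1/\<rho>))" using that by (simp add: continuous_on_def)
          thus ?thesis by (intro bounded_linear.tendsto[OF bounded_linear_cinner] tendsto_intros)
        qed
        hence "((\<lambda>z. (F z - F w) / (z - w)) \<longlongrightarrow> cinner x (R w (T (R w y)))) (at w within ball 0 (1/\<rho>))"
        proof (rule Lim_transform_eventually)
          have "eventually (\<lambda>z. z \<in> ball 0 (1/\<rho>) \<and> z \<noteq> w) (at w within ball 0 (1/\<rho>))"
            by (auto simp: eventually_at_topological)
          thus "\<forall>\<^sub>F z in at w within ball 0 (1 / \<rho>). cinner x (R z (T (R w y))) = (F z - F w) / (z - w)"
          proof eventually_elim
            case (elim z)
            hence "z \<in> D" by (auto simp: D_def)
            from arg_cong[OF res[OF this w], of "\<lambda>S. cinner x (blinfun_apply S y)"]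
            have "F z - F w = (z - w) * cinner x (R z (T (R w y)))"
              by (simp add: F_def blinfun.bilinear_simps cinner_diff_right scalar_op.rep_eq cinner_scaleC_right)
            thus ?case using elim by simp
          qed
        qed
        thus ?thesis using that by (simp add: has_field_derivative_iff at_within_open[of w "ball 0 (1/\<rho>)"])
      qed
      thus ?thesis unfolding holomorphic_on_open[OF open_ball] by blast
    qed
    \<comment> \<open>Iterating \<open>RS\<close> m times gives the Neumann expansion of R z with an
      exact remainder; it holds on all of \<open>D\<close>, before anything is known about
      convergence.\<close>
    have part: "F z = (\<Sum>k<m. a k * z ^ k) + z ^ m * cinner x (opow T m (R z y))" if "z \<in> D" for z m
    proof (induction m)
      case (Suc m)
      have "opow T m (R z y) = opow T m y + z *\<^sub>C opow T (Suc m) (R z y)"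
        using arg_cong[OF RS[OF that], of "\<lambda>S. blinfun_apply (opow T m o\<^sub>L S) y"] T
          arg_cong[OF opow_commute[of T m], of "\<lambda>S. blinfun_apply S (R z y)"]
        by (simp add: blinfun.bilinear_simps scalar_op.rep_eq BH_scaleC)
      hence "cinner x (opow T m (R z y)) = a m + z * cinner x (opow T (Suc m) (R z y))"
        by (metis a_def cinner_add_right cinner_scaleC_right)
      thus ?case using Suc.IH by (simp add: algebra_simps del: opow.simps)
    qed (simp add: F_def)
    have "F has_fps_expansion Abs_fps a"
    proof (rule has_fps_expansionI)
      \<comment> \<open>On this small disc |z| times the norm of T is below 1 and the remainder
        tends to 0. This is enough to identify the Taylor coefficients at 0; the bound on them comes
        from the full disc of radius 1/\<rho>.\<close>
      define \<delta> where "\<delta> = min (1 / \<rho>) (1 / (norm T + 1))"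
      have "\<delta> > 0" using \<rho> by (auto simp: \<delta>_def add_nonneg_pos)
      hence "eventually (\<lambda>z. z \<in> ball 0 \<delta>) (nhds 0)" by (intro eventually_nhds_in_open) auto
      thus "\<forall>\<^sub>F z in nhds 0. (\<lambda>k. fps_nth (Abs_fps a) k * z ^ k) sums F z"
      proof eventually_elim
        case (elim z)
        hence z: "z \<in> D" "cmod z < 1 / (norm T + 1)" by (auto simp: D_def \<delta>_def)
        have "cmod z * norm T \<le> cmod z * (norm T + 1)" by (intro mult_left_mono) auto
        also have "\<dots> < 1" using z(2) norm_ge_zero[of T] by (simp add: field_simps)
        finally have lt: "cmod z * norm T < 1" .
        have "(\<lambda>m. z ^ m * cinner x (opow T m (R z y))) \<longlonglongrightarrow> 0"
        proof (rule Lim_null_comparison)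
          have "cmod (z ^ m * cinner x (opow T m (R z y))) \<le> (cmod z * norm T) ^ m * (norm x * norm (R z y))" for m
          proof -
            have "norm (opow T m (R z y)) \<le> norm T ^ m * norm (R z y)"
              using norm_blinfun[of "opow T m"] norm_opow_le[of T m]
              by (meson mult_right_mono norm_ge_zero order_trans)
            hence "cmod (cinner x (opow T m (R z y))) \<le> norm x * (norm T ^ m * norm (R z y))"
              by (meson Cauchy_Schwarz_cinner mult_left_mono norm_ge_zero order_trans)
            hence "cmod z ^ m * cmod (cinner x (opow T m (R z y))) \<le> cmod z ^ m * (norm x * (norm T ^ m * norm (R z y)))"
              by (intro mult_left_mono) auto
            thus ?thesis by (simp add: norm_mult norm_power power_mult_distrib mult_ac)
          qed
          thus "\<forall>\<^sub>F m in sequentially. cmod (z ^ m * cinner x (opow T m (R z y))) \<le> (cmod z * norm T) ^ m * (norm x * norm (R z y))"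
            by simp
          show "(\<lambda>m. (cmod z * norm T) ^ m * (norm x * norm (R z y))) \<longlonglongrightarrow> 0"
            using lt by (intro tendsto_mult_left_zero LIMSEQ_power_zero) simp
        qed
        hence "(\<lambda>m. F z - z ^ m * cinner x (opow T m (R z y))) \<longlonglongrightarrow> F z - 0"
          by (intro tendsto_diff tendsto_const)
        also have "(\<lambda>m. F z - z ^ m * cinner x (opow T m (R z y))) = (\<lambda>m. \<Sum>k<m. a k * z ^ k)"
          by (intro ext) (metis part[OF z(1)] add_diff_cancel_right')
        finally show ?case by (simp add: sums_def)
      qed
    qed
    from fps_nth_fps_expansion[OF this, of n] have "(deriv ^^ n) F 0 = fact n * a n" by simp
    moreover have "norm ((deriv ^^ n) F 0) \<le> fact n * (norm x * (B * norm y)) / (1 / \<rho>) ^ n"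
      by (rule Cauchy_inequality[OF hol]) (use contF \<rho> FB in \<open>auto simp: D_def\<close>)
    ultimately have "cmod (a n) \<le> norm x * (B * norm y) * \<rho> ^ n"
      using \<rho> by (simp add: norm_mult field_simps)
    also have "cmod (a n) = norm x * norm x"
      by (simp add: a_def x_def[symmetric] cinner_self power2_eq_square norm_mult)
    finally have "norm x * norm x \<le> norm x * (B * \<rho> ^ n * norm y)" by (simp add: mult_ac)
    thus "norm (opow T n y) \<le> B * \<rho> ^ n * norm y"
      unfolding x_def[symmetric] using B \<rho> by (cases "norm x = 0") auto
  qed
  thus ?thesis by blast
qed

subsection \<open>Continuous functions on the circle\<close>

definition circ :: "real \<Rightarrow> complex" where
  "circ x = exp (2 * complex_of_real pi * \<i> * complex_of_real x)"

lemma circ_eq_cis: "circ x = cis (2 * pi * x)"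
  by (simp add: circ_def cis_conv_exp mult_ac)

lemma norm_circ [simp]: "cmod (circ x) = 1"
  by (simp add: circ_eq_cis)

lemma circ_in_sphere [simp]: "circ x \<in> sphere 0 1"
  by simp

lemma continuous_on_circ [continuous_intros]: "continuous_on A circ"
  unfolding circ_def by (intro continuous_intros)

lemma sphere_eq_circ: "z \<in> sphere 0 1 \<Longrightarrow> \<exists>x\<in>{0..1}. z = circ x"
proof -
  assume "z \<in> sphere 0 1"
  then obtain t where "0 \<le> t" "t < 2 * pi" "z = Complex (cos t) (sin t)"
    using complex_unimodular_polar[of z] by auto
  thus ?thesis by (intro bexI[of _ "t / (2 * pi)"]) (auto simp: circ_eq_cis complex_eq_iff)
qed

text \<open>Integration against normalized arc length, in the same parameter as
  \<open>exp_int_ln_circle\<close>.\<close>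

definition avg :: "(complex \<Rightarrow> 'b::{banach, second_countable_topology}) \<Rightarrow> 'b" where
  "avg g = (LBINT x:{0..1}. g (circ x))"

lemma set_integrable_circ:
  fixes g :: "complex \<Rightarrow> 'b::{banach, second_countable_topology}"
  assumes "continuous_on (sphere 0 1) g"
  shows "set_integrable lborel {0..1} (\<lambda>x. g (circ x))"
proof -
  have "continuous_on {0..1} (\<lambda>x. g (circ x))"
    by (rule continuous_on_compose2[OF assms]) (auto intro: continuous_intros)
  thus ?thesis unfolding set_integrable_def by (rule borel_integrable_compact[OF compact_Icc])
qed

lemma avg_cong: "(\<And>z. z \<in> sphere 0 1 \<Longrightarrow> f z = g z) \<Longrightarrow> avg f = avg g"
  by (simp add: avg_def)

lemma avg_add:
  assumes "continuous_on (sphere 0 1) f" "continuous_on (sphere 0 1) g"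
  shows "avg (\<lambda>z. f z + g z) = avg f + avg g"
  using assms unfolding avg_def by (intro set_integral_add set_integrable_circ)

lemma avg_diff:
  assumes "continuous_on (sphere 0 1) f" "continuous_on (sphere 0 1) g"
  shows "avg (\<lambda>z. f z - g z) = avg f - avg g"
  using assms unfolding avg_def by (intro set_integral_diff set_integrable_circ)

lemma avg_mult_left: "avg (\<lambda>z. c * g z) = c * avg (g :: complex \<Rightarrow> complex)"
  unfolding avg_def by simp

lemma avg_const [simp]: "avg (\<lambda>z. c :: 'b::euclidean_space) = c"
  unfolding avg_def set_lebesgue_integral_def by simp

lemma avg_sum:
  assumes "\<And>i. i \<in> I \<Longrightarrow> continuous_on (sphere 0 1) (f i :: _ \<Rightarrow> 'b::euclidean_space)" "finite I"
  shows "avg (\<lambda>z. \<Sum>i\<in>I. f i z) = (\<Sum>i\<in>I. avg (f i))"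
  using assms(2,1)
  by (induction) (auto simp: avg_add continuous_on_sum)

lemma avg_mono:
  fixes f g :: "complex \<Rightarrow> real"
  assumes "continuous_on (sphere 0 1) f" "continuous_on (sphere 0 1) g"
    "\<And>z. z \<in> sphere 0 1 \<Longrightarrow> f z \<le> g z"
  shows "avg f \<le> avg g"
  unfolding avg_def by (intro set_integral_mono set_integrable_circ assms circ_in_sphere)

lemma norm_avg_le:
  fixes g :: "complex \<Rightarrow> 'b::euclidean_space"
  assumes "continuous_on (sphere 0 1) g" "\<And>z. z \<in> sphere 0 1 \<Longrightarrow> norm (g z) \<le> M"
  shows "norm (avg g) \<le> M"
proof -
  have "norm (avg g) \<le> avg (\<lambda>z. norm (g z))"
    unfolding avg_def by (rule set_integral_norm_bound) (rule set_integrable_circ[OF assms(1)])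
  also have "\<dots> \<le> avg (\<lambda>z. M)"
    by (rule avg_mono) (use assms in \<open>auto intro!: continuous_intros\<close>)
  finally show ?thesis by simp
qed

lemma avg_of_real:
  "avg (\<lambda>z. complex_of_real (g z)) = complex_of_real (avg g)"
  unfolding avg_def by (rule set_integral_complex_of_real)

lemma avg_uniform_limit:
  fixes g :: "complex \<Rightarrow> 'b::euclidean_space"
  assumes "uniform_limit (sphere 0 1) p g sequentially" "\<And>n. continuous_on (sphere 0 1) (p n)"
  shows "(\<lambda>n. avg (p n)) \<longlonglongrightarrow> avg g"
proof (rule LIMSEQ_I)
  fix e :: real assume e: "e > 0"
  have cg: "continuous_on (sphere 0 1) g"
    by (rule uniform_limit_theorem[OF _ assms(1)]) (use assms in auto)
  have "\<forall>\<^sub>F n in sequentially. \<forall>z\<in>sphere 0 1. dist (p n z) (g z) < e / 2"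
    by (rule uniform_limitD[OF assms(1)]) (use e in simp)
  then obtain n0 where n0: "\<And>n z. n \<ge> n0 \<Longrightarrow> z \<in> sphere 0 1 \<Longrightarrow> dist (p n z) (g z) < e / 2"
    unfolding eventually_sequentially by blast
  have "norm (avg (p n) - avg g) \<le> e / 2" if "n \<ge> n0" for n
    unfolding avg_diff[OF assms(2) cg, symmetric]
    by (rule norm_avg_le) (use n0[OF that] assms(2) cg in \<open>auto intro!: continuous_intros less_imp_le simp: dist_norm\<close>)
  thus "\<exists>no. \<forall>n\<ge>no. norm (avg (p n) - avg g) < e" using e by (intro exI[of _ n0]) force
qed

lemma avg_power_int:
  "avg (\<lambda>z. z powi k) = (if k = 0 then 1 else 0)"
proof (cases "k = 0")
  case False
  define c where "c = 2 * complex_of_real pi * \<i> * of_int k"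
  have c: "c \<noteq> 0" using False by (simp add: c_def)
  have circ: "circ x powi k = exp (c * complex_of_real x)" for x
    by (simp add: circ_def c_def exp_power_int mult_ac)
  have "((\<lambda>x. exp (c * complex_of_real x)) has_integral
      exp (c * complex_of_real 1) / c - exp (c * complex_of_real 0) / c) {0..1}"
    by (rule fundamental_theorem_of_calculus)
       (auto intro!: derivative_eq_intros simp: c has_vector_derivative_complex_iff
         intro: has_vector_derivative_real_field)
  moreover have "exp c = 1"
    using exp_integer_2pi[of "of_int k"] by (simp add: c_def mult_ac)
  ultimately have "((\<lambda>x. circ x powi k) has_integral 0) {0..1}" by (simp add: circ)
  moreover have "set_integrable lborel {0..1} (\<lambda>x. circ x powi k)"
    by (rule set_integrable_circ) (auto intro!: continuous_intros)
  ultimately show ?thesis using False unfolding avg_def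
    by (simp add: set_borel_integral_eq_integral integral_unique)
qed simp

text \<open>Stone-Weierstrass as an induction rule: continuous functions on a compact set are
  uniform limits of polynomials in z and its conjugate. It serves for the density of trigonometric
  polynomials, for the uniqueness of the calculus and for moving \<open>u\<close> past the calculus
  of \<open>v\<close>.\<close>

lemma continuous_complex_induct:
  fixes f :: "complex \<Rightarrow> complex"
  assumes K: "compact K" and f: "continuous_on K f"
    and const: "\<And>c. P (\<lambda>z. c)"
    and ident: "P (\<lambda>z. z)"
    and cnj: "P (\<lambda>z. cnj z)"
    and add: "\<And>f g. continuous_on K f \<Longrightarrow> continuous_on K g \<Longrightarrow> P f \<Longrightarrow> P g \<Longrightarrow> P (\<lambda>z. f z + g z)"
    and mult: "\<And>f g. continuous_on K f \<Longrightarrow> continuous_on K g \<Longrightarrow> P f \<Longrightarrow> P g \<Longrightarrow> P (\<lambda>z. f z * g z)"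
    and lim: "\<And>f g. continuous_on K f \<Longrightarrow> (\<And>n. continuous_on K (g n)) \<Longrightarrow> (\<And>n. P (g n)) \<Longrightarrow>
          uniform_limit K g f sequentially \<Longrightarrow> P f"
  shows "P f"
proof -
  let ?Q = "\<lambda>f. continuous_on K f \<and> P f"
  have Qconst: "?Q (\<lambda>z. c)" for c using const by simp
  have Qid: "?Q (\<lambda>z. z)" "?Q (\<lambda>z. cnj z)"
    using ident cnj by (auto intro!: continuous_intros)
  have Qadd: "?Q (\<lambda>z. f z + g z)" if "?Q f" "?Q g" for f g
    using that add by (auto intro!: continuous_intros)
  have Qmult: "?Q (\<lambda>z. f z * g z)" if "?Q f" "?Q g" for f g
    using that mult by (auto intro!: continuous_intros)
  have real: "?Q (\<lambda>z. complex_of_real (p z))" if "real_polynomial_function p" for p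
    using that
  proof induction
    case (linear p)
    interpret bounded_linear p by fact
    \<comment> \<open>Real polynomials on the plane start from real-linear functionals; each of
      these is A z plus its conjugate, with A determined by the values at 1 and \<i>.\<close>
    define A where "A = (complex_of_real (p 1) - \<i> * complex_of_real (p \<i>)) / 2"
    have "complex_of_real (p z) = A * z + cnj A * cnj z" for z
    proof -
      have "z = Re z *\<^sub>R 1 + Im z *\<^sub>R \<i>" by (simp add: complex_eq_iff)
      hence "p z = Re z * p 1 + Im z * p \<i>" by (metis add scaleR real_scaleR_def)
      thus ?thesis by (simp add: A_def complex_eq_iff field_simps)
    qed
    thus ?case using Qadd[OF Qmult[OF Qconst Qid(1)] Qmult[OF Qconst Qid(2)], of A "cnj A"] by simp
  next
    case (const c)
    show ?case by (rule Qconst)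
  next
    case (add f g)
    thus ?case using Qadd[of "\<lambda>z. complex_of_real (f z)" "\<lambda>z. complex_of_real (g z)"] by simp
  next
    case (mult f g)
    thus ?case using Qmult[of "\<lambda>z. complex_of_real (f z)" "\<lambda>z. complex_of_real (g z)"] by simp
  qed
  have poly: "?Q p" if "polynomial_function p" for p
  proof -
    have "real_polynomial_function (\<lambda>z. Re (p z))" "real_polynomial_function (\<lambda>z. Im (p z))"
      using that bounded_linear_Re bounded_linear_Im by (auto simp: polynomial_function_def o_def)
    hence "?Q (\<lambda>z. complex_of_real (Re (p z)) + \<i> * complex_of_real (Im (p z)))"
      by (intro Qadd Qmult real Qconst)
    thus ?thesis by (simp flip: complex_eq)
  qed
  have "\<exists>g. polynomial_function g \<and> (\<forall>z\<in>K. norm (f z - g z) < inverse (real (Suc n)))" for n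
    by (rule Stone_Weierstrass_polynomial_function[OF K f]) simp
  then obtain g where g: "\<And>n. polynomial_function (g n)"
    "\<And>n z. z \<in> K \<Longrightarrow> norm (f z - g n z) < inverse (real (Suc n))" by metis
  have "uniform_limit K g f sequentially"
    unfolding uniform_limit_iff
  proof (intro allI impI)
    fix e :: real assume "e > 0"
    then obtain N where N: "inverse (real (Suc N)) < e" using reals_Archimedean by blast
    have "dist (g n z) (f z) < e" if "n \<ge> N" "z \<in> K" for n z
    proof -
      have "inverse (real (Suc n)) \<le> inverse (real (Suc N))" using that(1) by (auto intro!: le_imp_inverse_le)
      thus ?thesis using g(2)[OF that(2), of n] N norm_minus_commute[of "f z" "g n z"]
        unfolding dist_norm by linarith
    qed
    thus "\<forall>\<^sub>F n in sequentially. \<forall>z\<in>K. dist (g n z) (f z) < e"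
      unfolding eventually_sequentially by blast
  qed
  thus ?thesis using poly g(1) by (intro lim[OF f, of g]) auto
qed

text \<open>Laurent polynomials of degree at most N. The degree is recorded because the first norm
  estimate for the corresponding operators counts coefficients.\<close>

inductive trig :: "nat \<Rightarrow> (complex \<Rightarrow> complex) \<Rightarrow> bool" where
  monomial: "\<bar>k\<bar> \<le> int N \<Longrightarrow> trig N (\<lambda>z. c * z powi k)"
| add: "trig N p \<Longrightarrow> trig N q \<Longrightarrow> trig N (\<lambda>z. p z + q z)"

lemma trig_continuous: "trig N p \<Longrightarrow> continuous_on (sphere 0 1) p"
  by (induction rule: trig.induct) (auto intro!: continuous_intros)

lemma trig_mono: "trig N p \<Longrightarrow> N \<le> M \<Longrightarrow> trig M p"
  by (induction rule: trig.induct) (auto intro!: trig.intros)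

lemma power_int_add_sphere: "z \<in> sphere 0 1 \<Longrightarrow> (z::complex) powi (k + l) = z powi k * z powi l"
  by (rule power_int_add) auto

text \<open>Equality is claimed on the circle only: at 0 the law for adding exponents fails, as
  \<open>0 powi 0 = 1\<close> while \<open>0 powi k = 0\<close> for other k.\<close>

lemma trig_mult:
  assumes "trig N p" "trig M q"
  shows "\<exists>r. trig (N + M) r \<and> (\<forall>z\<in>sphere 0 1. p z * q z = r z)"
  using assms(1)
proof induction
  case (monomial k N c)
  show ?case using assms(2)
  proof induction
    case (monomial l M d)
    have "trig (N + M) (\<lambda>z. (c * d) * z powi (k + l))"
      using monomial \<open>\<bar>k\<bar> \<le> int N\<close> by (intro trig.monomial) auto
    thus ?case by (intro exI conjI) (auto simp: power_int_add_sphere)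
  next
    case (add M p q)
    then obtain r s where "trig (N + M) r" "\<forall>z\<in>sphere 0 1. c * z powi k * p z = r z"
      "trig (N + M) s" "\<forall>z\<in>sphere 0 1. c * z powi k * q z = s z" by blast
    thus ?case by (intro exI[of _ "\<lambda>z. r z + s z"]) (auto intro: trig.add simp: distrib_left)
  qed
next
  case (add N p1 p2)
  then obtain r s where "trig (N + M) r" "\<forall>z\<in>sphere 0 1. p1 z * q z = r z"
    "trig (N + M) s" "\<forall>z\<in>sphere 0 1. p2 z * q z = s z" by blast
  thus ?case by (intro exI[of _ "\<lambda>z. r z + s z"]) (auto intro: trig.add simp: distrib_right)
qed

lemma cnj_sphere: "z \<in> sphere 0 1 \<Longrightarrow> cnj z = inverse z"
  by (intro inverse_unique[symmetric]) (simp add: complex_norm_square[symmetric])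

lemma uniform_limit_approxI:
  fixes p :: "nat \<Rightarrow> 'a \<Rightarrow> 'b::metric_space"
  assumes "uniform_limit S g f sequentially"
    and "\<And>n z. z \<in> S \<Longrightarrow> dist (p n z) (g n z) < inverse (real (Suc n))"
  shows "uniform_limit S p f sequentially"
  unfolding uniform_limit_iff
proof (intro allI impI)
  fix e :: real assume "e > 0"
  have "\<forall>\<^sub>F n in sequentially. inverse (real (Suc n)) < e / 2"
    using \<open>e > 0\<close> by (intro order_tendstoD[OF LIMSEQ_inverse_real_of_nat]) auto
  moreover have "\<forall>\<^sub>F n in sequentially. \<forall>z\<in>S. dist (g n z) (f z) < e / 2"
    by (rule uniform_limitD[OF assms(1)]) (use \<open>e > 0\<close> in simp)
  ultimately show "\<forall>\<^sub>F n in sequentially. \<forall>z\<in>S. dist (p n z) (f z) < e"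
  proof eventually_elim
    case (elim n)
    show ?case
    proof
      fix z assume "z \<in> S"
      thus "dist (p n z) (f z) < e"
        using elim assms(2)[of z n] dist_triangle[of "p n z" "f z" "g n z"] by fastforce
    qed
  qed
qed

lemma bounded_continuous_image_sphere:
  "continuous_on (sphere (0::complex) 1) f \<Longrightarrow> bounded (f ` sphere 0 1)"
  by (intro compact_imp_bounded compact_continuous_image) auto

lemma trig_dense:
  assumes "continuous_on (sphere 0 1) f"
  shows "\<exists>N p. (\<forall>n. trig (N n) (p n)) \<and> uniform_limit (sphere 0 1) p f sequentially"
proof -
  let ?S = "sphere (0::complex) 1"
  let ?P = "\<lambda>f. \<exists>N p. (\<forall>n. trig (N n) (p n)) \<and> uniform_limit ?S p f sequentially"
  have P_trig: "?P f" if "trig N p" "\<And>z. z \<in> ?S \<Longrightarrow> f z = p z" for f N p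
    using that by (intro exI[of _ "\<lambda>_. N"] exI[of _ "\<lambda>_. p"]) (auto simp: uniform_limit_iff)
  show ?thesis
  proof (rule continuous_complex_induct[OF _ assms])
    show "?P (\<lambda>z. c)" for c
      by (rule P_trig[OF trig.monomial[of 0 0 c]]) auto
    show "?P (\<lambda>z. z)"
      by (rule P_trig[OF trig.monomial[of 1 1 1]]) auto
    show "?P (\<lambda>z. cnj z)"
      by (rule P_trig[OF trig.monomial[of "-1" 1 1]]) (auto simp: cnj_sphere power_int_minus)
    fix f g assume fg: "continuous_on ?S f" "continuous_on ?S g" "?P f" "?P g"
    then obtain N p M q where p: "\<And>n. trig (N n) (p n)" "uniform_limit ?S p f sequentially"
      and q: "\<And>n. trig (M n) (q n)" "uniform_limit ?S q g sequentially" by blast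
    have "trig (max (N n) (M n)) (\<lambda>z. p n z + q n z)" for n
      by (rule trig.add[OF trig_mono[OF p(1)] trig_mono[OF q(1)]]) auto
    moreover have "uniform_limit ?S (\<lambda>n z. p n z + q n z) (\<lambda>z. f z + g z) sequentially"
      using p q by (intro uniform_limit_add)
    ultimately show "?P (\<lambda>z. f z + g z)"
      by (intro exI[of _ "\<lambda>n. max (N n) (M n)"] exI[of _ "\<lambda>n z. p n z + q n z"]) auto
    have "uniform_limit ?S (\<lambda>n z. p n z * q n z) (\<lambda>z. f z * g z) sequentially"
      using p q fg by (intro uniform_lim_mult bounded_continuous_image_sphere)
    moreover have "\<forall>n. \<exists>r. trig (N n + M n) r \<and> (\<forall>z\<in>?S. p n z * q n z = r z)"
      using trig_mult[OF p(1) q(1)] by blast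
    then obtain r where r: "\<And>n. trig (N n + M n) (r n)" "\<And>n. \<forall>z\<in>?S. p n z * q n z = r n z"
      unfolding choice_iff by blast
    ultimately have "uniform_limit ?S r (\<lambda>z. f z * g z) sequentially"
      by (subst (asm) uniform_limit_cong') auto
    thus "?P (\<lambda>z. f z * g z)"
      using r(1) by (intro exI[of _ "\<lambda>n. N n + M n"] exI[of _ r]) auto
  next
    fix f g assume g: "\<And>n. ?P (g n)" "uniform_limit ?S g f sequentially"
    \<comment> \<open>A diagonal choice: each g n is itself only a limit, so it is replaced by a
      single trigonometric polynomial within 1/(n+1) of it.\<close>
    have "\<exists>N p. trig N p \<and> (\<forall>z\<in>?S. dist (p z) (g n z) < inverse (real (Suc n)))" for n
    proof -
      obtain N p where p: "\<And>m. trig (N m) (p m)" "uniform_limit ?S p (g n) sequentially"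
        using g(1) by blast
      have "\<forall>\<^sub>F m in sequentially. \<forall>z\<in>?S. dist (p m z) (g n z) < inverse (real (Suc n))"
        by (rule uniform_limitD[OF p(2)]) simp
      then obtain m where "\<forall>z\<in>?S. dist (p m z) (g n z) < inverse (real (Suc n))"
        unfolding eventually_sequentially by blast
      thus ?thesis using p(1) by blast
    qed
    then obtain N p where "\<And>n. trig (N n) (p n)"
      "\<And>n z. z \<in> ?S \<Longrightarrow> dist (p n z) (g n z) < inverse (real (Suc n))" by metis
    thus "?P f" using uniform_limit_approxI[OF g(2)] by metis
  qed auto
qed

section \<open>Rotation invariance and Weyl equidistribution\<close>

lemma continuous_on_rotate:
  assumes "continuous_on (sphere 0 1) g" "cmod c = 1"
  shows "continuous_on (sphere 0 1) (\<lambda>z. g (c * z))"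
  by (rule continuous_on_compose2[OF assms(1)]) (use assms(2) in \<open>auto intro!: continuous_intros simp: norm_mult\<close>)

lemma uniform_limit_rotate:
  assumes "uniform_limit (sphere 0 1) p g sequentially" "cmod c = 1"
  shows "uniform_limit (sphere 0 1) (\<lambda>n z. p n (c * z)) (\<lambda>z. g (c * z)) sequentially"
  by (rule uniform_limit_compose'[OF assms(1)]) (use assms(2) in \<open>auto simp: norm_mult\<close>)

text \<open>On a monomial a rotation only multiplies by c^k, which changes nothing for k = 0 and
  multiplies the average 0 otherwise; density does the rest. No change of variables across the
  endpoints of the parameter interval is involved.\<close>

lemma avg_rotate:
  fixes g :: "complex \<Rightarrow> complex"
  assumes g: "continuous_on (sphere 0 1) g" and c: "cmod c = 1"
  shows "avg (\<lambda>z. g (c * z)) = avg g"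
proof -
  have trig: "avg (\<lambda>z. p (c * z)) = avg p" if "trig N p" for N p
    using that
  proof induction
    case (monomial k N d)
    have "(\<lambda>z. d * (c * z) powi k) = (\<lambda>z. (d * c powi k) * z powi k)"
      by (simp add: power_int_mult_distrib mult_ac)
    thus ?case by (simp only: avg_mult_left avg_power_int) simp
  next
    case (add N p q)
    thus ?case by (simp add: avg_add continuous_on_rotate c trig_continuous)
  qed
  obtain N p where p: "\<And>n. trig (N n) (p n)" "uniform_limit (sphere 0 1) p g sequentially"
    using trig_dense[OF g] by blast
  have "(\<lambda>n. avg (p n)) \<longlonglongrightarrow> avg g"
    using p by (intro avg_uniform_limit) (auto intro: trig_continuous)
  moreover have "(\<lambda>n. avg (\<lambda>z. p n (c * z))) \<longlonglongrightarrow> avg (\<lambda>z. g (c * z))"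
    using p c by (intro avg_uniform_limit uniform_limit_rotate continuous_on_rotate) (auto intro: trig_continuous)
  ultimately show ?thesis using trig[OF p(1)] LIMSEQ_unique by fastforce
qed

lemma avg_rotate_real:
  fixes g :: "complex \<Rightarrow> real"
  assumes "continuous_on (sphere 0 1) g" "cmod c = 1"
  shows "avg (\<lambda>z. g (c * z)) = avg g"
proof -
  have "avg (\<lambda>z. complex_of_real (g (c * z))) = avg (\<lambda>z. complex_of_real (g z))"
    by (rule avg_rotate[of "\<lambda>z. complex_of_real (g z)"]) (use assms in \<open>auto intro!: continuous_intros\<close>)
  thus ?thesis unfolding avg_of_real by simp
qed

text \<open>The form in which irrationality is used, both to sum orbits of characters and to make
  the traces of the powers of \<open>v\<close> vanish.\<close>

lemma circ_power_int_neq_1: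
  assumes "\<theta> \<notin> \<rat>" "k \<noteq> 0"
  shows "circ \<theta> powi k \<noteq> 1"
proof
  assume "circ \<theta> powi k = 1"
  hence "exp (of_int k * (2 * complex_of_real pi * \<i> * complex_of_real \<theta>)) = 1"
    by (simp add: circ_def exp_power_int)
  then obtain n :: int where "of_int k * (2 * pi * \<theta>) = of_int (2 * n) * pi"
    unfolding exp_eq_1 by auto
  hence "of_int k * \<theta> = of_int n" by simp
  hence "\<theta> = of_int n / of_int k" using assms(2) by (simp add: field_simps)
  thus False using assms(1) by auto
qed

lemma equidistribution:
  fixes g :: "complex \<Rightarrow> complex"
  assumes g: "continuous_on (sphere 0 1) g" and \<theta>: "\<theta> \<notin> \<rat>" and e: "e > 0"
  shows "\<exists>n0. \<forall>n\<ge>n0. \<forall>z\<in>sphere 0 1.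
           cmod ((\<Sum>k<n. g (circ \<theta> ^ k * z)) - of_nat n * avg g) \<le> real n * e"
proof -
  let ?S = "sphere (0::complex) 1" and ?c = "circ \<theta>"
  have S: "?c ^ k * z \<in> ?S" if "z \<in> ?S" for k z
    using that by (simp add: norm_mult norm_power)
  \<comment> \<open>For a fixed trigonometric polynomial the deviation is bounded by one C for all n
    and z, since a nonzero frequency contributes a geometric sum with ratio \<open>?m\<close>
    different from 1.\<close>
  have trig: "\<exists>C. \<forall>n. \<forall>z\<in>?S. cmod ((\<Sum>k<n. p (?c ^ k * z)) - of_nat n * avg p) \<le> C" if "trig N p" for N p
    using that
  proof induction
    case (monomial l N d)
    show ?case
    proof (cases "l = 0")
      case False
      let ?m = "?c powi l"
      have m: "?m \<noteq> 1" using circ_power_int_neq_1[OF \<theta> False] .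
      have "cmod (\<Sum>k<n. d * (?c ^ k * z) powi l) \<le> cmod d * (2 / cmod (?m - 1))" if "z \<in> ?S" for n z
      proof -
        have "(?c ^ k) powi l = ?m ^ k" for k
          by (metis power_int_mult power_int_of_nat mult.commute)
        hence "(\<Sum>k<n. d * (?c ^ k * z) powi l) = d * z powi l * (\<Sum>k<n. ?m ^ k)"
          by (simp add: power_int_mult_distrib sum_distrib_left mult_ac)
        also have "(\<Sum>k<n. ?m ^ k) = (?m ^ n - 1) / (?m - 1)" using m by (rule geometric_sum)
        also have "cmod (d * z powi l * \<dots>) = cmod d * (cmod (?m ^ n - 1) / cmod (?m - 1))"
          using that by (simp add: norm_mult norm_divide norm_power_int)
        also have "cmod (?m ^ n - 1) \<le> cmod (?m ^ n) + cmod 1" by (rule norm_triangle_ineq4)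
        also have "\<dots> = 2" by (simp add: norm_power norm_power_int)
        finally show ?thesis by (simp add: divide_right_mono mult_left_mono)
      qed
      moreover have "avg (\<lambda>z. d * z powi l) = 0" using False by (simp add: avg_mult_left avg_power_int)
      ultimately show ?thesis by (intro exI[of _ "cmod d * (2 / cmod (?m - 1))"]) auto
    qed auto
  next
    case (add N p q)
    then obtain C D where CD: "\<And>n z. z\<in>?S \<Longrightarrow> cmod ((\<Sum>k<n. p (?c ^ k * z)) - of_nat n * avg p) \<le> C"
       "\<And>n z. z\<in>?S \<Longrightarrow> cmod ((\<Sum>k<n. q (?c ^ k * z)) - of_nat n * avg q) \<le> D" by blast
    have "avg (\<lambda>z. p z + q z) = avg p + avg q" using add by (intro avg_add trig_continuous)
    hence "cmod ((\<Sum>k<n. p (?c ^ k * z) + q (?c ^ k * z)) - of_nat n * avg (\<lambda>z. p z + q z)) \<le> C + D"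
      if "z \<in> ?S" for n z
      using norm_triangle_mono[OF CD(1)[OF that, of n] CD(2)[OF that, of n]] by (simp add: sum.distrib algebra_simps)
    thus ?case by blast
  qed
  obtain N p where p: "\<And>n. trig (N n) (p n)" "uniform_limit ?S p g sequentially"
    using trig_dense[OF g] by blast
  have "\<forall>\<^sub>F m in sequentially. \<forall>z\<in>?S. dist (p m z) (g z) < e / 3"
    by (rule uniform_limitD[OF p(2)]) (use e in simp)
  then obtain m where m: "\<And>z. z \<in> ?S \<Longrightarrow> dist (p m z) (g z) < e / 3"
    unfolding eventually_sequentially by blast
  define q where "q = p m"
  have q: "trig (N m) q" "\<And>z. z \<in> ?S \<Longrightarrow> cmod (g z - q z) \<le> e / 3"
    using p(1) m by (auto simp: q_def dist_norm norm_minus_commute less_imp_le)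
  obtain C where C: "\<And>n z. z \<in> ?S \<Longrightarrow> cmod ((\<Sum>k<n. q (?c ^ k * z)) - of_nat n * avg q) \<le> C"
    using trig[OF q(1)] by blast
  have avg: "cmod (avg g - avg q) \<le> e / 3"
    unfolding avg_diff[OF g trig_continuous[OF q(1)], symmetric]
    by (rule norm_avg_le) (use g q in \<open>auto intro!: continuous_intros trig_continuous[OF q(1)]\<close>)
  \<comment> \<open>From n0 on, C is at most n e / 3. The error is split into three such shares:
    approximation along the orbit, deviation of q, and approximation of the average.\<close>
  obtain n0 :: nat where n0: "real n0 > C / (e / 3)" using reals_Archimedean2 by blast
  have "cmod ((\<Sum>k<n. g (?c ^ k * z)) - of_nat n * avg g) \<le> real n * e" if "n \<ge> n0" "z \<in> ?S" for n z
  proof -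
    have "C / (e / 3) < real n" using n0 that(1) by linarith
    hence Cn: "C \<le> real n * (e / 3)" using e by (simp add: field_simps)
    let ?A = "\<Sum>k<n. g (?c ^ k * z) - q (?c ^ k * z)"
    let ?B = "(\<Sum>k<n. q (?c ^ k * z)) - of_nat n * avg q"
    let ?D = "of_nat n * (avg g - avg q)"
    have "cmod ?A \<le> of_nat (card {..<n}) * (e / 3)"
      by (rule sum_norm_bound) (use q(2)[OF S[OF that(2)]] in auto)
    moreover have "cmod ?B \<le> real n * (e / 3)" using C[OF that(2), of n] Cn by linarith
    moreover have "cmod ?D \<le> real n * (e / 3)" using mult_left_mono[OF avg, of "real n"] by (simp add: norm_mult)
    moreover have "cmod (?A + ?B - ?D) \<le> cmod ?A + cmod ?B + cmod ?D"
      using norm_triangle_ineq4[of "?A + ?B" ?D] norm_triangle_ineq[of ?A ?B] by linarith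
    moreover have "(\<Sum>k<n. g (?c ^ k * z)) - of_nat n * avg g = ?A + ?B - ?D"
      by (simp add: sum_subtractf algebra_simps)
    ultimately show ?thesis by simp
  qed
  thus ?thesis by blast
qed

subsection \<open>Continuous functional calculus\<close>

text \<open>The conditions of \<open>is_cfc\<close> over an explicitly given compact set K instead
  of the spectrum of a. This allows a calculus for \<open>v\<close> to be built over the circle
  before the spectrum is known; \<open>spectrum_eq\<close> then identifies K.\<close>

locale calculus =
  fixes K :: "complex set" and a :: "'h::complex_hilbert \<Rightarrow>\<^sub>L 'h"
    and \<Phi> :: "(complex \<Rightarrow> complex) \<Rightarrow> ('h \<Rightarrow>\<^sub>L 'h)"
  assumes compact: "compact K" and nonempty: "K \<noteq> {}"
    and calc_const: "\<Phi> (\<lambda>z. c) = scalar_op c"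
    and calc_ident: "\<Phi> (\<lambda>z. z) = a"
    and calc_add: "continuous_on K f \<Longrightarrow> continuous_on K g \<Longrightarrow> \<Phi> (\<lambda>z. f z + g z) = \<Phi> f + \<Phi> g"
    and calc_mult: "continuous_on K f \<Longrightarrow> continuous_on K g \<Longrightarrow> \<Phi> (\<lambda>z. f z * g z) = \<Phi> f o\<^sub>L \<Phi> g"
    and calc_in_BH: "continuous_on K f \<Longrightarrow> \<Phi> f \<in> BH"
    and calc_adj: "continuous_on K f \<Longrightarrow> \<Phi> (\<lambda>z. cnj (f z)) = adj (\<Phi> f)"
    and calc_norm: "continuous_on K f \<Longrightarrow> norm (\<Phi> f) = (SUP z\<in>K. cmod (f z))"
begin

lemma calc_norm_ge:
  assumes "continuous_on K f" "z \<in> K"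
  shows "cmod (f z) \<le> norm (\<Phi> f)"
proof -
  have "compact ((\<lambda>z. cmod (f z)) ` K)"
    using assms(1) compact by (intro compact_continuous_image continuous_intros)
  hence "bdd_above ((\<lambda>z. cmod (f z)) ` K)" by (intro bounded_imp_bdd_above compact_imp_bounded)
  thus ?thesis unfolding calc_norm[OF assms(1)] using assms(2) by (intro cSUP_upper) auto
qed

lemma calc_norm_le:
  assumes "continuous_on K f" "\<And>z. z \<in> K \<Longrightarrow> cmod (f z) \<le> M"
  shows "norm (\<Phi> f) \<le> M"
  unfolding calc_norm[OF assms(1)] using nonempty assms(2) by (intro cSUP_least) auto

lemma calc_cmult: "continuous_on K f \<Longrightarrow> \<Phi> (\<lambda>z. c * f z) = scalar_op c o\<^sub>L \<Phi> f"
  using calc_mult[of "\<lambda>_. c" f] by (simp add: calc_const)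

lemma calc_diff:
  assumes "continuous_on K f" "continuous_on K g"
  shows "\<Phi> (\<lambda>z. f z - g z) = \<Phi> f - \<Phi> g"
proof -
  have "\<Phi> (\<lambda>z. f z + (-1) * g z) = \<Phi> f + (scalar_op (-1) o\<^sub>L \<Phi> g)"
    using assms calc_cmult[OF assms(2), of "-1"] by (subst calc_add) (auto intro!: continuous_intros)
  thus ?thesis by (simp add: scalar_op_minus compose_distrib)
qed

text \<open>The norm condition applied to f - g, which vanishes on K: values off K have no
  influence.\<close>

lemma calc_cong:
  assumes "continuous_on K f" "\<And>z. z \<in> K \<Longrightarrow> f z = g z"
  shows "\<Phi> f = \<Phi> g"
proof -
  have g: "continuous_on K g" using assms by (metis continuous_on_cong)
  have "norm (\<Phi> (\<lambda>z. f z - g z)) \<le> 0"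
    using assms g by (intro calc_norm_le) (auto intro!: continuous_intros)
  thus ?thesis using calc_diff[OF assms(1) g] by simp
qed

lemma calc_limit:
  assumes "uniform_limit K p f sequentially" "\<And>n. continuous_on K (p n)"
  shows "(\<lambda>n. \<Phi> (p n)) \<longlonglongrightarrow> \<Phi> f"
proof (rule LIMSEQ_I)
  fix e :: real assume e: "e > 0"
  have f: "continuous_on K f"
    by (rule uniform_limit_theorem[OF _ assms(1)]) (use assms in auto)
  have "\<forall>\<^sub>F n in sequentially. \<forall>z\<in>K. dist (p n z) (f z) < e / 2"
    by (rule uniform_limitD[OF assms(1)]) (use e in simp)
  then obtain n0 where n0: "\<And>n z. n \<ge> n0 \<Longrightarrow> z \<in> K \<Longrightarrow> dist (p n z) (f z) < e / 2"
    unfolding eventually_sequentially by blast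
  have "norm (\<Phi> (p n) - \<Phi> f) \<le> e / 2" if "n \<ge> n0" for n
    unfolding calc_diff[OF assms(2) f, symmetric]
    by (rule calc_norm_le) (use n0[OF that] assms(2) f in \<open>auto intro!: continuous_intros less_imp_le simp: dist_norm\<close>)
  thus "\<exists>no. \<forall>n\<ge>no. norm (\<Phi> (p n) - \<Phi> f) < e" using e by (intro exI[of _ n0]) force
qed

text \<open>If \<open>f z = 0\<close>, then \<open>\<Phi> f\<close> is not bounded below on the elements \<open>\<Phi> h\<close> with \<open>h\<close> peaked on the
  zeros of \<open>f\<close>.\<close>

lemma calc_invertible_iff:
  assumes f: "continuous_on K f"
  shows "invertible_op (\<Phi> f) \<longleftrightarrow> (\<forall>z\<in>K. f z \<noteq> 0)"
proof
  assume nz: "\<forall>z\<in>K. f z \<noteq> 0"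
  have g: "continuous_on K (\<lambda>z. inverse (f z))" using f nz by (intro continuous_intros) auto
  have "\<Phi> (\<lambda>z. f z * inverse (f z)) = \<Phi> (\<lambda>z. 1)" "\<Phi> (\<lambda>z. inverse (f z) * f z) = \<Phi> (\<lambda>z. 1)"
    using nz f g by (auto intro!: calc_cong continuous_intros)
  thus "invertible_op (\<Phi> f)" unfolding invertible_op_def
    using calc_in_BH[OF g] calc_mult[OF f g] calc_mult[OF g f] by (auto simp: calc_const)
next
  assume "invertible_op (\<Phi> f)"
  then obtain S where S: "S \<in> BH" "S o\<^sub>L \<Phi> f = id_blinfun" by (auto simp: invertible_op_def)
  show "\<forall>z\<in>K. f z \<noteq> 0"
  proof (intro ballI notI)
    fix z assume z: "z \<in> K" "f z = 0"
    obtain n :: nat where n: "real n > norm S" using reals_Archimedean2 by blast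
    hence n0: "real n > 0" using norm_ge_zero[of S] by linarith
    define h where "h w = complex_of_real (max 0 (1 - real n * cmod (f w)))" for w
    have h: "continuous_on K h" unfolding h_def using f by (intro continuous_intros)
    have "1 \<le> norm (\<Phi> h)" using calc_norm_ge[OF h z(1)] by (simp add: h_def z(2))
    also have "\<Phi> h = S o\<^sub>L \<Phi> (\<lambda>w. f w * h w)"
      by (simp add: calc_mult f h S(2) flip: compose_assoc)
    also have "norm \<dots> \<le> norm S * norm (\<Phi> (\<lambda>w. f w * h w))" by (rule norm_blinfun_compose)
    also have "norm (\<Phi> (\<lambda>w. f w * h w)) \<le> inverse (real n)"
    proof (rule calc_norm_le)
      fix w
      have hw: "cmod (h w) = max 0 (1 - real n * cmod (f w))" unfolding h_def by (subst norm_of_real) auto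
      show "cmod (f w * h w) \<le> inverse (real n)"
      proof (cases "real n * cmod (f w) \<ge> 1")
        case False
        hence "cmod (f w) * (1 - real n * cmod (f w)) \<le> cmod (f w) * 1"
          by (intro mult_left_mono) auto
        also have "\<dots> \<le> inverse (real n)" using False n0 by (simp add: field_simps)
        finally show ?thesis using False by (simp add: hw norm_mult)
      qed (simp add: hw norm_mult)
    qed (intro continuous_intros f h)
    finally have "1 \<le> norm S * inverse (real n)" by (simp add: mult_left_mono)
    thus False using n n0 by (simp add: field_simps)
  qed
qed

lemma calc_spectrum:
  assumes f: "continuous_on K f"
  shows "spectrum (\<Phi> f) = f ` K"
proof -
  have "z \<in> spectrum (\<Phi> f) \<longleftrightarrow> \<not> invertible_op (\<Phi> (\<lambda>w. f w - z))" for z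
    using f by (simp add: spectrum_iff calc_diff calc_const)
  also have "\<dots> z \<longleftrightarrow> z \<in> f ` K" for z
    using f by (subst calc_invertible_iff) (auto intro!: continuous_intros)
  finally show ?thesis by blast
qed

lemma spectrum_eq: "spectrum a = K"
  using calc_spectrum[of "\<lambda>z. z"] by (simp add: calc_ident)

lemma calc_compose:
  assumes g: "continuous_on K g"
  shows "is_cfc (\<Phi> g) (\<lambda>h. \<Phi> (\<lambda>z. h (g z)))"
proof -
  have c: "continuous_on K (\<lambda>z. h (g z))" if "continuous_on (g ` K) h" for h :: "complex \<Rightarrow> complex"
    using continuous_on_compose[OF g that] by (simp add: o_def)
  show ?thesis unfolding is_cfc_def calc_spectrum[OF g]
    using c by (auto simp: calc_const calc_add calc_mult calc_in_BH calc_adj calc_norm image_image)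
qed

lemma is_cfc: "is_cfc a \<Phi>"
  using calc_compose[of "\<lambda>z. z"] by (simp add: calc_ident)

end

lemma calculus_is_cfc:
  assumes "is_cfc a \<Phi>" "compact (spectrum a)" "spectrum a \<noteq> {}"
  shows "calculus (spectrum a) a \<Phi>"
  using assms unfolding is_cfc_def calculus_def by simp

text \<open>The values at constants, at the identity and, through the adjoint, at conjugation are
  prescribed; sums, products and uniform limits propagate the agreement. This removes the
  arbitrariness of the choice in \<open>cfc\<close>.\<close>

lemma calculus_unique:
  assumes "calculus K a \<Phi>" "calculus K a \<Psi>" and h: "continuous_on K h"
  shows "\<Phi> h = \<Psi> h"
proof -
  interpret A: calculus K a \<Phi> by fact
  interpret B: calculus K a \<Psi> by fact
  show ?thesis
  proof (rule continuous_complex_induct[OF A.compact h, where P = "\<lambda>h. \<Phi> h = \<Psi> h"])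
    show "\<Phi> (\<lambda>z. cnj z) = \<Psi> (\<lambda>z. cnj z)"
      using A.calc_adj[of "\<lambda>z. z"] B.calc_adj[of "\<lambda>z. z"] by (simp add: A.calc_ident B.calc_ident)
  next
    fix f g assume "\<And>n. continuous_on K (g n)" "\<And>n. \<Phi> (g n) = \<Psi> (g n)" "uniform_limit K g f sequentially"
    thus "\<Phi> f = \<Psi> f" using A.calc_limit[of g f] B.calc_limit[of g f] LIMSEQ_unique by simp
  qed (simp_all add: A.calc_const B.calc_const A.calc_ident B.calc_ident A.calc_add B.calc_add
      A.calc_mult B.calc_mult)
qed

context calculus
begin

lemma calculus_cfc: "calculus K a (cfc a)"
proof -
  have "is_cfc a (cfc a)" unfolding cfc_def by (rule someI[of "is_cfc a", OF is_cfc])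
  thus ?thesis using calculus_is_cfc[of a "cfc a"] compact nonempty by (simp add: spectrum_eq)
qed

lemma cfc_calc:
  assumes g: "continuous_on K g" and h: "continuous_on (g ` K) h"
  shows "cfc (\<Phi> g) h = \<Phi> (\<lambda>z. h (g z))"
proof -
  have K: "compact (g ` K)" "g ` K \<noteq> {}"
    using g compact nonempty by (auto intro: compact_continuous_image)
  have "calculus (g ` K) (\<Phi> g) (\<lambda>h. \<Phi> (\<lambda>z. h (g z)))"
    using calculus_is_cfc[OF calc_compose[OF g]] K by (simp add: calc_spectrum[OF g])
  thus ?thesis by (intro calculus_unique[OF calculus.calculus_cfc _ h])
qed

lemma abs_op_calc:
  assumes f: "continuous_on K f"
  shows "abs_op (\<Phi> f) = \<Phi> (\<lambda>z. complex_of_real (cmod (f z)))"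
proof -
  have c: "continuous_on K (\<lambda>z. cnj (f z))" using f by (intro continuous_intros)
  have "adj (\<Phi> f) o\<^sub>L \<Phi> f = \<Phi> (\<lambda>z. cnj (f z) * f z)"
    by (simp add: calc_mult[OF c f] calc_adj[OF f])
  hence "abs_op (\<Phi> f) = \<Phi> (\<lambda>z. complex_of_real (sqrt (Re (cnj (f z) * f z))))"
    unfolding abs_op_def
    by (simp only:) (rule cfc_calc; intro continuous_intros c f)
  also have "(\<lambda>z. complex_of_real (sqrt (Re (cnj (f z) * f z)))) = (\<lambda>z. complex_of_real (cmod (f z)))"
    by (simp add: cmod_def power2_eq_square)
  finally show ?thesis .
qed

text \<open>The function |f| is real and nonnegative, so \<open>Re\<close> recovers it and
  \<epsilon> > 0 keeps the argument of ln away from 0.\<close>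

lemma cfc_abs_op_calc:
  assumes f: "continuous_on K f" and e: "\<epsilon> > 0"
  shows "cfc (abs_op (\<Phi> f)) (\<lambda>z. complex_of_real (ln (Re z + \<epsilon>)))
    = \<Phi> (\<lambda>z. complex_of_real (ln (cmod (f z) + \<epsilon>)))"
  unfolding abs_op_calc[OF f]
  by (subst cfc_calc) (use e in \<open>auto intro!: continuous_intros f simp: add_nonneg_eq_0_iff\<close>)

end

subsection \<open>Unitaries generating an irrational rotation algebra\<close>

text \<open>Taking m-th roots removes a prefactor that is linear in m, because m q^m tends to 0 for
  0 \<le> q < 1. Exponents are restricted to powers of two, the ones covered by
  \<open>norm_opow_selfadjoint\<close>.\<close>

lemma power_le_linear_growth:
  fixes x y c d :: real
  assumes "x \<ge> 0" "y \<ge> 0" and le: "\<And>n. x ^ (2 ^ n) \<le> (c * real (2 ^ n) + d) * y ^ (2 ^ n)"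
  shows "x \<le> y"
proof (rule ccontr)
  assume "\<not> x \<le> y"
  hence xy: "y < x" "x > 0" using assms(2) by auto
  define q where "q = y / x"
  have q: "0 \<le> q" "q < 1" using xy assms(2) by (auto simp: q_def)
  have "(\<lambda>m. c * (real m * q ^ m) + d * q ^ m) \<longlonglongrightarrow> c * 0 + d * 0"
    using q powser_times_n_limit_0[of q] by (intro tendsto_intros LIMSEQ_power_zero) auto
  hence "(\<lambda>m. (c * real m + d) * q ^ m) \<longlonglongrightarrow> 0" by (simp add: algebra_simps)
  hence "\<forall>\<^sub>F m in sequentially. (c * real m + d) * q ^ m < 1" by (rule order_tendstoD) simp
  then obtain m0 where m0: "\<And>m. m \<ge> m0 \<Longrightarrow> (c * real m + d) * q ^ m < 1"
    unfolding eventually_sequentially by blast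
  have "m0 \<le> 2 ^ m0" by (rule less_imp_le) (rule less_exp)
  from m0[OF this] le[of m0] xy show False
    by (simp add: q_def power_divide field_simps)
qed

lemma avg_pos:
  fixes h :: "complex \<Rightarrow> real"
  assumes h: "continuous_on (sphere 0 1) h" and nn: "\<And>z. z \<in> sphere 0 1 \<Longrightarrow> h z \<ge> 0"
    and z: "z \<in> sphere 0 1" "h z > 0"
  shows "avg h > 0"
proof (rule ccontr)
  assume "\<not> ?thesis"
  moreover have "avg h \<ge> avg (\<lambda>z. 0)" using h nn by (intro avg_mono) (auto intro!: continuous_intros)
  ultimately have 0: "avg h = 0" by simp
  have "((\<lambda>x. h (circ x)) has_integral 0) {0..1}"
    using 0 set_borel_integral_eq_integral[OF set_integrable_circ[OF h]]
    by (simp add: avg_def has_integral_iff)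
  moreover have "continuous_on {0..1} (\<lambda>x. h (circ x))"
    by (rule continuous_on_compose2[OF h]) (auto intro: continuous_intros)
  ultimately have "h (circ x) = 0" if "x \<in> {0..1}" for x
    using has_integral_0_cbox_imp_0[of 0 1 "\<lambda>x. h (circ x)" x] nn that by auto
  thus False using sphere_eq_circ[OF z(1)] z(2) by auto
qed

text \<open>If g exceeded B somewhere, it would exceed some b > B on a set of positive mass; its
  m-th moment would then be at least a positive multiple of b^m, which outgrows C B^m.\<close>

lemma le_of_avg_power_le:
  fixes g :: "complex \<Rightarrow> real"
  assumes g: "continuous_on (sphere 0 1) g" and nn: "\<And>z. z \<in> sphere 0 1 \<Longrightarrow> g z \<ge> 0"
    and z: "z \<in> sphere 0 1" and B: "B \<ge> 0" and le: "\<And>m. avg (\<lambda>z. g z ^ m) \<le> C * B ^ m"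
  shows "g z \<le> B"
proof (rule ccontr)
  assume less: "\<not> g z \<le> B"
  define b where "b = (g z + B) / 2"
  have b: "B < b" "b < g z" using less by (auto simp: b_def)
  \<comment> \<open>A continuous substitute for the indicator of the set where g > b. After division
    by its bound H it stays below 1, so b^m h / H \<le> g^m.\<close>
  define h where "h z = max 0 (g z - b)" for z
  have h: "continuous_on (sphere 0 1) h" unfolding h_def using g by (intro continuous_intros)
  obtain H where H: "\<And>w. w \<in> sphere 0 1 \<Longrightarrow> h w \<le> H" "H > 0"
  proof -
    have "bounded (h ` sphere 0 1)"
      using h by (intro compact_imp_bounded compact_continuous_image) auto
    then obtain H where H: "H > 0" "\<And>w. w \<in> sphere 0 1 \<Longrightarrow> norm (h w) \<le> H"
      unfolding bounded_pos by blast
    show ?thesis by (rule that[OF order_trans[OF _ H(2)] H(1)]) auto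
  qed
  have pos: "avg h > 0" by (rule avg_pos[OF h _ z]) (use b in \<open>auto simp: h_def\<close>)
  have "b ^ m * (avg h / H) \<le> C * B ^ m" for m
  proof -
    have "avg (\<lambda>w. (b ^ m / H) * h w) \<le> avg (\<lambda>w. g w ^ m)"
    proof (rule avg_mono)
      fix w :: complex assume w: "w \<in> sphere 0 1"
      show "b ^ m / H * h w \<le> g w ^ m"
      proof (cases "g w \<le> b")
        case False
        have "b ^ m / H * h w \<le> b ^ m / H * H" using H(1)[OF w] H(2) b B by (intro mult_left_mono) auto
        also have "\<dots> = b ^ m" using H(2) by simp
        also have "\<dots> \<le> g w ^ m" using False b B by (intro power_mono) auto
        finally show ?thesis .
      qed (simp add: h_def nn[OF w])
    qed (intro continuous_intros h g)+
    also have "avg (\<lambda>w. (b ^ m / H) * h w) = (b ^ m / H) * avg h" by (simp add: avg_def)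
    finally show ?thesis using le[of m] by simp
  qed
  hence le': "avg h / H \<le> C * (B / b) ^ m" for m using b B by (simp add: power_divide field_simps)
  have "(\<lambda>m. C * (B / b) ^ m) \<longlonglongrightarrow> C * 0"
    using b B by (intro tendsto_intros LIMSEQ_power_zero) auto
  hence "avg h / H \<le> 0" using le' by (intro LIMSEQ_le_const[of "\<lambda>m. C * (B / b) ^ m"]) auto
  thus False using pos H(2) by (simp add: divide_le_0_iff)
qed

lemma adj_opow: "T \<in> BH \<Longrightarrow> adj (opow T n) = opow (adj T) n"
  by (induction n) (simp_all add: adj_compose opow_commute)

text \<open>Repeated squaring with the C*-identity, each power of A being self-adjoint.\<close>

lemma norm_opow_selfadjoint:
  assumes "A \<in> BH" "adj A = A"
  shows "norm (opow A (2 ^ n)) = norm A ^ (2 ^ n)"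
proof (induction n)
  case (Suc n)
  have "opow A (2 ^ Suc n) = adj (opow A (2 ^ n)) o\<^sub>L opow A (2 ^ n)"
    using assms by (simp add: adj_opow mult_2 opow_add)
  hence "norm (opow A (2 ^ Suc n)) = (norm (opow A (2 ^ n)))\<^sup>2"
    using assms by (simp only: norm_adj_compose_self opow_in_BH)
  thus ?case using Suc by (simp add: mult.commute flip: power_mult)
qed simp

section \<open>Commutants and normal functionals\<close>

lemma commutant_subset_BH: "commutant A \<subseteq> BH"
  by (auto simp: commutant_def)

lemma commutant_scalar_op: "A \<subseteq> BH \<Longrightarrow> scalar_op c \<in> commutant A"
  using scalar_op_commute by (fastforce simp: commutant_def)

lemma commutant_add: "S \<in> commutant A \<Longrightarrow> T \<in> commutant A \<Longrightarrow> S + T \<in> commutant A"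
  by (simp add: commutant_def compose_distrib)

lemma commutant_compose: "S \<in> commutant A \<Longrightarrow> T \<in> commutant A \<Longrightarrow> S o\<^sub>L T \<in> commutant A"
  by (auto simp: commutant_def compose_assoc) (metis compose_assoc)

lemma commutant_limit:
  assumes "\<And>n. T n \<in> commutant A" "T \<longlonglongrightarrow> S"
  shows "S \<in> commutant A"
proof -
  have "S o\<^sub>L B = B o\<^sub>L S" if "B \<in> A" for B
  proof -
    have "(\<lambda>n. T n o\<^sub>L B) \<longlonglongrightarrow> (S o\<^sub>L B)" "(\<lambda>n. B o\<^sub>L T n) \<longlonglongrightarrow> (B o\<^sub>L S)"
      using assms(2) by (auto intro!: bounded_bilinear.tendsto[OF bounded_bilinear_blinfun_compose])
    moreover have "(\<lambda>n. T n o\<^sub>L B) = (\<lambda>n. B o\<^sub>L T n)" using assms(1) that by (auto simp: commutant_def)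
    ultimately show ?thesis using LIMSEQ_unique by metis
  qed
  moreover have "S \<in> BH" using assms commutant_subset_BH by (intro BH_limit[of T S]) auto
  ultimately show ?thesis by (simp add: commutant_def)
qed

text \<open>Cauchy-Schwarz bounds the series termwise by the norm of T times a summable sequence.
  The resulting norm continuity carries the trace to limits, and the constant C allows traces of
  powers to be compared with norms.\<close>

lemma normal_functional_bounded:
  assumes "normal_functional M \<tau>"
  shows "\<exists>C. \<forall>T\<in>M. cmod (\<tau> T) \<le> C * norm T"
proof -
  obtain x y where sm: "summable (\<lambda>n. (norm (x n))\<^sup>2)" "summable (\<lambda>n. (norm (y n))\<^sup>2)"
    and \<tau>: "\<And>T. T \<in> M \<Longrightarrow> (\<lambda>n. cinner (x n) (blinfun_apply T (y n))) sums \<tau> T"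
    using assms unfolding normal_functional_def by blast
  define b where "b n = (norm (x n))\<^sup>2 + (norm (y n))\<^sup>2" for n
  have b: "summable b" unfolding b_def using sm by (rule summable_add)
  have "cmod (\<tau> T) \<le> (suminf b) * norm T" if "T \<in> M" for T
  proof -
    have "cmod (cinner (x n) (blinfun_apply T (y n))) \<le> b n * norm T" for n
    proof -
      have "cmod (cinner (x n) (blinfun_apply T (y n))) \<le> norm (x n) * (norm T * norm (y n))"
        by (meson Cauchy_Schwarz_cinner norm_blinfun mult_left_mono norm_ge_zero order_trans)
      also have "\<dots> = (norm (x n) * norm (y n)) * norm T" by simp
      also have "norm (x n) * norm (y n) \<le> b n"
        using sum_squares_bound[of "norm (x n)" "norm (y n)"] mult_nonneg_nonneg[OF norm_ge_zero norm_ge_zero, of "x n" "y n"]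
        unfolding b_def by linarith
      finally show ?thesis by (simp add: mult_right_mono)
    qed
    moreover have "summable (\<lambda>n. b n * norm T)" using b by (rule summable_mult2)
    ultimately have "cmod (suminf (\<lambda>n. cinner (x n) (blinfun_apply T (y n)))) \<le> (\<Sum>n. b n * norm T)"
      by (rule norm_suminf_le)
    thus ?thesis using sums_unique[OF \<tau>[OF that]] suminf_mult2[OF b, of "norm T"] by simp
  qed
  thus ?thesis by blast
qed

section \<open>The rotation relation in a von Neumann algebra with trace\<close>

locale rotation_pair =
  fixes R :: "('h::complex_hilbert \<Rightarrow>\<^sub>L 'h) set" and u v :: "'h \<Rightarrow>\<^sub>L 'h"
    and \<theta> :: real and \<tau> :: "('h \<Rightarrow>\<^sub>L 'h) \<Rightarrow> complex"
  assumes vN: "von_neumann_algebra R"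
    and trace: "faithful_normal_tracial_state R \<tau>"
    and irrational: "\<theta> \<notin> \<rat>"
    and u_in_R: "u \<in> R" and v_in_R: "v \<in> R"
    and unitary_u: "unitary u" and unitary_v: "unitary v"
    and commutation: "v o\<^sub>L u = scalar_op (circ \<theta>) o\<^sub>L (u o\<^sub>L v)"
begin

abbreviation "\<S> \<equiv> sphere (0::complex) 1"

lemma R_subset_BH: "R \<subseteq> BH"
  using vN by (simp add: von_neumann_algebra_def)

lemma R_BH [simp]: "T \<in> R \<Longrightarrow> T \<in> BH"
  using R_subset_BH by blast

lemma R_eq: "R = commutant (commutant R)"
  using vN by (simp add: von_neumann_algebra_def)

lemma R_adj: "T \<in> R \<Longrightarrow> adj T \<in> R"
  using vN by (auto simp: von_neumann_algebra_def)

lemma R_scalar_op: "scalar_op c \<in> R"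
  using R_eq commutant_scalar_op[OF commutant_subset_BH] by metis

lemma R_add: "S \<in> R \<Longrightarrow> T \<in> R \<Longrightarrow> S + T \<in> R"
  using R_eq commutant_add by metis

lemma R_compose: "S \<in> R \<Longrightarrow> T \<in> R \<Longrightarrow> S o\<^sub>L T \<in> R"
  using R_eq commutant_compose by metis

lemma R_limit: "(\<And>n. T n \<in> R) \<Longrightarrow> T \<longlonglongrightarrow> S \<Longrightarrow> S \<in> R"
  using R_eq commutant_limit by metis

lemma R_id: "id_blinfun \<in> R"
  using R_scalar_op[of 1] by simp

lemma R_opow: "T \<in> R \<Longrightarrow> opow T n \<in> R"
  by (induction n) (auto intro: R_compose R_id)

lemma R_diff: "S \<in> R \<Longrightarrow> T \<in> R \<Longrightarrow> S - T \<in> R"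
  using R_add[of S "scalar_op (-1) o\<^sub>L T"] R_compose[of "scalar_op (-1)" T] R_scalar_op[of "-1"]
  by (simp add: scalar_op_minus compose_distrib)

lemma trace_add: "S \<in> R \<Longrightarrow> T \<in> R \<Longrightarrow> \<tau> (S + T) = \<tau> S + \<tau> T"
  and trace_scale: "T \<in> R \<Longrightarrow> \<tau> (scalar_op c o\<^sub>L T) = c * \<tau> T"
  and trace_id: "\<tau> id_blinfun = 1"
  and trace_commute: "S \<in> R \<Longrightarrow> T \<in> R \<Longrightarrow> \<tau> (S o\<^sub>L T) = \<tau> (T o\<^sub>L S)"
  and trace_normal: "normal_functional R \<tau>"
  using trace by (auto simp: faithful_normal_tracial_state_def)

lemma trace_diff: "S \<in> R \<Longrightarrow> T \<in> R \<Longrightarrow> \<tau> (S - T) = \<tau> S - \<tau> T"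
  using trace_add[of "S - T" T] R_diff by simp

lemma trace_limit:
  assumes "\<And>n. T n \<in> R" "T \<longlonglongrightarrow> S"
  shows "(\<lambda>n. \<tau> (T n)) \<longlonglongrightarrow> \<tau> S"
proof -
  obtain C where C: "\<And>T. T \<in> R \<Longrightarrow> cmod (\<tau> T) \<le> C * norm T"
    using normal_functional_bounded[OF trace_normal] by blast
  have S: "S \<in> R" using R_limit assms by blast
  have "(\<lambda>n. \<tau> (T n) - \<tau> S) \<longlonglongrightarrow> 0"
  proof (rule Lim_null_comparison)
    show "\<forall>\<^sub>F n in sequentially. norm (\<tau> (T n) - \<tau> S) \<le> C * norm (T n - S)"
      using C[OF R_diff[OF assms(1) S]] by (simp add: trace_diff assms(1) S)
    have "(\<lambda>n. C * norm (T n - S)) \<longlonglongrightarrow> C * norm (S - S)"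
      by (intro tendsto_intros assms(2))
    thus "(\<lambda>n. C * norm (T n - S)) \<longlonglongrightarrow> 0" by simp
  qed
  thus ?thesis using Lim_null by blast
qed

lemma adj_v_v [simp]: "adj v o\<^sub>L v = id_blinfun" and v_adj_v [simp]: "v o\<^sub>L adj v = id_blinfun"
  and adj_u_u [simp]: "adj u o\<^sub>L u = id_blinfun" and u_adj_u [simp]: "u o\<^sub>L adj u = id_blinfun"
  using unitary_u unitary_v by (auto simp: unitary_def)

lemma left_cancel:
  "adj v o\<^sub>L (v o\<^sub>L T) = T" "v o\<^sub>L (adj v o\<^sub>L T) = T"
  "adj u o\<^sub>L (u o\<^sub>L T) = T" "u o\<^sub>L (adj u o\<^sub>L T) = T"
  by (simp_all flip: compose_assoc)

lemma adj_commutation: "adj v o\<^sub>L u = scalar_op (cnj (circ \<theta>)) o\<^sub>L (u o\<^sub>L adj v)"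
proof -
  have "cnj (circ \<theta>) * circ \<theta> = 1" by (simp add: complex_norm_square[symmetric] mult.commute)
  hence "adj v o\<^sub>L u = scalar_op (cnj (circ \<theta>)) o\<^sub>L (adj v o\<^sub>L ((scalar_op (circ \<theta>) o\<^sub>L (u o\<^sub>L v)) o\<^sub>L adj v))"
    using v_in_R by (simp add: compose_assoc scalar_op_left_commute[OF adj_in_BH[OF R_BH]] scalar_op_mult_compose)
  also have "\<dots> = scalar_op (cnj (circ \<theta>)) o\<^sub>L (u o\<^sub>L adj v)"
    by (simp only: commutation[symmetric] compose_assoc left_cancel)
  finally show ?thesis .
qed

lemma opow_commutation:
  assumes "W o\<^sub>L u = scalar_op c o\<^sub>L (u o\<^sub>L W)" "W \<in> BH"
  shows "opow W n o\<^sub>L u = scalar_op (c ^ n) o\<^sub>L (u o\<^sub>L opow W n)"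
proof (induction n)
  case (Suc n)
  have "opow W (Suc n) o\<^sub>L u = scalar_op (c ^ n) o\<^sub>L ((W o\<^sub>L u) o\<^sub>L opow W n)"
    by (simp add: compose_assoc Suc scalar_op_left_commute[OF assms(2)])
  thus ?case by (simp add: assms(1) compose_assoc scalar_op_mult_compose mult.commute)
qed simp

section \<open>Integer powers of \<open>v\<close> and trigonometric polynomials in them\<close>

definition V :: "int \<Rightarrow> ('h \<Rightarrow>\<^sub>L 'h)" where
  "V k = (if k \<ge> 0 then opow v (nat k) else opow (adj v) (nat (- k)))"

lemma V_in_R: "V k \<in> R"
  by (auto simp: V_def intro: R_opow R_adj v_in_R)

lemma V_0 [simp]: "V 0 = id_blinfun" and V_1 [simp]: "V 1 = v"
  by (simp_all add: V_def)

lemma V_Suc: "V (k + 1) = v o\<^sub>L V k"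
proof (cases "k \<ge> 0")
  case True
  hence "nat (k + 1) = Suc (nat k)" by simp
  thus ?thesis using True by (simp add: V_def)
next
  case False
  hence "nat (- k) = Suc (nat (- (k + 1)))" by simp
  thus ?thesis using False by (cases "k = -1") (simp_all add: V_def left_cancel)
qed

lemma V_pred: "V (k - 1) = adj v o\<^sub>L V k"
  using V_Suc[of "k - 1"] by (simp add: left_cancel)

lemma V_add: "V (k + l) = V k o\<^sub>L V l"
proof (induction k rule: int_induct[of _ 0])
  case (step1 i)
  have "V (i + 1 + l) = v o\<^sub>L V (i + l)" using V_Suc[of "i + l"] by (simp add: algebra_simps)
  thus ?case using step1 by (simp add: V_Suc compose_assoc)
next
  case (step2 i)
  have "V (i - 1 + l) = adj v o\<^sub>L V (i + l)" using V_pred[of "i + l"] by (simp add: algebra_simps)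
  thus ?case using step2 by (simp add: V_pred compose_assoc)
qed simp

lemma adj_V: "adj (V k) = V (- k)"
  using v_in_R by (auto simp: V_def adj_opow)

lemma V_commutation: "V k o\<^sub>L u = scalar_op (circ \<theta> powi k) o\<^sub>L (u o\<^sub>L V k)"
proof (cases "k \<ge> 0")
  case True
  thus ?thesis using opow_commutation[OF commutation, of "nat k"] v_in_R
    by (simp add: V_def power_int_def)
next
  case False
  thus ?thesis using opow_commutation[OF adj_commutation, of "nat (- k)"] v_in_R
    by (simp add: V_def power_int_def cnj_sphere flip: power_inverse)
qed

lemma norm_V_le: "norm (V k) \<le> 1"
proof -
  have "(norm (V k))\<^sup>2 = norm (adj (V k) o\<^sub>L V k)" using V_in_R by (simp add: norm_adj_compose_self)
  also have "adj (V k) o\<^sub>L V k = id_blinfun" by (simp add: adj_V flip: V_add)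
  finally have "(norm (V k))\<^sup>2 \<le> 1\<^sup>2" by (simp add: norm_blinfun_id_le)
  thus ?thesis by (rule power2_le_imp_le) simp
qed

text \<open>Inserting \<open>adj u o\<^sub>L u\<close> and using the trace property, \<tau> (V k) is
  the trace of \<open>u o\<^sub>L V k o\<^sub>L adj u\<close>. Moving u past V k shows that
  multiplication by \<open>circ \<theta> powi k\<close> reproduces \<tau> (V k); this factor is not
  1.\<close>

lemma trace_V: "\<tau> (V k) = (if k = 0 then 1 else 0)"
proof (cases "k = 0")
  case False
  have "\<tau> (V k) = \<tau> (adj u o\<^sub>L (u o\<^sub>L V k))" by (simp add: left_cancel)
  also have "\<dots> = \<tau> ((u o\<^sub>L V k) o\<^sub>L adj u)"
    by (intro trace_commute R_compose R_adj u_in_R V_in_R)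
  also have "circ \<theta> powi k * \<dots> = \<tau> ((scalar_op (circ \<theta> powi k) o\<^sub>L (u o\<^sub>L V k)) o\<^sub>L adj u)"
    by (subst trace_scale[symmetric]) (auto intro!: R_compose R_adj u_in_R V_in_R simp: compose_assoc)
  also have "\<dots> = \<tau> (V k)" by (simp only: V_commutation[symmetric] compose_assoc u_adj_u compose_id)
  finally show ?thesis using False circ_power_int_neq_1[OF irrational False] by simp
qed (simp add: trace_id)

text \<open>Function and operator are built in parallel, as a relation. That the operator depends
  only on the function on the circle is not visible here; it follows from the norm bound
  \<open>trig_op_norm_le\<close>.\<close>

inductive trig_op :: "nat \<Rightarrow> (complex \<Rightarrow> complex) \<Rightarrow> ('h \<Rightarrow>\<^sub>L 'h) \<Rightarrow> bool" where
  monomial: "\<bar>k\<bar> \<le> int N \<Longrightarrow> trig_op N (\<lambda>z. c * z powi k) (scalar_op c o\<^sub>L V k)"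
| add: "trig_op N p P \<Longrightarrow> trig_op N q Q \<Longrightarrow> trig_op N (\<lambda>z. p z + q z) (P + Q)"

lemma trig_op_trig: "trig_op N p P \<Longrightarrow> trig N p"
  by (induction rule: trig_op.induct) (auto intro: trig.intros)

lemma trig_op_continuous: "trig_op N p P \<Longrightarrow> continuous_on \<S> p"
  using trig_op_trig trig_continuous by blast

lemma trig_trig_op: "trig N p \<Longrightarrow> \<exists>P. trig_op N p P"
  by (induction rule: trig.induct) (blast intro: trig_op.intros)+

lemma trig_op_mono: "trig_op N p P \<Longrightarrow> N \<le> M \<Longrightarrow> trig_op M p P"
  by (induction rule: trig_op.induct) (auto intro!: trig_op.intros)

lemma trig_op_in_R: "trig_op N p P \<Longrightarrow> P \<in> R"
  by (induction rule: trig_op.induct) (auto intro: R_add R_compose R_scalar_op V_in_R)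

lemma trig_op_cmult: "trig_op N p P \<Longrightarrow> trig_op N (\<lambda>z. c * p z) (scalar_op c o\<^sub>L P)"
proof (induction rule: trig_op.induct)
  case (monomial k N d)
  thus ?case using trig_op.monomial[of k N "c * d"] by (simp add: scalar_op_mult_compose mult.assoc)
qed (simp add: compose_distrib distrib_left trig_op.add)

lemma trig_op_diff:
  assumes "trig_op N p P" "trig_op M q Q"
  shows "trig_op (max N M) (\<lambda>z. p z - q z) (P - Q)"
  using trig_op.add[OF trig_op_mono[OF assms(1)] trig_op_mono[OF trig_op_cmult[OF assms(2), of "-1"]], of "max N M"]
  by (simp add: scalar_op_minus compose_distrib)

lemma trig_op_mult:
  assumes "trig_op N p P" "trig_op M q Q"
  shows "\<exists>r. trig_op (N + M) r (P o\<^sub>L Q) \<and> (\<forall>z\<in>\<S>. p z * q z = r z)"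
  using assms(1)
proof induction
  case (monomial k N c)
  show ?case using assms(2)
  proof induction
    case (monomial l M d)
    have "trig_op (N + M) (\<lambda>z. (c * d) * z powi (k + l)) (scalar_op (c * d) o\<^sub>L V (k + l))"
      using monomial \<open>\<bar>k\<bar> \<le> int N\<close> by (intro trig_op.monomial) auto
    also have "scalar_op (c * d) o\<^sub>L V (k + l) = (scalar_op c o\<^sub>L V k) o\<^sub>L (scalar_op d o\<^sub>L V l)"
      by (simp add: V_add compose_assoc scalar_op_left_commute[OF R_BH[OF V_in_R]] scalar_op_mult_compose)
    finally show ?case by (intro exI conjI) (auto simp: power_int_add_sphere)
  next
    case (add M p P q Q)
    then obtain r s where "trig_op (N + M) r ((scalar_op c o\<^sub>L V k) o\<^sub>L P)" "\<forall>z\<in>\<S>. c * z powi k * p z = r z"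
      "trig_op (N + M) s ((scalar_op c o\<^sub>L V k) o\<^sub>L Q)" "\<forall>z\<in>\<S>. c * z powi k * q z = s z" by blast
    thus ?case by (intro exI[of _ "\<lambda>z. r z + s z"])
        (auto intro: trig_op.add simp: distrib_left bounded_bilinear.add_right[OF bounded_bilinear_blinfun_compose])
  qed
next
  case (add N p1 P1 p2 P2)
  then obtain r s where "trig_op (N + M) r (P1 o\<^sub>L Q)" "\<forall>z\<in>\<S>. p1 z * q z = r z"
    "trig_op (N + M) s (P2 o\<^sub>L Q)" "\<forall>z\<in>\<S>. p2 z * q z = s z" by blast
  thus ?case by (intro exI[of _ "\<lambda>z. r z + s z"])
      (auto intro: trig_op.add simp: distrib_right bounded_bilinear.add_left[OF bounded_bilinear_blinfun_compose])
qed

lemma trig_op_adj: "trig_op N p P \<Longrightarrow> \<exists>r. trig_op N r (adj P) \<and> (\<forall>z\<in>\<S>. cnj (p z) = r z)"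
proof (induction rule: trig_op.induct)
  case (monomial k N c)
  hence "trig_op N (\<lambda>z. cnj c * z powi (- k)) (scalar_op (cnj c) o\<^sub>L V (- k))"
    by (intro trig_op.monomial) auto
  also have "scalar_op (cnj c) o\<^sub>L V (- k) = adj (scalar_op c o\<^sub>L V k)"
    using V_in_R by (simp add: adj_compose adj_V scalar_op_commute[OF R_BH[OF V_in_R]])
  finally show ?case
    by (intro exI conjI) (auto simp: power_int_minus cnj_sphere power_int_inverse simp del: mem_sphere_0)
next
  case (add N p P q Q)
  then obtain r s where "trig_op N r (adj P)" "\<forall>z\<in>\<S>. cnj (p z) = r z"
    "trig_op N s (adj Q)" "\<forall>z\<in>\<S>. cnj (q z) = s z" by blast
  thus ?case using add.hyps
    by (intro exI[of _ "\<lambda>z. r z + s z"]) (auto intro: trig_op.add simp: adj_add trig_op_in_R)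
qed

lemma trig_op_opow:
  assumes "trig_op N p P"
  shows "\<exists>r. trig_op (N * m) r (opow P m) \<and> (\<forall>z\<in>\<S>. p z ^ m = r z)"
proof (induction m)
  case 0
  show ?case using trig_op.monomial[of 0 0 1] by (intro exI[of _ "\<lambda>z. 1"]) simp
next
  case (Suc m)
  then obtain r where r: "trig_op (N * m) r (opow P m)" "\<forall>z\<in>\<S>. p z ^ m = r z" by blast
  obtain s where "trig_op (N + N * m) s (P o\<^sub>L opow P m)" "\<forall>z\<in>\<S>. p z * r z = s z"
    using trig_op_mult[OF assms r(1)] by blast
  thus ?case using r by (intro exI[of _ s]) auto
qed

lemma trig_op_coeffs:
  "trig_op N p P \<Longrightarrow> \<exists>c. (\<forall>z. p z = (\<Sum>k=-int N..int N. c k * z powi k)) \<and>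
     P = (\<Sum>k=-int N..int N. scalar_op (c k) o\<^sub>L V k)"
proof (induction rule: trig_op.induct)
  case (monomial k N c)
  hence k: "k \<in> {-int N..int N}" by auto
  have "(\<Sum>j=-int N..int N. (if j = k then c else 0) * z powi j) = c * z powi k" for z
    using k by (subst sum.remove[of _ k]) (auto intro: sum.neutral)
  moreover have "(\<Sum>j=-int N..int N. scalar_op (if j = k then c else 0) o\<^sub>L V j) = scalar_op c o\<^sub>L V k"
    using k by (subst sum.remove[of _ k]) (auto intro: sum.neutral)
  ultimately show ?case by (intro exI[of _ "\<lambda>j. if j = k then c else 0"]) auto
next
  case (add N p P q Q)
  from add.IH(1) obtain c where c: "\<forall>z. p z = (\<Sum>k=-int N..int N. c k * z powi k)"
    "P = (\<Sum>k=-int N..int N. scalar_op (c k) o\<^sub>L V k)" by blast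
  from add.IH(2) obtain d where d: "\<forall>z. q z = (\<Sum>k=-int N..int N. d k * z powi k)"
    "Q = (\<Sum>k=-int N..int N. scalar_op (d k) o\<^sub>L V k)" by blast
  show ?case unfolding c(2) d(2) using c(1) d(1) by (intro exI[of _ "\<lambda>k. c k + d k"])
    (simp add: sum.distrib distrib_right scalar_op_add bounded_bilinear.add_left[OF bounded_bilinear_blinfun_compose])
qed

text \<open>Each coefficient is the average of p z^(-k), hence at most M in modulus; there are 2N +
  1 of them and every V k has norm at most 1.\<close>

lemma trig_op_norm_le_length:
  assumes "trig_op N p P" "\<And>z. z \<in> \<S> \<Longrightarrow> cmod (p z) \<le> M"
  shows "norm P \<le> (2 * real N + 1) * M"
proof -
  obtain c where p: "\<And>z. p z = (\<Sum>k=-int N..int N. c k * z powi k)"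
    and P: "P = (\<Sum>k=-int N..int N. scalar_op (c k) o\<^sub>L V k)"
    using trig_op_coeffs[OF assms(1)] by blast
  have "norm (scalar_op (c k) o\<^sub>L V k) \<le> M" if k: "k \<in> {-int N..int N}" for k
  proof -
    have cont: "continuous_on \<S> (\<lambda>z. z powi j :: complex)" for j by (intro continuous_intros) auto
    have "avg (\<lambda>z. p z * z powi (- k)) = avg (\<lambda>z. \<Sum>j=-int N..int N. c j * z powi (j - k))"
      unfolding p sum_distrib_right
    proof (intro avg_cong sum.cong refl)
      show "c j * z powi j * z powi (- k) = c j * z powi (j - k)" if "z \<in> \<S>" for z j
        using power_int_add_sphere[OF that, of j "- k"] by simp
    qed
    also have "\<dots> = (\<Sum>j=-int N..int N. avg (\<lambda>z. c j * z powi (j - k)))"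
      by (intro avg_sum continuous_intros cont) auto
    also have "\<dots> = (\<Sum>j=-int N..int N. if j = k then c k else 0)"
      by (intro sum.cong) (auto simp: avg_mult_left avg_power_int)
    also have "\<dots> = c k" using k by simp
    finally have "c k = avg (\<lambda>z. p z * z powi (- k))" ..
    also have "cmod \<dots> \<le> M"
      by (rule norm_avg_le)
        (use assms(2) in \<open>auto intro!: continuous_intros trig_op_continuous[OF assms(1)] simp: norm_mult norm_power_int power_int_minus norm_inverse\<close>)
    finally have "cmod (c k) \<le> M" .
    moreover have "norm (scalar_op (c k) o\<^sub>L V k) \<le> cmod (c k) * 1"
      by (rule order_trans[OF norm_scalar_op_compose_le]) (intro mult_left_mono norm_V_le norm_ge_zero)
    ultimately show ?thesis by simp
  qed
  hence "norm P \<le> real (card {-int N..int N}) * M" unfolding P by (rule sum_norm_bound)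
  thus ?thesis by (simp add: add.commute)
qed

text \<open>For \<open>A = P*P\<close> the crude bound above, applied to \<open>A\<^sup>m\<close> with \<open>m = 2\<^sup>n\<close>, loses only a factor
  linear in \<open>m\<close>, while \<open>\<parallel>A\<^sup>m\<parallel> = \<parallel>A\<parallel>\<^sup>m\<close>.\<close>

lemma trig_op_norm_le:
  assumes P: "trig_op N p P" and M: "\<And>z. z \<in> \<S> \<Longrightarrow> cmod (p z) \<le> M"
  shows "norm P \<le> M"
proof -
  have "M \<ge> 0" using order_trans[OF norm_ge_zero M[of 1]] by simp
  define A where "A = adj P o\<^sub>L P"
  have PB: "P \<in> BH" using trig_op_in_R[OF P] by simp
  have A: "A \<in> BH" "adj A = A" using PB by (auto simp: A_def adj_compose)
  obtain p' where p': "trig_op N p' (adj P)" "\<forall>z\<in>\<S>. cnj (p z) = p' z" using trig_op_adj[OF P] by blast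
  obtain a where a: "trig_op (N + N) a A" "\<forall>z\<in>\<S>. p' z * p z = a z"
    using trig_op_mult[OF p'(1) P] unfolding A_def by blast
  \<comment> \<open>The operator A has degree 2N and its m-th power degree 2Nm, so the number of
    coefficients is 4Nm + 1 with m = 2^n.\<close>
  have "norm A ^ (2 ^ n) \<le> (4 * real N * real (2 ^ n) + 1) * (M\<^sup>2) ^ (2 ^ n)" for n
  proof -
    obtain r where r: "trig_op ((N + N) * 2 ^ n) r (opow A (2 ^ n))" "\<forall>z\<in>\<S>. a z ^ 2 ^ n = r z"
      using trig_op_opow[OF a(1)] by blast
    have "norm (opow A (2 ^ n)) \<le> (2 * real ((N + N) * 2 ^ n) + 1) * (M\<^sup>2) ^ (2 ^ n)"
    proof (rule trig_op_norm_le_length[OF r(1)])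
      fix z :: complex assume z: "z \<in> \<S>"
      have "cmod (a z) = (cmod (p z))\<^sup>2"
        using a(2) p'(2) z by (metis complex_mod_cnj norm_mult power2_eq_square)
      moreover have "(cmod (p z))\<^sup>2 \<le> M\<^sup>2" using M[OF z] by (intro power_mono) auto
      ultimately have "cmod (a z) ^ 2 ^ n \<le> (M\<^sup>2) ^ 2 ^ n" by (intro power_mono) auto
      thus "cmod (r z) \<le> (M\<^sup>2) ^ 2 ^ n" using r(2) z by (metis norm_power)
    qed
    moreover have "2 * real ((N + N) * 2 ^ n) = 4 * real N * real (2 ^ n)" by simp
    ultimately show ?thesis by (simp only: norm_opow_selfadjoint[OF A])
  qed
  hence "norm A \<le> M\<^sup>2" by (rule power_le_linear_growth[OF norm_ge_zero zero_le_power2])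
  hence "(norm P)\<^sup>2 \<le> M\<^sup>2" using norm_adj_compose_self[OF PB] by (simp add: A_def)
  thus ?thesis using \<open>M \<ge> 0\<close> by (rule power2_le_imp_le)
qed

lemma trig_op_trace: "trig_op N p P \<Longrightarrow> \<tau> P = avg p"
proof (induction rule: trig_op.induct)
  case (monomial k N c)
  show ?case by (simp only: trace_scale[OF V_in_R] trace_V avg_mult_left avg_power_int)
next
  case (add N p P q Q)
  thus ?case using trig_op_continuous trig_op_in_R by (simp add: trace_add avg_add)
qed

text \<open>The trace of the m-th power of A = P*P is the average of |p|^(2m). Boundedness of the
  trace makes this at most C times the m-th power of the norm of A, and
  \<open>le_of_avg_power_le\<close> turns the moment bound into a pointwise one.\<close>

lemma trig_op_norm_ge:
  assumes P: "trig_op N p P" and z: "z \<in> \<S>"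
  shows "cmod (p z) \<le> norm P"
proof -
  obtain C where C: "\<And>T. T \<in> R \<Longrightarrow> cmod (\<tau> T) \<le> C * norm T"
    using normal_functional_bounded[OF trace_normal] by blast
  \<comment> \<open>The bound comes without a sign for C; evaluating it at the identity, of trace 1,
    excludes C < 0.\<close>
  have "C \<ge> 0"
  proof (rule ccontr)
    assume "\<not> ?thesis"
    hence "C * norm (id_blinfun :: 'h \<Rightarrow>\<^sub>L 'h) \<le> 0" by (simp add: mult_nonpos_nonneg)
    thus False using C[OF R_id] trace_id by simp
  qed
  define A where "A = adj P o\<^sub>L P"
  have PB: "P \<in> BH" using trig_op_in_R[OF P] by simp
  obtain p' where p': "trig_op N p' (adj P)" "\<forall>z\<in>\<S>. cnj (p z) = p' z" using trig_op_adj[OF P] by blast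
  obtain a where a: "trig_op (N + N) a A" "\<forall>z\<in>\<S>. p' z * p z = a z"
    using trig_op_mult[OF p'(1) P] unfolding A_def by blast
  have "(cmod (p z))\<^sup>2 \<le> norm A"
  proof (rule le_of_avg_power_le[of "\<lambda>z. (cmod (p z))\<^sup>2", OF _ _ z])
    fix m
    obtain r where r: "trig_op ((N + N) * m) r (opow A m)" "\<forall>z\<in>\<S>. a z ^ m = r z"
      using trig_op_opow[OF a(1)] by blast
    have "r z = complex_of_real (((cmod (p z))\<^sup>2) ^ m)" if "z \<in> \<S>" for z
    proof -
      have "a z = complex_of_real ((cmod (p z))\<^sup>2)"
        using a(2) p'(2) that by (metis complex_norm_square mult.commute)
      thus ?thesis using r(2) that by (metis of_real_power)
    qed
    hence "avg r = complex_of_real (avg (\<lambda>z. ((cmod (p z))\<^sup>2) ^ m))"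
      unfolding avg_of_real[symmetric] by (rule avg_cong)
    hence "\<bar>avg (\<lambda>z. ((cmod (p z))\<^sup>2) ^ m)\<bar> = cmod (\<tau> (opow A m))"
      unfolding trig_op_trace[OF r(1)] by simp
    also have "\<dots> \<le> C * norm (opow A m)" using C trig_op_in_R[OF r(1)] by blast
    also have "\<dots> \<le> C * norm A ^ m" using \<open>C \<ge> 0\<close> by (intro mult_left_mono norm_opow_le)
    finally show "avg (\<lambda>z. ((cmod (p z))\<^sup>2) ^ m) \<le> C * norm A ^ m" by linarith
  qed (auto intro!: continuous_intros trig_op_continuous[OF P])
  hence "(cmod (p z))\<^sup>2 \<le> (norm P)\<^sup>2" using norm_adj_compose_self[OF PB] by (simp add: A_def)
  thus ?thesis by (rule power2_le_imp_le) simp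
qed

section \<open>Norm limits and the construction of the calculus of \<open>v\<close>\<close>

definition op_limit :: "(complex \<Rightarrow> complex) \<Rightarrow> ('h \<Rightarrow>\<^sub>L 'h) \<Rightarrow> bool" where
  "op_limit f T \<longleftrightarrow> (\<exists>N p P. (\<forall>n. trig_op (N n) (p n) (P n)) \<and>
     uniform_limit \<S> p f sequentially \<and> P \<longlonglongrightarrow> T)"

lemma op_limitI:
  "(\<And>n. trig_op (N n) (p n) (P n)) \<Longrightarrow> uniform_limit \<S> p f sequentially \<Longrightarrow> P \<longlonglongrightarrow> T \<Longrightarrow> op_limit f T"
  unfolding op_limit_def by blast

lemma op_limitE:
  assumes "op_limit f T"
  obtains N p P where "\<And>n. trig_op (N n) (p n) (P n)" "uniform_limit \<S> p f sequentially" "P \<longlonglongrightarrow> T"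
  using assms unfolding op_limit_def by blast

lemma op_limit_trig_op:
  assumes "trig_op N p P" "\<And>z. z \<in> \<S> \<Longrightarrow> f z = p z"
  shows "op_limit f P"
  by (rule op_limitI[OF assms(1)]) (use assms(2) in \<open>auto simp: uniform_limit_iff\<close>)

lemma op_limit_ex:
  assumes f: "continuous_on \<S> f"
  shows "\<exists>T. op_limit f T"
proof -
  obtain N p where p: "\<And>n. trig (N n) (p n)" "uniform_limit \<S> p f sequentially"
    using trig_dense[OF f] by blast
  obtain P where P: "\<And>n. trig_op (N n) (p n) (P n)" using trig_trig_op[OF p(1)] by metis
  have "Cauchy P"
  proof (rule CauchyI)
    fix e :: real assume e: "e > 0"
    have "\<forall>\<^sub>F n in sequentially. \<forall>z\<in>\<S>. dist (p n z) (f z) < e / 4"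
      by (rule uniform_limitD[OF p(2)]) (use e in simp)
    then obtain n0 where n0: "\<And>n z. n \<ge> n0 \<Longrightarrow> z \<in> \<S> \<Longrightarrow> dist (p n z) (f z) < e / 4"
      unfolding eventually_sequentially by blast
    have "norm (P m - P n) < e" if "m \<ge> n0" "n \<ge> n0" for m n
    proof -
      have "norm (P m - P n) \<le> e / 2"
      proof (rule trig_op_norm_le[OF trig_op_diff[OF P P]])
        fix z assume "z \<in> \<S>"
        thus "cmod (p m z - p n z) \<le> e / 2"
          using n0[OF that(1), of z] n0[OF that(2), of z] dist_triangle2[of "p m z" "p n z" "f z"]
          by (simp add: dist_norm)
      qed
      thus ?thesis using e by simp
    qed
    thus "\<exists>M. \<forall>m\<ge>M. \<forall>n\<ge>M. norm (P m - P n) < e" by blast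
  qed
  then obtain T where "P \<longlonglongrightarrow> T" using Cauchy_convergent convergent_def by blast
  thus ?thesis using op_limitI[OF P p(2)] by blast
qed

lemma op_limit_norm_le:
  assumes "op_limit f T" "\<And>z. z \<in> \<S> \<Longrightarrow> cmod (f z) \<le> M"
  shows "norm T \<le> M"
proof (rule field_le_epsilon)
  fix e :: real assume e: "e > 0"
  obtain N p P where P: "\<And>n. trig_op (N n) (p n) (P n)" "uniform_limit \<S> p f sequentially" "P \<longlonglongrightarrow> T"
    using assms(1) by (rule op_limitE) blast
  have "\<forall>\<^sub>F n in sequentially. \<forall>z\<in>\<S>. dist (p n z) (f z) < e"
    by (rule uniform_limitD[OF P(2) e])
  hence "\<forall>\<^sub>F n in sequentially. norm (P n) \<le> M + e"
  proof eventually_elim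
    case (elim n)
    show ?case
    proof (rule trig_op_norm_le[OF P(1)])
      fix z assume z: "z \<in> \<S>"
      thus "cmod (p n z) \<le> M + e"
        using elim[rule_format, OF z] assms(2)[OF z] norm_triangle_sub[of "p n z" "f z"]
        by (simp add: dist_norm)
    qed
  qed
  thus "norm T \<le> M + e"
    by (intro tendsto_upperbound[OF tendsto_norm[OF P(3)]]) auto
qed

lemma op_limit_norm_ge:
  assumes "op_limit f T" "z \<in> \<S>"
  shows "cmod (f z) \<le> norm T"
proof -
  obtain N p P where P: "\<And>n. trig_op (N n) (p n) (P n)" "uniform_limit \<S> p f sequentially" "P \<longlonglongrightarrow> T"
    using assms(1) by (rule op_limitE) blast
  have "(\<lambda>n. cmod (p n z)) \<longlonglongrightarrow> cmod (f z)"
    by (intro tendsto_norm tendsto_uniform_limitI[OF P(2) assms(2)])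
  from LIMSEQ_le[OF this tendsto_norm[OF P(3)]] show ?thesis
    using trig_op_norm_ge[OF P(1) assms(2)] by blast
qed

lemma op_limit_in_R: "op_limit f T \<Longrightarrow> T \<in> R"
  by (erule op_limitE) (meson R_limit trig_op_in_R)

lemma op_limit_trace:
  assumes "op_limit f T"
  shows "\<tau> T = avg f"
proof -
  obtain N p P where P: "\<And>n. trig_op (N n) (p n) (P n)" "uniform_limit \<S> p f sequentially" "P \<longlonglongrightarrow> T"
    using assms(1) by (rule op_limitE) blast
  have "(\<lambda>n. \<tau> (P n)) \<longlonglongrightarrow> \<tau> T" by (rule trace_limit[OF trig_op_in_R[OF P(1)] P(3)])
  moreover have "(\<lambda>n. avg (p n)) \<longlonglongrightarrow> avg f"
    by (rule avg_uniform_limit[OF P(2) trig_op_continuous[OF P(1)]])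
  ultimately show ?thesis using trig_op_trace[OF P(1)] LIMSEQ_unique by simp
qed

lemma op_limit_add:
  assumes "op_limit f S" "op_limit g T"
  shows "op_limit (\<lambda>z. f z + g z) (S + T)"
proof -
  obtain N p P where P: "\<And>n. trig_op (N n) (p n) (P n)" "uniform_limit \<S> p f sequentially" "P \<longlonglongrightarrow> S"
    using assms(1) by (rule op_limitE) blast
  obtain M q Q where Q: "\<And>n. trig_op (M n) (q n) (Q n)" "uniform_limit \<S> q g sequentially" "Q \<longlonglongrightarrow> T"
    using assms(2) by (rule op_limitE) blast
  have "trig_op (max (N n) (M n)) (\<lambda>z. p n z + q n z) (P n + Q n)" for n
    by (rule trig_op.add[OF trig_op_mono[OF P(1)] trig_op_mono[OF Q(1)]]) auto
  thus ?thesis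
    by (rule op_limitI[OF _ uniform_limit_add[OF P(2) Q(2)] tendsto_add[OF P(3) Q(3)]])
qed

lemma op_limit_diff:
  assumes "op_limit f S" "op_limit g T"
  shows "op_limit (\<lambda>z. f z - g z) (S - T)"
proof -
  obtain N p P where P: "\<And>n. trig_op (N n) (p n) (P n)" "uniform_limit \<S> p f sequentially" "P \<longlonglongrightarrow> S"
    using assms(1) by (rule op_limitE) blast
  obtain M q Q where Q: "\<And>n. trig_op (M n) (q n) (Q n)" "uniform_limit \<S> q g sequentially" "Q \<longlonglongrightarrow> T"
    using assms(2) by (rule op_limitE) blast
  show ?thesis
    by (rule op_limitI[OF trig_op_diff[OF P(1) Q(1)] uniform_limit_minus[OF P(2) Q(2)] tendsto_diff[OF P(3) Q(3)]])
qed

lemma op_limit_unique: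
  assumes "op_limit f S" "op_limit f T"
  shows "S = T"
  using op_limit_norm_le[OF op_limit_diff[OF assms], of 0] by simp

lemma op_limit_mult:
  assumes "op_limit f S" "op_limit g T" "continuous_on \<S> f" "continuous_on \<S> g"
  shows "op_limit (\<lambda>z. f z * g z) (S o\<^sub>L T)"
proof -
  obtain N p P where P: "\<And>n. trig_op (N n) (p n) (P n)" "uniform_limit \<S> p f sequentially" "P \<longlonglongrightarrow> S"
    using assms(1) by (rule op_limitE) blast
  obtain M q Q where Q: "\<And>n. trig_op (M n) (q n) (Q n)" "uniform_limit \<S> q g sequentially" "Q \<longlonglongrightarrow> T"
    using assms(2) by (rule op_limitE) blast
  have "\<forall>n. \<exists>r. trig_op (N n + M n) r (P n o\<^sub>L Q n) \<and> (\<forall>z\<in>\<S>. p n z * q n z = r z)"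
    using trig_op_mult[OF P(1) Q(1)] by blast
  then obtain r where r: "\<And>n. trig_op (N n + M n) (r n) (P n o\<^sub>L Q n)" "\<And>n. \<forall>z\<in>\<S>. p n z * q n z = r n z"
    unfolding choice_iff by blast
  have "uniform_limit \<S> (\<lambda>n z. p n z * q n z) (\<lambda>z. f z * g z) sequentially"
    using P(2) Q(2) assms(3,4) by (intro uniform_lim_mult bounded_continuous_image_sphere)
  hence "uniform_limit \<S> r (\<lambda>z. f z * g z) sequentially"
    using r(2) by (subst (asm) uniform_limit_cong') auto
  moreover have "(\<lambda>n. P n o\<^sub>L Q n) \<longlonglongrightarrow> (S o\<^sub>L T)"
    by (rule bounded_bilinear.tendsto[OF bounded_bilinear_blinfun_compose P(3) Q(3)])
  ultimately show ?thesis by (rule op_limitI[OF r(1)])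
qed

lemma op_limit_adj:
  assumes "op_limit f T"
  shows "op_limit (\<lambda>z. cnj (f z)) (adj T)"
proof -
  obtain N p P where P: "\<And>n. trig_op (N n) (p n) (P n)" "uniform_limit \<S> p f sequentially" "P \<longlonglongrightarrow> T"
    using assms(1) by (rule op_limitE) blast
  have "\<forall>n. \<exists>r. trig_op (N n) r (adj (P n)) \<and> (\<forall>z\<in>\<S>. cnj (p n z) = r z)"
    using trig_op_adj[OF P(1)] by blast
  then obtain r where r: "\<And>n. trig_op (N n) (r n) (adj (P n))" "\<And>n. \<forall>z\<in>\<S>. cnj (p n z) = r n z"
    unfolding choice_iff by blast
  have "dist (cnj a) (cnj b) = dist a b" for a b :: complex
    by (metis complex_cnj_diff complex_mod_cnj dist_norm)
  hence "uniform_limit \<S> (\<lambda>n z. cnj (p n z)) (\<lambda>z. cnj (f z)) sequentially"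
    using P(2) by (simp add: uniform_limit_iff)
  hence "uniform_limit \<S> r (\<lambda>z. cnj (f z)) sequentially"
    using r(2) by (subst (asm) uniform_limit_cong') auto
  moreover have "(\<lambda>n. adj (P n)) \<longlonglongrightarrow> adj T"
  proof -
    have "T \<in> BH" using op_limit_in_R[OF assms] by simp
    hence "norm (adj (P n) - adj T) = norm (P n - T)" for n
      using trig_op_in_R[OF P(1)] by (simp flip: adj_diff)
    thus ?thesis using P(3) by (simp add: tendsto_iff dist_norm)
  qed
  ultimately show ?thesis by (rule op_limitI[OF r(1)])
qed

text \<open>The second conjunct keeps the link to approximating trigonometric polynomials, through
  which the trace of the calculus is computed.\<close>

lemma calculus_op_limit: "\<exists>\<Phi>. calculus \<S> v \<Phi> \<and> (\<forall>f. continuous_on \<S> f \<longrightarrow> op_limit f (\<Phi> f))"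
proof -
  define \<Phi> where "\<Phi> f = (THE T. op_limit f T)" for f
  have \<Phi>: "\<Phi> f = T" if "op_limit f T" for f T
    unfolding \<Phi>_def using that op_limit_unique by (intro the_equality) auto
  have ex: "op_limit f (\<Phi> f)" if "continuous_on \<S> f" for f
    using op_limit_ex[OF that] \<Phi> by blast
  have "calculus \<S> v \<Phi>"
  proof
    show "\<Phi> (\<lambda>z. c) = scalar_op c" for c
      by (rule \<Phi>, rule op_limit_trig_op[of 0 _ "scalar_op c"])
        (use trig_op.monomial[of 0 0 c] in auto)
    show "\<Phi> (\<lambda>z. z) = v"
      by (rule \<Phi>, rule op_limit_trig_op[of 1 _ v]) (use trig_op.monomial[of 1 1 1] in auto)
    fix f :: "complex \<Rightarrow> complex" assume f: "continuous_on \<S> f"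
    show "\<Phi> f \<in> BH" using op_limit_in_R[OF ex[OF f]] by simp
    show "\<Phi> (\<lambda>z. cnj (f z)) = adj (\<Phi> f)" by (rule \<Phi>[OF op_limit_adj[OF ex[OF f]]])
    have le: "cmod (f z) \<le> norm (\<Phi> f)" if "z \<in> \<S>" for z by (rule op_limit_norm_ge[OF ex[OF f] that])
    show "norm (\<Phi> f) = (SUP z\<in>\<S>. cmod (f z))"
    proof (rule antisym)
      have "bdd_above ((\<lambda>z. cmod (f z)) ` \<S>)" using le by (intro bdd_aboveI2)
      thus "norm (\<Phi> f) \<le> (SUP z\<in>\<S>. cmod (f z))"
        by (intro op_limit_norm_le[OF ex[OF f]] cSUP_upper)
      show "(SUP z\<in>\<S>. cmod (f z)) \<le> norm (\<Phi> f)" using le by (intro cSUP_least) auto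
    qed
    fix g :: "complex \<Rightarrow> complex" assume g: "continuous_on \<S> g"
    show "\<Phi> (\<lambda>z. f z + g z) = \<Phi> f + \<Phi> g" by (rule \<Phi>[OF op_limit_add[OF ex[OF f] ex[OF g]]])
    show "\<Phi> (\<lambda>z. f z * g z) = \<Phi> f o\<^sub>L \<Phi> g" by (rule \<Phi>[OF op_limit_mult[OF ex[OF f] ex[OF g] f g]])
  qed auto
  thus ?thesis using ex by blast
qed

lemma calculus_v: "calculus \<S> v (cfc v)"
  using calculus_op_limit calculus.calculus_cfc by blast

lemma op_limit_cfc:
  assumes "continuous_on \<S> f"
  shows "op_limit f (cfc v f)"
  using calculus_op_limit calculus_unique[OF calculus_v _ assms] assms by metis

lemma trace_cfc: "continuous_on \<S> f \<Longrightarrow> \<tau> (cfc v f) = avg f"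
  by (rule op_limit_trace[OF op_limit_cfc])

end

sublocale rotation_pair \<subseteq> calculus "sphere 0 1" v "cfc v"
  by (rule calculus_v)

text \<open>With empty spectrum T would be invertible, so its powers could not decay faster than
  those of its inverse grow; yet the bound B \<rho>^n would be available for every \<rho> > 0.
  Nonemptiness makes the supremum in \<open>spectral_radius\<close> meaningful.\<close>

lemma spectrum_nonempty:
  assumes T: "T \<in> BH" and nz: "(id_blinfun :: 'h::complex_hilbert \<Rightarrow>\<^sub>L 'h) \<noteq> 0"
  shows "spectrum (T :: 'h \<Rightarrow>\<^sub>L 'h) \<noteq> {}"
proof
  assume empty: "spectrum T = {}"
  have "invertible_op T" using empty spectrum_iff[of 0 T] by simp
  then obtain S where S: "S \<in> BH" "S o\<^sub>L T = id_blinfun" by (auto simp: invertible_op_def)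
  have ST: "opow S n o\<^sub>L opow T n = id_blinfun" for n
  proof (induction n)
    case (Suc n)
    have "opow S (Suc n) o\<^sub>L opow T (Suc n) = opow S n o\<^sub>L ((S o\<^sub>L T) o\<^sub>L opow T n)"
      by (simp add: compose_assoc flip: opow_commute)
    thus ?case by (simp add: S Suc)
  qed simp
  \<comment> \<open>Chosen so that (norm S + 1) \<rho> = 1/2; the added 1 avoids division by
    0.\<close>
  define \<rho> where "\<rho> = 1 / (2 * (norm S + 1))"
  have \<rho>: "\<rho> > 0" by (simp add: \<rho>_def add_nonneg_pos)
  obtain B where B: "\<And>n. norm (opow T n) \<le> B * \<rho> ^ n"
    using opow_bound_of_spectrum[OF T \<rho>] empty by auto
  have "norm (id_blinfun :: 'h \<Rightarrow>\<^sub>L 'h) \<le> B * (1 / 2) ^ n" for n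
  proof -
    have "norm (id_blinfun :: 'h \<Rightarrow>\<^sub>L 'h) \<le> norm (opow S n) * norm (opow T n)"
      using norm_blinfun_compose[of "opow S n" "opow T n"] by (simp add: ST)
    also have "\<dots> \<le> (norm S + 1) ^ n * (B * \<rho> ^ n)"
    proof (intro mult_mono B)
      show "norm (opow S n) \<le> (norm S + 1) ^ n"
        by (rule order_trans[OF norm_opow_le]) (intro power_mono, auto)
    qed auto
    also have "\<dots> = B * ((norm S + 1) * \<rho>) ^ n" by (simp add: power_mult_distrib mult_ac)
    also have "(norm S + 1) * \<rho> = 1 / 2"
      using norm_ge_zero[of S] by (simp add: \<rho>_def field_simps del: norm_ge_zero)
    finally show ?thesis .
  qed
  moreover have "(\<lambda>n. B * (1 / 2) ^ n) \<longlonglongrightarrow> B * 0"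
    by (intro tendsto_intros LIMSEQ_power_zero) auto
  ultimately have "norm (id_blinfun :: 'h \<Rightarrow>\<^sub>L 'h) \<le> 0"
    by (intro LIMSEQ_le_const[of "\<lambda>n. B * (1 / 2) ^ n"]) auto
  thus False using nz by simp
qed

text \<open>For fixed \<open>\<epsilon>\<close> the inequality holds at a maximum of \<open>\<Sum>k<n. ln (f (c ^ k * z) + \<epsilon>)\<close>, which is
  at least the average of this function; compactness lets \<open>\<epsilon>\<close> tend to 0.\<close>

lemma geometric_mean_le_prod:
  fixes f :: "complex \<Rightarrow> real" and c :: complex
  assumes f: "continuous_on (sphere 0 1) f" and nn: "\<And>z. z \<in> sphere 0 1 \<Longrightarrow> f z \<ge> 0"
    and c: "cmod c = 1"
    and D: "D \<ge> 0" "\<And>\<epsilon>. \<epsilon> > 0 \<Longrightarrow> D \<le> exp (avg (\<lambda>z. ln (f z + \<epsilon>)))"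
  shows "\<exists>z\<in>sphere 0 1. D ^ n \<le> (\<Prod>k<n. f (c ^ k * z))"
proof -
  let ?S = "sphere (0::complex) 1"
  have ck: "cmod (c ^ k) = 1" for k using c by (simp add: norm_power)
  have S: "c ^ k * z \<in> ?S" if "z \<in> ?S" for k z using that ck by (simp add: norm_mult)
  have fk: "continuous_on ?S (\<lambda>z. f (c ^ k * z))" for k
    by (rule continuous_on_compose2[OF f]) (use S in \<open>auto intro!: continuous_intros\<close>)
  have step: "\<exists>z\<in>?S. D ^ n \<le> (\<Prod>k<n. f (c ^ k * z) + \<epsilon>)" if e: "\<epsilon> > 0" for \<epsilon>
  proof -
    define G where "G z = (\<Sum>k<n. ln (f (c ^ k * z) + \<epsilon>))" for z
    have pos: "f (c ^ k * z) + \<epsilon> > 0" if "z \<in> ?S" for k z using nn[OF S[OF that]] e by (simp add: add_nonneg_pos)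
    have ln: "continuous_on ?S (\<lambda>z. ln (f (c ^ k * z) + \<epsilon>))" for k
      using pos by (intro continuous_intros fk) (auto simp: less_le)
    have G: "continuous_on ?S G" unfolding G_def by (intro continuous_intros ln)
    obtain z where z: "z \<in> ?S" "\<And>w. w \<in> ?S \<Longrightarrow> G w \<le> G z"
      using continuous_attains_sup[OF _ _ G] by auto
    \<comment> \<open>By rotation invariance every summand of \<open>G\<close> has the same average,
      so the average of \<open>G\<close> is n times that of ln (f + \<epsilon>).\<close>
    have "avg (\<lambda>z. ln (f (c ^ k * z) + \<epsilon>)) = avg (\<lambda>z. ln (f z + \<epsilon>))" for k
      using ln[of 0] by (intro avg_rotate_real[of "\<lambda>z. ln (f z + \<epsilon>)"] ck) simp
    hence "real n * avg (\<lambda>z. ln (f z + \<epsilon>)) = avg G"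
      unfolding G_def by (simp add: avg_sum[OF ln])
    also have "avg G \<le> avg (\<lambda>w. G z)" using z(2) by (intro avg_mono G continuous_on_const)
    finally have "real n * avg (\<lambda>z. ln (f z + \<epsilon>)) \<le> G z" by simp
    have "D ^ n \<le> exp (avg (\<lambda>z. ln (f z + \<epsilon>))) ^ n" using D e by (intro power_mono)
    also have "\<dots> = exp (real n * avg (\<lambda>z. ln (f z + \<epsilon>)))" by (simp add: exp_of_nat_mult)
    also have "\<dots> \<le> exp (G z)" using \<open>_ \<le> G z\<close> by simp
    also have "\<dots> = (\<Prod>k<n. f (c ^ k * z) + \<epsilon>)" using pos[OF z(1)] by (simp add: G_def exp_sum)
    finally show ?thesis using z(1) by blast
  qed
  have "\<exists>z\<in>?S. D ^ n \<le> (\<Prod>k<n. f (c ^ k * z) + inverse (real (Suc m)))" for m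
    by (rule step) simp
  then obtain z where z: "\<And>m. z m \<in> ?S" "\<And>m. D ^ n \<le> (\<Prod>k<n. f (c ^ k * z m) + inverse (real (Suc m)))"
    by metis
  obtain w r where w: "w \<in> ?S" "strict_mono r" "(z \<circ> r) \<longlonglongrightarrow> w"
    using compact_sphere[of "0::complex" 1] z(1) unfolding compact_def by metis
  have "(\<lambda>m. f (c ^ k * z (r m))) \<longlonglongrightarrow> f (c ^ k * w)" for k
    using continuous_on_tendsto_compose[OF fk[of k] w(3) w(1)] z(1) by (simp add: o_def)
  moreover have "(\<lambda>m. inverse (real (Suc (r m)))) \<longlonglongrightarrow> 0"
    using LIMSEQ_subseq_LIMSEQ[OF LIMSEQ_inverse_real_of_nat w(2)] by (simp add: o_def)
  ultimately have "(\<lambda>m. \<Prod>k<n. f (c ^ k * z (r m)) + inverse (real (Suc (r m)))) \<longlonglongrightarrow> (\<Prod>k<n. f (c ^ k * w) + 0)"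
    by (intro tendsto_prod tendsto_add)
  hence "D ^ n \<le> (\<Prod>k<n. f (c ^ k * w) + 0)"
    by (rule LIMSEQ_le_const) (use z(2) in blast)
  thus ?thesis using w(1) by auto
qed

section \<open>The spectral radius of the weighted rotation operator\<close>

context rotation_pair
begin

text \<open>On the generators this is the commutation relation and its adjoint version: pulling u to
  the left rotates the symbol. Both sides respect sums, products and uniform limits.\<close>

lemma cfc_u:
  assumes "continuous_on \<S> g"
  shows "cfc v g o\<^sub>L u = u o\<^sub>L cfc v (\<lambda>z. g (circ \<theta> * z))"
proof -
  let ?c = "circ \<theta>" and ?P = "\<lambda>g. cfc v g o\<^sub>L u = u o\<^sub>L cfc v (\<lambda>z. g (circ \<theta> * z))"
  have u: "u \<in> BH" using u_in_R by simp
  note rot = continuous_on_rotate[OF _ norm_circ]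
  show ?thesis
  proof (rule continuous_complex_induct[OF compact assms, where P = ?P])
    show "cfc v (\<lambda>z. k) o\<^sub>L u = u o\<^sub>L cfc v (\<lambda>z. k)" for k
      by (simp add: calc_const scalar_op_commute[OF u])
    show "cfc v (\<lambda>z. z) o\<^sub>L u = u o\<^sub>L cfc v (\<lambda>z. ?c * z)"
      by (simp add: calc_cmult calc_ident commutation scalar_op_left_commute[OF u])
    have "cfc v (\<lambda>z. cnj z) = adj v" using calc_adj[of "\<lambda>z. z"] by (simp add: calc_ident)
    thus "cfc v (\<lambda>z. cnj z) o\<^sub>L u = u o\<^sub>L cfc v (\<lambda>z. cnj (?c * z))"
      by (simp add: calc_cmult adj_commutation scalar_op_left_commute[OF u] continuous_on_cnj)
  next
    fix f g assume fg: "continuous_on \<S> f" "continuous_on \<S> g" "?P f" "?P g"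
    thus "?P (\<lambda>z. f z + g z)" by (simp add: calc_add rot compose_distrib)
    have "(cfc v f o\<^sub>L cfc v g) o\<^sub>L u = (cfc v f o\<^sub>L u) o\<^sub>L cfc v (\<lambda>z. g (?c * z))"
      by (simp add: compose_assoc fg(4))
    thus "?P (\<lambda>z. f z * g z)" using fg by (simp add: calc_mult rot compose_assoc)
  next
    fix f g assume g: "\<And>n. continuous_on \<S> (g n)" "\<And>n. ?P (g n)" "uniform_limit \<S> g f sequentially"
    have "(\<lambda>n. cfc v (g n) o\<^sub>L u) \<longlonglongrightarrow> (cfc v f o\<^sub>L u)"
      by (intro bounded_bilinear.tendsto[OF bounded_bilinear_blinfun_compose] tendsto_const calc_limit g)
    moreover have "(\<lambda>n. u o\<^sub>L cfc v (\<lambda>z. g n (?c * z))) \<longlonglongrightarrow> (u o\<^sub>L cfc v (\<lambda>z. f (?c * z)))"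
      by (intro bounded_bilinear.tendsto[OF bounded_bilinear_blinfun_compose] tendsto_const calc_limit
          uniform_limit_rotate rot g norm_circ)
    ultimately show "?P f" using g(2) LIMSEQ_unique by simp
  qed
qed

lemma cfc_opow_u:
  assumes "continuous_on \<S> g"
  shows "cfc v g o\<^sub>L opow u n = opow u n o\<^sub>L cfc v (\<lambda>z. g (circ \<theta> ^ n * z))"
  using assms
proof (induction n arbitrary: g)
  case (Suc n)
  have "cfc v g o\<^sub>L opow u (Suc n) = u o\<^sub>L (cfc v (\<lambda>z. g (circ \<theta> * z)) o\<^sub>L opow u n)"
    using cfc_u[OF Suc.prems] by (simp flip: compose_assoc)
  also have "\<dots> = opow u (Suc n) o\<^sub>L cfc v (\<lambda>z. g (circ \<theta> ^ Suc n * z))"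
    using Suc.IH[OF continuous_on_rotate[OF Suc.prems norm_circ[of \<theta>]]] by (simp add: compose_assoc mult.assoc)
  finally show ?case .
qed simp

lemma continuous_on_orbit_prod:
  "continuous_on \<S> f \<Longrightarrow> continuous_on \<S> (\<lambda>z. \<Prod>k<n. f (circ \<theta> ^ k * z) :: complex)"
  by (intro continuous_on_prod continuous_on_rotate) (auto simp: norm_power)

lemma opow_u_cfc:
  assumes f: "continuous_on \<S> f"
  shows "opow (u o\<^sub>L cfc v f) n = opow u n o\<^sub>L cfc v (\<lambda>z. \<Prod>k<n. f (circ \<theta> ^ k * z))"
proof (induction n)
  case (Suc n)
  let ?F = "\<lambda>z. \<Prod>k<n. f (circ \<theta> ^ k * z)"
  have rot: "continuous_on \<S> (\<lambda>z. f (circ \<theta> ^ n * z))"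
    by (rule continuous_on_rotate[OF f]) (simp add: norm_power)
  have "opow (u o\<^sub>L cfc v f) (Suc n) = u o\<^sub>L ((cfc v f o\<^sub>L opow u n) o\<^sub>L cfc v ?F)"
    by (simp add: Suc compose_assoc)
  also have "\<dots> = opow u (Suc n) o\<^sub>L (cfc v (\<lambda>z. f (circ \<theta> ^ n * z)) o\<^sub>L cfc v ?F)"
    by (simp add: cfc_opow_u[OF f] compose_assoc)
  also have "cfc v (\<lambda>z. f (circ \<theta> ^ n * z)) o\<^sub>L cfc v ?F = cfc v (\<lambda>z. f (circ \<theta> ^ n * z) * ?F z)"
    by (rule calc_mult[OF rot continuous_on_orbit_prod[OF f], symmetric])
  finally show ?case by (simp add: mult.commute)
qed (simp add: calc_const)

text \<open>Left multiplication by \<open>u\<close> and by \<open>adj u\<close> are mutually inverse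
  contractions, hence isometries.\<close>

lemma norm_opow_u_compose: "norm (opow u n o\<^sub>L (T :: 'h \<Rightarrow>\<^sub>L 'h)) = norm T"
proof (induction n)
  case (Suc n)
  have u: "u \<in> BH" using u_in_R by simp
  have "(norm u)\<^sup>2 \<le> 1\<^sup>2"
    using norm_adj_compose_self[OF u] norm_blinfun_id_le[where 'a = 'h] by simp
  hence "norm u \<le> 1" by (rule power2_le_imp_le) simp
  hence le: "norm (u o\<^sub>L S) \<le> norm S" "norm (adj u o\<^sub>L S) \<le> norm S" for S :: "'h \<Rightarrow>\<^sub>L 'h"
    using u by (auto intro!: order_trans[OF norm_blinfun_compose] mult_left_le_one_le)
  have "norm (u o\<^sub>L S) = norm S" for S :: "'h \<Rightarrow>\<^sub>L 'h"
    using le(1)[of S] le(2)[of "u o\<^sub>L S"] by (simp add: left_cancel)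
  thus ?case using Suc by (simp add: compose_assoc)
qed simp

text \<open>The multiplicative Mahler measure of f on the circle, with zeros handled by the same
  regularization as in \<open>fk_det\<close>.\<close>

definition mahler :: "(complex \<Rightarrow> complex) \<Rightarrow> real" where
  "mahler f = (INF \<epsilon>\<in>{0<..}. exp (avg (\<lambda>z. ln (cmod (f z) + \<epsilon>))))"

lemma mahler_le: "\<epsilon> > 0 \<Longrightarrow> mahler f \<le> exp (avg (\<lambda>z. ln (cmod (f z) + \<epsilon>)))"
  unfolding mahler_def by (intro cINF_lower bdd_belowI2[of _ 0]) auto

lemma mahler_nonneg: "mahler f \<ge> 0"
  unfolding mahler_def by (intro cINF_greatest) auto

lemma continuous_on_ln_cmod:
  assumes "continuous_on \<S> f" "\<epsilon> > 0"
  shows "continuous_on \<S> (\<lambda>z. ln (cmod (f z) + \<epsilon>))"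
proof -
  have "cmod (f z) + \<epsilon> \<noteq> 0" for z using norm_ge_zero[of "f z"] assms(2) by linarith
  thus ?thesis using assms(1) by (intro continuous_intros) auto
qed

text \<open>For fixed \<epsilon> the function ln (|f| + \<epsilon>) is continuous, so its orbit sums
  are uniformly at most n (a + \<delta>) for large n. This bounds the norm of the n-th power, and a
  single such n already bounds the spectrum.\<close>

lemma spectrum_le_mahler:
  assumes f: "continuous_on \<S> f" and z: "z \<in> spectrum (u o\<^sub>L cfc v f)"
  shows "cmod z \<le> mahler f"
  unfolding mahler_def
proof (intro cINF_greatest)
  fix \<epsilon> :: real assume "\<epsilon> \<in> {0<..}"
  hence e: "\<epsilon> > 0" by simp
  define a where "a = avg (\<lambda>z. ln (cmod (f z) + \<epsilon>))"
  note ln = continuous_on_ln_cmod[OF f e]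
  have pos: "cmod (f w) + \<epsilon> > 0" for w using e by (simp add: add_nonneg_pos)
  have "cmod z \<le> exp (a + \<delta>)" if \<delta>: "\<delta> > 0" for \<delta>
  proof -
    have "continuous_on \<S> (\<lambda>z. complex_of_real (ln (cmod (f z) + \<epsilon>)))"
      using ln by (rule continuous_on_of_real)
    from equidistribution[OF this irrational \<delta>] obtain n0 where n0:
      "\<And>n w. n \<ge> n0 \<Longrightarrow> w \<in> \<S> \<Longrightarrow> cmod ((\<Sum>k<n. complex_of_real (ln (cmod (f (circ \<theta> ^ k * w)) + \<epsilon>)))
          - of_nat n * complex_of_real a) \<le> real n * \<delta>"
      unfolding avg_of_real a_def by blast
    \<comment> \<open>A successor, so that n > 0 and the n-th root can be taken.\<close>
    define n where "n = Suc n0"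
    have "cmod (\<Prod>k<n. f (circ \<theta> ^ k * w)) \<le> exp (a + \<delta>) ^ n" if w: "w \<in> \<S>" for w
    proof -
      let ?G = "\<Sum>k<n. ln (cmod (f (circ \<theta> ^ k * w)) + \<epsilon>)"
      have "\<bar>?G - real n * a\<bar> = cmod (complex_of_real (?G - real n * a))" by (simp only: norm_of_real)
      also have "\<dots> \<le> real n * \<delta>" using n0[of n w] w by (simp add: n_def)
      finally have G: "?G \<le> real n * (a + \<delta>)" by (simp add: algebra_simps)
      have "cmod (\<Prod>k<n. f (circ \<theta> ^ k * w)) \<le> (\<Prod>k<n. cmod (f (circ \<theta> ^ k * w)) + \<epsilon>)"
        unfolding prod_norm[symmetric] using e by (intro prod_mono) auto
      also have "\<dots> = exp ?G" using pos by (simp add: exp_sum)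
      also have "\<dots> \<le> exp (real n * (a + \<delta>))" using G by simp
      also have "\<dots> = exp (a + \<delta>) ^ n" by (rule exp_of_nat_mult)
      finally show ?thesis .
    qed
    hence "norm (opow (u o\<^sub>L cfc v f) n) \<le> exp (a + \<delta>) ^ n"
      unfolding opow_u_cfc[OF f] norm_opow_u_compose
      by (intro calc_norm_le continuous_on_orbit_prod f)
    moreover have "u o\<^sub>L cfc v f \<in> BH" using u_in_R calc_in_BH[OF f] by simp
    ultimately have "cmod z ^ n \<le> exp (a + \<delta>) ^ n"
      using spectrum_norm_power_le[OF _ z, of n] by linarith
    thus ?thesis by (rule power_le_imp_le_base[of _ n0, folded n_def]) simp
  qed
  show "cmod z \<le> exp (avg (\<lambda>z. ln (cmod (f z) + \<epsilon>)))"
  proof (cases "z = 0")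
    case False
    have "ln (cmod z) \<le> a"
    proof (rule field_le_epsilon)
      fix \<delta> :: real assume "\<delta> > 0"
      have "ln (cmod z) \<le> ln (exp (a + \<delta>))"
        using \<open>\<And>\<delta>. \<delta> > 0 \<Longrightarrow> cmod z \<le> exp (a + \<delta>)\<close>[OF \<open>\<delta> > 0\<close>] False by (subst ln_le_cancel_iff) auto
      thus "ln (cmod z) \<le> a + \<delta>" by simp
    qed
    hence "exp (ln (cmod z)) \<le> exp a" by simp
    thus ?thesis using False by (simp add: a_def)
  qed simp
qed auto

lemma mahler_power_le_norm_opow:
  assumes f: "continuous_on \<S> f"
  shows "mahler f ^ n \<le> norm (opow (u o\<^sub>L cfc v f) n)"
proof -
  obtain z where z: "z \<in> \<S>" "mahler f ^ n \<le> (\<Prod>k<n. cmod (f (circ \<theta> ^ k * z)))"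
    using geometric_mean_le_prod[OF continuous_on_norm[OF f] norm_ge_zero norm_circ mahler_nonneg mahler_le]
    by blast
  note z(2)
  also have "(\<Prod>k<n. cmod (f (circ \<theta> ^ k * z))) = cmod (\<Prod>k<n. f (circ \<theta> ^ k * z))" by (rule prod_norm)
  also have "\<dots> \<le> norm (cfc v (\<lambda>z. \<Prod>k<n. f (circ \<theta> ^ k * z)))"
    by (rule calc_norm_ge[OF continuous_on_orbit_prod[OF f] z(1)])
  finally show ?thesis by (simp add: opow_u_cfc[OF f] norm_opow_u_compose)
qed

lemma spectral_radius_eq_mahler:
  assumes f: "continuous_on \<S> f"
  shows "spectral_radius (u o\<^sub>L cfc v f) = mahler f"
proof (rule antisym)
  let ?T = "u o\<^sub>L cfc v f"
  have T: "?T \<in> BH" using u_in_R calc_in_BH[OF f] by simp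
  \<comment> \<open>A trace with value 1 at the identity excludes the zero space, on which every
    spectrum would be empty.\<close>
  have "id_blinfun \<noteq> (0 :: 'h \<Rightarrow>\<^sub>L 'h)"
    using trace_scale[OF R_id, of 0] trace_id by auto
  hence ne: "spectrum ?T \<noteq> {}" by (rule spectrum_nonempty[OF T])
  show "spectral_radius ?T \<le> mahler f"
    unfolding spectral_radius_def using ne spectrum_le_mahler[OF f] by (intro cSUP_least) auto
  have up: "cmod z \<le> spectral_radius ?T" if "z \<in> spectrum ?T" for z
    unfolding spectral_radius_def using spectrum_le_mahler[OF f] that
    by (intro cSUP_upper bdd_aboveI2[of _ _ "mahler f"]) auto
  hence nn: "spectral_radius ?T \<ge> 0" using ne by (meson norm_ge_zero order_trans ex_in_conv)
  show "mahler f \<le> spectral_radius ?T"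
  proof (rule dense_ge)
    fix \<rho> assume \<rho>: "spectral_radius ?T < \<rho>"
    have "\<rho> > 0" using \<rho> nn by linarith
    moreover have "w \<notin> spectrum ?T" if "cmod w \<ge> \<rho>" for w using up[of w] \<rho> that by linarith
    ultimately obtain B where B: "\<And>n. norm (opow ?T n) \<le> B * \<rho> ^ n"
      using opow_bound_of_spectrum[OF T] by blast
    \<comment> \<open>The constant B disappears on taking roots: the growth lemma is used with
      vanishing linear coefficient.\<close>
    show "mahler f \<le> \<rho>"
    proof (rule power_le_linear_growth[OF mahler_nonneg])
      show "mahler f ^ 2 ^ n \<le> (0 * real (2 ^ n) + B) * \<rho> ^ 2 ^ n" for n
        using order_trans[OF mahler_power_le_norm_opow[OF f] B, of "2 ^ n"] by simp
    qed (use \<open>\<rho> > 0\<close> in simp)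
  qed
qed

end

text \<open>If f vanishes almost nowhere and ln |f| is integrable, dominated convergence identifies
  the infimum D with the exponential of the integral. Conversely D > 0 forces both conditions, so D
  = 0 whenever the default value 0 applies.\<close>

lemma exp_int_ln_circle_eq:
  assumes f: "continuous_on (sphere 0 1) f"
  shows "exp_int_ln_circle f = (INF \<epsilon>\<in>{0<..}. exp (avg (\<lambda>z. ln (cmod (f z) + \<epsilon>))))"
proof -
  define g where "g x = cmod (f (circ x))" for x
  define I where "I \<epsilon> = avg (\<lambda>z. ln (cmod (f z) + \<epsilon>))" for \<epsilon>
  define D where "D = (INF \<epsilon>\<in>{0<..}. exp (I \<epsilon>))"
  define s where "s n = inverse (real (Suc n))" for n
  have s: "s n > 0" "s n \<le> 1" for n by (auto simp: s_def inverse_le_1_iff)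
  have s0: "s \<longlonglongrightarrow> 0" unfolding s_def by (rule LIMSEQ_inverse_real_of_nat)
  have s_dec: "s n \<le> s m" if "m \<le> n" for m n using that by (auto simp: s_def)
  have g_nn: "g x \<ge> 0" for x by (simp add: g_def)
  have g_cont: "continuous_on A g" for A unfolding g_def
    by (intro continuous_on_norm continuous_on_compose2[OF f] continuous_on_circ) auto
  have pos: "g x + \<epsilon> > 0" if "\<epsilon> > 0" for x \<epsilon> using g_nn[of x] that by linarith
  have int: "set_integrable lborel {0..1} (\<lambda>x. ln (g x + \<epsilon>))" if "\<epsilon> > 0" for \<epsilon>
  proof -
    have "continuous_on {0..1} (\<lambda>x. ln (g x + \<epsilon>))"
      using pos[OF that] by (intro continuous_intros g_cont) (auto simp: less_le)
    thus ?thesis unfolding set_integrable_def by (rule borel_integrable_compact[OF compact_Icc])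
  qed
  have I_eq: "I \<epsilon> = (LBINT x:{0..1}. ln (g x + \<epsilon>))" for \<epsilon>
    by (simp add: I_def avg_def g_def)
  have D_le: "D \<le> exp (I \<epsilon>)" if "\<epsilon> > 0" for \<epsilon>
    unfolding D_def using that by (intro cINF_lower bdd_belowI2[of _ 0]) auto
  have D_ge: "c \<le> D" if "\<And>\<epsilon>. \<epsilon> > 0 \<Longrightarrow> c \<le> exp (I \<epsilon>)" for c
    unfolding D_def using that by (intro cINF_greatest) auto
  have D_nn: "D \<ge> 0" by (rule D_ge) simp
  have meas: "g \<in> borel_measurable borel" by (rule borel_measurable_continuous_onI[OF g_cont])
  define h where "h x = indicator {0..1} x *\<^sub>R ln (g x)" for x :: real
  define hn where "hn n x = indicator {0..1} x *\<^sub>R ln (g x + s n)" for n and x :: real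
  have hn_int: "integrable lborel (hn n)" for n
    using int[OF s(1)] unfolding hn_def set_integrable_def .
  have hn_I: "integral\<^sup>L lborel (hn n) = I (s n)" for n
    unfolding hn_def I_eq set_lebesgue_integral_def ..
  have h_meas: "h \<in> borel_measurable lborel" unfolding h_def using meas by measurable
  have lim: "(\<lambda>n. hn n x) \<longlonglongrightarrow> h x" if "x \<in> {0..1} \<longrightarrow> g x \<noteq> 0" for x
  proof (cases "x \<in> {0..1}")
    case True
    hence "(\<lambda>n. ln (g x + s n)) \<longlonglongrightarrow> ln (g x + 0)"
      using that by (intro tendsto_ln tendsto_add tendsto_const s0) auto
    thus ?thesis using True by (simp add: h_def hn_def)
  qed (simp add: h_def hn_def)
  let ?ae = "AE x\<in>{0..1} in lborel. g x \<noteq> 0"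
  let ?int = "set_integrable lborel {0..1} (\<lambda>x. ln (g x))"
  have main: "D = exp (LBINT x:{0..1}. ln (g x))" if ae: ?ae and int_h: ?int
  proof (rule antisym)
    have "(\<lambda>n. integral\<^sup>L lborel (hn n)) \<longlonglongrightarrow> integral\<^sup>L lborel h"
    proof (rule integral_dominated_convergence)
      \<comment> \<open>Off the zeros of g each \<open>hn n\<close> lies between the limit
        \<open>h\<close> and the first function \<open>hn 0\<close>, so the two absolute values
        together dominate.\<close>
      show "integrable lborel (\<lambda>x. \<bar>h x\<bar> + \<bar>hn 0 x\<bar>)"
        using int_h hn_int[of 0] unfolding h_def set_integrable_def
        by (intro Bochner_Integration.integrable_add integrable_abs)
      show "AE x in lborel. (\<lambda>n. hn n x) \<longlonglongrightarrow> h x" using ae lim by auto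
      show "AE x in lborel. norm (hn n x) \<le> \<bar>h x\<bar> + \<bar>hn 0 x\<bar>" for n
        using ae
      proof eventually_elim
        case (elim x)
        show ?case
        proof (cases "x \<in> {0..1}")
          case True
          hence "g x > 0" using elim g_nn[of x] by simp
          hence "ln (g x) \<le> ln (g x + s n)" "ln (g x + s n) \<le> ln (g x + s 0)"
            using s[of n] s_dec[of 0 n] by (auto intro!: ln_mono)
          thus ?thesis using True by (auto simp: h_def hn_def)
        qed (simp add: h_def hn_def)
      qed
    qed (use h_meas hn_int in auto)
    hence "(\<lambda>n. exp (I (s n))) \<longlonglongrightarrow> exp (LBINT x:{0..1}. ln (g x))"
      unfolding hn_I by (intro tendsto_exp) (simp add: h_def[abs_def] set_lebesgue_integral_def)
    thus "D \<le> exp (LBINT x:{0..1}. ln (g x))"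
      by (rule LIMSEQ_le_const) (use D_le s in auto)
    show "exp (LBINT x:{0..1}. ln (g x)) \<le> D"
    proof (rule D_ge)
      fix \<epsilon> :: real assume e: "\<epsilon> > 0"
      have "(LBINT x:{0..1}. ln (g x)) \<le> I \<epsilon>" unfolding I_eq
      proof (rule set_integral_mono_AE[OF int_h int[OF e]])
        show "AE x\<in>{0..1} in lborel. ln (g x) \<le> ln (g x + \<epsilon>)"
          using ae
        proof eventually_elim
          case (elim x)
          show ?case
          proof
            assume "x \<in> {0..1}"
            hence "g x > 0" using elim g_nn[of x] by simp
            thus "ln (g x) \<le> ln (g x + \<epsilon>)" using e by (intro ln_mono) auto
          qed
        qed
      qed
      thus "exp (LBINT x:{0..1}. ln (g x)) \<le> exp (I \<epsilon>)" by simp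
    qed
  qed
  have pos_ae: ?ae if Dpos: "D > 0"
  proof -
    define Z where "Z = {x\<in>{0..1}. g x = 0}"
    have Z: "Z \<in> sets lborel" unfolding Z_def using meas by measurable
    have fin: "emeasure lborel Z \<noteq> \<infinity>"
    proof -
      have "emeasure lborel Z \<le> emeasure lborel {0..1::real}" by (rule emeasure_mono) (auto simp: Z_def)
      thus ?thesis by (auto simp: top_unique)
    qed
    define m where "m = measure lborel Z"
    obtain K where K: "\<And>x. x \<in> {0..1} \<Longrightarrow> g x \<le> K" "K \<ge> 0"
    proof -
      obtain y where "y \<in> {0..1}" "\<And>x. x \<in> {0..1} \<Longrightarrow> g x \<le> g y"
        using continuous_attains_sup[of "{0..1::real}" g] g_cont by auto
      thus ?thesis using that g_nn by blast
    qed
    \<comment> \<open>On the zero set Z the integrand is ln \<epsilon>, elsewhere at most ln (K +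
      1); a zero set of positive measure m would thus push the averages to minus infinity.\<close>
    have I_le: "I \<epsilon> \<le> m * ln \<epsilon> + ln (K + 1)" if e: "\<epsilon> > 0" "\<epsilon> \<le> 1" for \<epsilon>
    proof -
      have iZ: "integrable lborel (\<lambda>x. indicator Z x * ln \<epsilon>)"
        using Z fin by (intro integrable_mult_left) (auto simp: less_top)
      have iK: "integrable lborel (\<lambda>x. indicator {0..1::real} x * ln (K + 1))"
        by (intro integrable_mult_left) auto
      have "I \<epsilon> \<le> (LBINT x. indicator Z x * ln \<epsilon> + indicator {0..1} x * ln (K + 1))"
        unfolding I_eq set_lebesgue_integral_def
      proof (rule integral_mono)
        show "integrable lborel (\<lambda>x. indicat_real {0..1} x *\<^sub>R ln (g x + \<epsilon>))"
          using int[OF e(1)] by (simp only: set_integrable_def)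
        fix x :: real
        show "indicat_real {0..1} x *\<^sub>R ln (g x + \<epsilon>) \<le> indicator Z x * ln \<epsilon> + indicator {0..1} x * ln (K + 1)"
        proof (cases "x \<in> {0..1}")
          case True
          have "ln (g x + \<epsilon>) \<le> ln (K + 1)" using K(1)[OF True] e pos[OF e(1), of x] by (intro ln_mono) auto
          moreover have "ln (K + 1) \<ge> 0" using K(2) by simp
          ultimately show ?thesis using True by (auto simp: Z_def indicator_def)
        qed (auto simp: Z_def indicator_def)
      qed (intro Bochner_Integration.integrable_add iZ iK)
      also have "\<dots> = m * ln \<epsilon> + ln (K + 1)"
        using iZ iK Z fin by (subst Bochner_Integration.integral_add) (auto simp: m_def)
      finally show ?thesis .
    qed
    have "m = 0"
    proof (rule ccontr)
      assume "m \<noteq> 0"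
      hence m: "m > 0" by (simp add: m_def less_le)
      \<comment> \<open>With this t the bound m t + ln (K + 1) equals ln D - 1, below the lower
        bound ln D; the minimum with 0 keeps \<epsilon> \<le> 1.\<close>
      define t where "t = (ln D - ln (K + 1) - 1) / m"
      define \<epsilon> where "\<epsilon> = exp (min 0 t)"
      have "ln D \<le> I \<epsilon>" using D_le[of \<epsilon>] Dpos by (metis \<epsilon>_def exp_gt_zero ln_exp ln_le_cancel_iff)
      also have "I \<epsilon> \<le> m * ln \<epsilon> + ln (K + 1)" by (rule I_le) (auto simp: \<epsilon>_def)
      also have "m * ln \<epsilon> \<le> m * t" using m by (simp add: \<epsilon>_def)
      also have "m * t = ln D - ln (K + 1) - 1" using m by (simp add: t_def)
      finally show False by simp
    qed
    hence "Z \<in> null_sets lborel" using Z fin by (auto simp: null_sets_def m_def measure_def enn2real_eq_0_iff)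
    thus ?ae by (rule AE_I') (auto simp: Z_def)
  qed
  have pos_int: ?int if Dpos: "D > 0"
  proof -
    \<comment> \<open>The averages decrease with \<epsilon> and stay above ln D, so monotone
      convergence for their negatives yields integrability of the limit.\<close>
    have "incseq (\<lambda>n. - I (s n))"
    proof (rule incseq_SucI)
      fix n
      have "I (s (Suc n)) \<le> I (s n)" unfolding I_eq
        by (intro set_integral_mono int s ln_mono pos add_left_mono s_dec) auto
      thus "- I (s n) \<le> - I (s (Suc n))" by simp
    qed
    moreover have "- I (s n) \<le> - ln D" for n
      using D_le[OF s(1), of n] Dpos by (metis exp_gt_zero ln_exp ln_le_cancel_iff neg_le_iff_le)
    ultimately obtain L where L: "(\<lambda>n. - I (s n)) \<longlonglongrightarrow> L"
      using incseq_convergent[of "\<lambda>n. - I (s n)" "- ln D"] by blast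
    have "integrable lborel (\<lambda>x. - h x)"
    proof (rule integrable_monotone_convergence[where f = "\<lambda>n x. - hn n x"])
      show "AE x in lborel. mono (\<lambda>n. - hn n x)"
      proof (rule AE_I2, rule monoI)
        fix x :: real and i j :: nat assume "i \<le> j"
        hence "ln (g x + s j) \<le> ln (g x + s i)" using pos[OF s(1)[of j], of x] s_dec[of i j] by (intro ln_mono) auto
        thus "- hn i x \<le> - hn j x" by (simp add: hn_def indicator_def)
      qed
      show "AE x in lborel. (\<lambda>n. - hn n x) \<longlonglongrightarrow> - h x"
        using pos_ae[OF Dpos] by eventually_elim (intro tendsto_minus lim, simp)
      show "(\<lambda>n. integral\<^sup>L lborel (\<lambda>x. - hn n x)) \<longlonglongrightarrow> L" using L by (simp add: hn_I)
    qed (use hn_int h_meas in auto)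
    hence "integrable lborel h" by simp
    thus ?int by (simp add: h_def[abs_def] set_integrable_def)
  qed
  have "exp_int_ln_circle f = (if ?ae \<and> ?int then exp (LBINT x:{0..1}. ln (g x)) else 0)"
    unfolding exp_int_ln_circle_def g_def circ_def Let_def ..
  also have "\<dots> = D" using main pos_ae pos_int D_nn by (auto simp: less_le)
  finally show ?thesis by (simp add: D_def I_def)
qed

context rotation_pair
begin

lemma fk_det_cfc:
  assumes f: "continuous_on \<S> f" and \<tau>: "\<tau> = trace_of R"
  shows "fk_det R (cfc v f) = mahler f"
proof -
  have "Re (trace_of R (cfc (abs_op (cfc v f)) (\<lambda>z. complex_of_real (ln (Re z + \<epsilon>))))) =
      avg (\<lambda>z. ln (cmod (f z) + \<epsilon>))" if "\<epsilon> \<in> {0<..}" for \<epsilon>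
  proof -
    have e: "\<epsilon> > 0" using that by simp
    have "continuous_on \<S> (\<lambda>z. complex_of_real (ln (cmod (f z) + \<epsilon>)))"
      by (intro continuous_on_of_real continuous_on_ln_cmod f e)
    thus ?thesis unfolding cfc_abs_op_calc[OF f e] \<tau>[symmetric]
      by (simp add: trace_cfc avg_of_real)
  qed
  thus ?thesis unfolding fk_det_def mahler_def by (intro INF_cong) auto
qed

end

theorem theorem2p3:
  fixes R :: "('h::complex_hilbert \<Rightarrow>\<^sub>L 'h) set"
    and u v :: "'h \<Rightarrow>\<^sub>L 'h"
    and \<theta> :: real
    and f :: "complex \<Rightarrow> complex"
  assumes "II1_factor R" and "hyperfinite R"
    and "0 < \<theta>" and "\<theta> < 1" and "\<theta> \<notin> \<rat>"
    and "u \<in> R" and "v \<in> R" and "unitary u" and "unitary v"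
    and "R = commutant (commutant {u, v})"
    and "v o\<^sub>L u = scalar_op (exp (2 * complex_of_real pi * \<i> * complex_of_real \<theta>)) o\<^sub>L (u o\<^sub>L v)"
    and "continuous_on (sphere 0 1) f"
  shows "spectral_radius (u o\<^sub>L cfc v f) = fk_det R (cfc v f) \<and>
         fk_det R (cfc v f) = exp_int_ln_circle f"
proof -
  have "\<exists>\<tau>. faithful_normal_tracial_state R \<tau>" using assms(1) by (simp add: II1_factor_def)
  hence tr: "faithful_normal_tracial_state R (trace_of R)" unfolding trace_of_def by (rule someI_ex)
  interpret rotation_pair R u v \<theta> "trace_of R"
    using assms tr by unfold_locales (auto simp: II1_factor_def factor_def circ_def)
  show ?thesis
    using spectral_radius_eq_mahler[OF assms(12)] fk_det_cfc[OF assms(12) refl]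
      exp_int_ln_circle_eq[OF assms(12)] by (simp add: mahler_def)
qed

end
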